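(* Let $f:N^5\to M^6$ be an immersion of an oriented $5$-manifold into a (oriented) $6$-manifold with a nearly Kähler structure $(F,\Psi_+,\Psi_-)$, with unit normal vector field $\mathbb{N}$. Then the $SU(2)$-structure induced on $N^5$, $$\eta=-\mathbb{N}\lrcorner F,\quad \omega_1=f^*F,\quad \omega_2=\mathbb{N}\lrcorner\Psi_-,\quad \omega_3=-\mathbb{N}\lrcorner\Psi_+$$ (all forms pulled back to $N^5$), is a nearly hypo structure, i.e. $d\omega_1=3\eta\wedge\omega_2$ and $d(\eta\wedge\omega_3)=-2\omega_1\wedge\omega_1$.
   Context: An $SU(3)$-structure on a $6$-manifold is a triple $(F,\Psi_+,\Psi_-)$ such that locally there is a coframe $e^1,\dots,e^6$ with $F=e^{12}+e^{34}+e^{56}$, $\Psi_++i\Psi_-=(e^1+ie^2)\wedge(e^3+ie^4)\wedge(e^5+ie^6)$; its metric makes this coframe orthonormal. It is nearly Kähler if $dF=3\Psi_+$ and $d\Psi_-=-2F\wedge F$. An $SU(2)$-structure on a $5$-manifold is a quadruplet $(\eta,\omega_1,\omega_2,\omega_3)$ of a $1$-form $\eta$ and $2$-forms $\omega_i$ with $\omega_i\wedge\omega_j=\delta_{ij}v$ for some $4$-form $v$ with $v\wedge\eta$ nowhere zero, and such that $X\lrcorner\omega_1=Y\lrcorner\omega_2$ implies $\omega_3(X,Y)\ge 0$. *)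

theory Defs
  imports "HOL-Analysis.Analysis" "HOL-Combinatorics.Permutations"
begin

primrec ck_on :: "nat \<Rightarrow> 'v::real_normed_vector set \<Rightarrow> ('v \<Rightarrow> 'w::real_normed_vector) \<Rightarrow> bool" where
  "ck_on 0 S f \<longleftrightarrow> continuous_on S f"
| "ck_on (Suc k) S f \<longleftrightarrow> (\<forall>x\<in>S. f differentiable (at x)) \<and>
     (\<forall>v. ck_on k S (\<lambda>x. frechet_derivative f (at x) v))"

text \<open>Only used for open sets \<open>S\<close> (of Euclidean spaces).\<close>

definition smooth_on :: "'v::real_normed_vector set \<Rightarrow> ('v \<Rightarrow> 'w::real_normed_vector) \<Rightarrow> bool" where
  "smooth_on S f \<longleftrightarrow> (\<forall>k. ck_on k S f)"

text \<open>A manifold is a whole type \<open>'m\<close> whose topology is Hausdorff and second countable,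
  together with a (not necessarily maximal) smooth atlas. A chart is its domain together with
  its coordinate map; the values of the coordinate map outside the domain are irrelevant.\<close>

type_synonym ('m, 'd) chart = "'m set \<times> ('m \<Rightarrow> real ^ 'd)"

definition chart_inv :: "('m, 'd::finite) chart \<Rightarrow> real ^ 'd \<Rightarrow> 'm" where
  "chart_inv c = inv_into (fst c) (snd c)"

definition is_chart :: "('m::topological_space, 'd::finite) chart \<Rightarrow> bool" where
  "is_chart c \<longleftrightarrow> open (fst c) \<and> open (snd c ` fst c) \<and>
     homeomorphism (fst c) (snd c ` fst c) (snd c) (chart_inv c)"

definition transition :: "('m, 'd::finite) chart \<Rightarrow> ('m, 'd) chart \<Rightarrow> real ^ 'd \<Rightarrow> real ^ 'd" where
  "transition c c' = snd c' \<circ> chart_inv c"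

definition smooth_atlas ::
    "('m::{t2_space, second_countable_topology}, 'd::finite) chart set \<Rightarrow> bool" where
  "smooth_atlas A \<longleftrightarrow> (\<forall>c\<in>A. is_chart c) \<and> (\<Union>c\<in>A. fst c) = UNIV \<and>
     (\<forall>c\<in>A. \<forall>c'\<in>A. smooth_on (snd c ` (fst c \<inter> fst c')) (transition c c'))"

definition oriented_atlas ::
    "('m::{t2_space, second_countable_topology}, 'd::finite) chart set \<Rightarrow> bool" where
  "oriented_atlas A \<longleftrightarrow> smooth_atlas A \<and>
     (\<forall>c\<in>A. \<forall>c'\<in>A. \<forall>x\<in>snd c ` (fst c \<inter> fst c').
        0 < det (matrix (frechet_derivative (transition c c') (at x))))"

definition charts_at :: "('m, 'd::finite) chart set \<Rightarrow> 'm \<Rightarrow> ('m, 'd) chart set" where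
  "charts_at A p = {c\<in>A. p \<in> fst c}"

definition chart_at :: "('m, 'd::finite) chart set \<Rightarrow> 'm \<Rightarrow> ('m, 'd) chart" where
  "chart_at A p = (SOME c. c \<in> charts_at A p)"

text \<open>A tangent vector at \<open>p\<close> is the family of its coordinate vectors in all charts around \<open>p\<close>,
  which are related by the derivatives of the transition maps. The entries at charts not
  containing \<open>p\<close> carry no information and are set to 0.\<close>

type_synonym ('m, 'd) tvec = "('m, 'd) chart \<Rightarrow> real ^ 'd"

definition tangent_space :: "('m, 'd::finite) chart set \<Rightarrow> 'm \<Rightarrow> ('m, 'd) tvec set" where
  "tangent_space A p = {v.
     (\<forall>c\<in>charts_at A p. \<forall>c'\<in>charts_at A p.
        v c' = frechet_derivative (transition c c') (at (snd c p)) (v c)) \<and>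
     (\<forall>c. c \<notin> charts_at A p \<longrightarrow> v c = 0)}"

text \<open>The tangent vector at \<open>p\<close> with coordinate vector \<open>w\<close> in the chart \<open>c\<close>.\<close>

definition tvec_of ::
    "('m, 'd::finite) chart set \<Rightarrow> ('m, 'd) chart \<Rightarrow> 'm \<Rightarrow> real ^ 'd \<Rightarrow> ('m, 'd) tvec" where
  "tvec_of A c p w = (\<lambda>c'. if c' \<in> charts_at A p
     then frechet_derivative (transition c c') (at (snd c p)) w else 0)"

definition tcomb :: "real \<Rightarrow> ('m, 'd::finite) tvec \<Rightarrow> real \<Rightarrow> ('m, 'd) tvec \<Rightarrow> ('m, 'd) tvec" where
  "tcomb a v b w = (\<lambda>c. a *\<^sub>R v c + b *\<^sub>R w c)"

text \<open>A \<open>k\<close>-form at a point takes a sequence of tangent vectors, of which only the entries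
  \<open>0, \<dots>, k - 1\<close> are relevant. What it does outside the tangent space is irrelevant, so that
  forms are compared by \<open>form_eq\<close> instead of equality.\<close>

definition alt_form ::
    "('m, 'd::finite) tvec set \<Rightarrow> nat \<Rightarrow> ((nat \<Rightarrow> ('m, 'd) tvec) \<Rightarrow> real) \<Rightarrow> bool" where
  "alt_form T k \<alpha> \<longleftrightarrow>
     (\<forall>v w. (\<forall>i<k. v i \<in> T \<and> v i = w i) \<longrightarrow> \<alpha> v = \<alpha> w) \<and>
     (\<forall>v i a x b y. (\<forall>j<k. v j \<in> T) \<and> i < k \<and> x \<in> T \<and> y \<in> T \<longrightarrow>
        \<alpha> (v(i := tcomb a x b y)) = a * \<alpha> (v(i := x)) + b * \<alpha> (v(i := y))) \<and>
     (\<forall>v i j. (\<forall>l<k. v l \<in> T) \<and> i < j \<and> j < k \<and> v i = v j \<longrightarrow> \<alpha> v = 0)"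

definition form_eq :: "'v set \<Rightarrow> nat \<Rightarrow> ((nat \<Rightarrow> 'v) \<Rightarrow> 'a) \<Rightarrow> ((nat \<Rightarrow> 'v) \<Rightarrow> 'a) \<Rightarrow> bool" where
  "form_eq T k \<alpha> \<beta> \<longleftrightarrow> (\<forall>v. (\<forall>i<k. v i \<in> T) \<longrightarrow> \<alpha> v = \<beta> v)"

text \<open>Wedge product of a \<open>k\<close>-form and an \<open>l\<close>-form, real or complex valued, normalised such that
  \<open>(e \<and> e')(X, Y) = e(X) e'(Y) - e(Y) e'(X)\<close> for 1-forms.\<close>

definition wedge :: "nat \<Rightarrow> nat \<Rightarrow> ((nat \<Rightarrow> 'v) \<Rightarrow> 'a::field_char_0) \<Rightarrow> ((nat \<Rightarrow> 'v) \<Rightarrow> 'a) \<Rightarrow>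
    (nat \<Rightarrow> 'v) \<Rightarrow> 'a" where
  "wedge k l \<alpha> \<beta> v = (\<Sum>\<sigma> | \<sigma> permutes {..<k + l}.
     of_int (sign \<sigma>) * \<alpha> (\<lambda>i. v (\<sigma> i)) * \<beta> (\<lambda>i. v (\<sigma> (k + i)))) / (fact k * fact l)"

definition contract :: "'v \<Rightarrow> ((nat \<Rightarrow> 'v) \<Rightarrow> 'a) \<Rightarrow> (nat \<Rightarrow> 'v) \<Rightarrow> 'a" where
  "contract X \<alpha> v = \<alpha> (case_nat X v)"

type_synonym ('m, 'd) form = "'m \<Rightarrow> (nat \<Rightarrow> ('m, 'd) tvec) \<Rightarrow> real"

definition smooth_form_on ::
    "('m::topological_space, 'd::finite) chart set \<Rightarrow> nat \<Rightarrow> 'm set \<Rightarrow> ('m, 'd) form \<Rightarrow> bool" where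
  "smooth_form_on A k U \<alpha> \<longleftrightarrow>
     (\<forall>p\<in>U. alt_form (tangent_space A p) k (\<alpha> p)) \<and>
     (\<forall>c\<in>A. \<forall>w. smooth_on (snd c ` (fst c \<inter> U))
        (\<lambda>x. \<alpha> (chart_inv c x) (\<lambda>i. tvec_of A c (chart_inv c x) (w i))))"

abbreviation "smooth_form A k \<equiv> smooth_form_on A k UNIV"

text \<open>Exterior derivative of a \<open>k\<close>-form, computed with the usual coordinate formula
  \<open>d\<alpha>(v\<^sub>0, \<dots>, v\<^sub>k) = \<Sum>\<^sub>i (-1)\<^sup>i D\<alpha>(v\<^sub>i)(v\<^sub>0, \<dots>, v\<^sub>i\<^sub>-\<^sub>1, v\<^sub>i\<^sub>+\<^sub>1, \<dots>, v\<^sub>k)\<close> in an arbitrary chart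
  around the point; for smooth \<open>\<alpha>\<close> the result does not depend on that chart.\<close>

definition ext_d :: "('m, 'd::finite) chart set \<Rightarrow> nat \<Rightarrow> ('m, 'd) form \<Rightarrow> ('m, 'd) form" where
  "ext_d A k \<alpha> p v = (let c = chart_at A p in
     \<Sum>i\<le>k. (- 1) ^ i * frechet_derivative
       (\<lambda>x. \<alpha> (chart_inv c x)
          (\<lambda>j. tvec_of A c (chart_inv c x) (v (if j < i then j else Suc j) c)))
       (at (snd c p)) (v i c))"

definition local_rep :: "('m, 'd::finite) chart \<Rightarrow> ('n, 'e::finite) chart \<Rightarrow> ('m \<Rightarrow> 'n) \<Rightarrow>
    real ^ 'd \<Rightarrow> real ^ 'e" where
  "local_rep c c' f = snd c' \<circ> f \<circ> chart_inv c"

definition smooth_map ::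
    "('m::topological_space, 'd::finite) chart set \<Rightarrow> ('n::topological_space, 'e::finite) chart set \<Rightarrow>
     ('m \<Rightarrow> 'n) \<Rightarrow> bool" where
  "smooth_map A B f \<longleftrightarrow> continuous_on UNIV f \<and>
     (\<forall>c\<in>A. \<forall>c'\<in>B. smooth_on (snd c ` (fst c \<inter> f -` fst c')) (local_rep c c' f))"

text \<open>The differential of \<open>f\<close> at \<open>p\<close>; for smooth \<open>f\<close> and tangent vectors \<open>v\<close> at \<open>p\<close> it does not
  depend on the chart around \<open>p\<close>.\<close>

definition differential ::
    "('m, 'd::finite) chart set \<Rightarrow> ('n, 'e::finite) chart set \<Rightarrow> ('m \<Rightarrow> 'n) \<Rightarrow> 'm \<Rightarrow>
     ('m, 'd) tvec \<Rightarrow> ('n, 'e) tvec" where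
  "differential A B f p v = (let c = chart_at A p in
     (\<lambda>c'. if c' \<in> charts_at B (f p)
           then frechet_derivative (local_rep c c' f) (at (snd c p)) (v c) else 0))"

definition immersion ::
    "('m::topological_space, 'd::finite) chart set \<Rightarrow> ('n::topological_space, 'e::finite) chart set \<Rightarrow>
     ('m \<Rightarrow> 'n) \<Rightarrow> bool" where
  "immersion A B f \<longleftrightarrow> smooth_map A B f \<and>
     (\<forall>p. inj_on (differential A B f p) (tangent_space A p))"

text \<open>\<open>pull\<close> turns a form \<open>\<beta>\<close> along \<open>f\<close>, i.e. with \<open>\<beta> p\<close> a form on the tangent space of the target
  at \<open>f p\<close>, into a form on the source; the pullback of a form of the target is the special case
  \<open>\<beta> p = \<alpha> (f p)\<close>.\<close>

definition pull ::
    "('m, 'd::finite) chart set \<Rightarrow> ('n, 'e::finite) chart set \<Rightarrow> ('m \<Rightarrow> 'n) \<Rightarrow>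
     ('m \<Rightarrow> (nat \<Rightarrow> ('n, 'e) tvec) \<Rightarrow> real) \<Rightarrow> ('m, 'd) form" where
  "pull A B f \<beta> = (\<lambda>p v. \<beta> p (\<lambda>i. differential A B f p (v i)))"

definition pullback ::
    "('m, 'd::finite) chart set \<Rightarrow> ('n, 'e::finite) chart set \<Rightarrow> ('m \<Rightarrow> 'n) \<Rightarrow>
     ('n, 'e) form \<Rightarrow> ('m, 'd) form" where
  "pullback A B f \<alpha> = pull A B f (\<lambda>p. \<alpha> (f p))"

definition smooth_field_along ::
    "('m, 'd::finite) chart set \<Rightarrow> ('n, 'e::finite) chart set \<Rightarrow> ('m \<Rightarrow> 'n) \<Rightarrow>
     ('m \<Rightarrow> ('n, 'e) tvec) \<Rightarrow> bool" where
  "smooth_field_along A B f \<nu> \<longleftrightarrow> (\<forall>p. \<nu> p \<in> tangent_space B (f p)) \<and>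
     (\<forall>c\<in>A. \<forall>c'\<in>B. smooth_on (snd c ` (fst c \<inter> f -` fst c')) (\<lambda>x. \<nu> (chart_inv c x) c'))"

definition coframe_on ::
    "('m::topological_space, 'd::finite) chart set \<Rightarrow> 'm set \<Rightarrow> (nat \<Rightarrow> ('m, 'd) form) \<Rightarrow> bool" where
  "coframe_on A U e \<longleftrightarrow> (\<forall>i\<in>{1..CARD('d)}. smooth_form_on A 1 U (e i)) \<and>
     (\<forall>p\<in>U. \<forall>a. form_eq (tangent_space A p) 1
          (\<lambda>v. \<Sum>i\<in>{1..CARD('d)}. a i * e i p v) (\<lambda>v. 0)
        \<longrightarrow> (\<forall>i\<in>{1..CARD('d)}. a i = 0))"

definition adapted_coframe_on ::
    "('m::topological_space, 6) chart set \<Rightarrow> ('m, 6) form \<Rightarrow> ('m, 6) form \<Rightarrow> ('m, 6) form \<Rightarrow>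
     'm set \<Rightarrow> (nat \<Rightarrow> ('m, 6) form) \<Rightarrow> bool" where
  "adapted_coframe_on A F \<Psi>p \<Psi>m U e \<longleftrightarrow> coframe_on A U e \<and>
     (\<forall>p\<in>U.
        form_eq (tangent_space A p) 2 (F p)
          (\<lambda>v. wedge 1 1 (e 1 p) (e 2 p) v + wedge 1 1 (e 3 p) (e 4 p) v
             + wedge 1 1 (e 5 p) (e 6 p) v) \<and>
        form_eq (tangent_space A p) 3
          (\<lambda>v. of_real (\<Psi>p p v) + \<i> * of_real (\<Psi>m p v) :: complex)
          (wedge 2 1
             (wedge 1 1 (\<lambda>v. of_real (e 1 p v) + \<i> * of_real (e 2 p v))
                        (\<lambda>v. of_real (e 3 p v) + \<i> * of_real (e 4 p v)))
             (\<lambda>v. of_real (e 5 p v) + \<i> * of_real (e 6 p v))))"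

definition su3_structure ::
    "('m::topological_space, 6) chart set \<Rightarrow> ('m, 6) form \<Rightarrow> ('m, 6) form \<Rightarrow> ('m, 6) form \<Rightarrow> bool" where
  "su3_structure A F \<Psi>p \<Psi>m \<longleftrightarrow>
     smooth_form A 2 F \<and> smooth_form A 3 \<Psi>p \<and> smooth_form A 3 \<Psi>m \<and>
     (\<forall>p. \<exists>U e. open U \<and> p \<in> U \<and> adapted_coframe_on A F \<Psi>p \<Psi>m U e)"

text \<open>The metric making adapted coframes orthonormal. It does not depend on the chosen coframe,
  since adapted coframes at a point are related by elements of \<open>SU(3) \<subseteq> SO(6)\<close>.\<close>

definition su3_metric ::
    "('m::topological_space, 6) chart set \<Rightarrow> ('m, 6) form \<Rightarrow> ('m, 6) form \<Rightarrow> ('m, 6) form \<Rightarrow>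
     'm \<Rightarrow> ('m, 6) tvec \<Rightarrow> ('m, 6) tvec \<Rightarrow> real" where
  "su3_metric A F \<Psi>p \<Psi>m p X Y =
     (let e = (SOME e. \<exists>U. open U \<and> p \<in> U \<and> adapted_coframe_on A F \<Psi>p \<Psi>m U e)
      in \<Sum>i\<in>{1..6}. e i p (\<lambda>_. X) * e i p (\<lambda>_. Y))"

definition nearly_kaehler ::
    "('m::topological_space, 6) chart set \<Rightarrow> ('m, 6) form \<Rightarrow> ('m, 6) form \<Rightarrow> ('m, 6) form \<Rightarrow> bool" where
  "nearly_kaehler A F \<Psi>p \<Psi>m \<longleftrightarrow> su3_structure A F \<Psi>p \<Psi>m \<and>
     (\<forall>p. form_eq (tangent_space A p) 3 (ext_d A 2 F p) (\<lambda>v. 3 * \<Psi>p p v)) \<and>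
     (\<forall>p. form_eq (tangent_space A p) 4 (ext_d A 3 \<Psi>m p) (\<lambda>v. - 2 * wedge 2 2 (F p) (F p) v))"

definition unit_normal_field ::
    "('m::topological_space, 5) chart set \<Rightarrow> ('n::topological_space, 6) chart set \<Rightarrow> ('m \<Rightarrow> 'n) \<Rightarrow>
     ('n, 6) form \<Rightarrow> ('n, 6) form \<Rightarrow> ('n, 6) form \<Rightarrow> ('m \<Rightarrow> ('n, 6) tvec) \<Rightarrow> bool" where
  "unit_normal_field A B f F \<Psi>p \<Psi>m \<nu> \<longleftrightarrow> smooth_field_along A B f \<nu> \<and>
     (\<forall>p. su3_metric B F \<Psi>p \<Psi>m (f p) (\<nu> p) (\<nu> p) = 1 \<and>
        (\<forall>X\<in>tangent_space A p.
           su3_metric B F \<Psi>p \<Psi>m (f p) (\<nu> p) (differential A B f p X) = 0))"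

text \<open>The 2-forms \<open>\<omega>\<^sub>1, \<omega>\<^sub>2, \<omega>\<^sub>3\<close> are given as a family \<open>\<omega>\<close> indexed by \<open>{1..3}\<close>.\<close>

definition su2_structure ::
    "('m::topological_space, 5) chart set \<Rightarrow> ('m, 5) form \<Rightarrow> (nat \<Rightarrow> ('m, 5) form) \<Rightarrow> bool" where
  "su2_structure A \<eta> \<omega> \<longleftrightarrow>
     smooth_form A 1 \<eta> \<and> (\<forall>i\<in>{1..3}. smooth_form A 2 (\<omega> i)) \<and>
     (\<exists>\<upsilon>. smooth_form A 4 \<upsilon> \<and>
        (\<forall>i\<in>{1..3}. \<forall>j\<in>{1..3}. \<forall>p. form_eq (tangent_space A p) 4
           (wedge 2 2 (\<omega> i p) (\<omega> j p)) (\<lambda>v. if i = j then \<upsilon> p v else 0)) \<and>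
        (\<forall>p. \<not> form_eq (tangent_space A p) 5 (wedge 4 1 (\<upsilon> p) (\<eta> p)) (\<lambda>v. 0))) \<and>
     (\<forall>p. \<forall>X\<in>tangent_space A p. \<forall>Y\<in>tangent_space A p.
        form_eq (tangent_space A p) 1 (contract X (\<omega> 1 p)) (contract Y (\<omega> 2 p)) \<longrightarrow>
        0 \<le> contract X (\<omega> 3 p) (\<lambda>_. Y))"

definition nearly_hypo ::
    "('m::topological_space, 5) chart set \<Rightarrow> ('m, 5) form \<Rightarrow> (nat \<Rightarrow> ('m, 5) form) \<Rightarrow> bool" where
  "nearly_hypo A \<eta> \<omega> \<longleftrightarrow> su2_structure A \<eta> \<omega> \<and>
     (\<forall>p. form_eq (tangent_space A p) 3
        (ext_d A 2 (\<omega> 1) p) (\<lambda>v. 3 * wedge 1 2 (\<eta> p) (\<omega> 2 p) v)) \<and>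
     (\<forall>p. form_eq (tangent_space A p) 4
        (ext_d A 3 (\<lambda>q. wedge 1 2 (\<eta> q) (\<omega> 3 q)) p)
        (\<lambda>v. - 2 * wedge 2 2 (\<omega> 1 p) (\<omega> 1 p) v))"

end

theory Submission
  imports Defs
begin

text \<open>The two equations come from exterior derivatives that are known on the target, pulled back to
  the hypersurface. For this the forms must satisfy, at every point of the hypersurface,
  \<open>f\<^sup>*\<Psi>\<^sub>+ = \<eta> \<and> \<omega>\<^sub>2\<close> and \<open>f\<^sup>*\<Psi>\<^sub>- = \<eta> \<and> \<omega>\<^sub>3\<close>, besides \<open>f\<^sup>*F = \<omega>\<^sub>1\<close>. Then
  \<open>d\<omega>\<^sub>1 = f\<^sup>*dF = 3 f\<^sup>*\<Psi>\<^sub>+ = 3 \<eta> \<and> \<omega>\<^sub>2\<close> and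
  \<open>d(\<eta> \<and> \<omega>\<^sub>3) = f\<^sup>*d\<Psi>\<^sub>- = - 2 f\<^sup>*(F \<and> F) = - 2 \<omega>\<^sub>1 \<and> \<omega>\<^sub>1\<close>.

  The pointwise identities are obtained from a normal form. In the complex coordinates of an adapted
  coframe, \<open>F\<close> is the imaginary part and the metric the real part of the Hermitian product, and
  \<open>\<Psi>\<^sub>+ + i\<Psi>\<^sub>-\<close> is the determinant. The unit normal is a unit vector of complex three-space and
  extends to a unitary frame of determinant 1 (\<open>ex_unit_orthogonal\<close>, \<open>hprod_unitary_frame\<close>,
  \<open>cvol_unitary_frame\<close>). With respect to that frame a tangent vector of the hypersurface has
  coordinates \<open>(i\<epsilon>\<^sub>2, \<epsilon>\<^sub>3 + i\<epsilon>\<^sub>4, \<epsilon>\<^sub>5 + i\<epsilon>\<^sub>6)\<close> and the normal has coordinates \<open>(1, 0, 0)\<close>, so that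
  \<open>\<eta> = -\<epsilon>\<^sub>2\<close>, \<open>\<omega>\<^sub>1 = \<epsilon>\<^sub>3 \<and> \<epsilon>\<^sub>4 + \<epsilon>\<^sub>5 \<and> \<epsilon>\<^sub>6\<close>, \<open>\<omega>\<^sub>2 = \<epsilon>\<^sub>3 \<and> \<epsilon>\<^sub>6 + \<epsilon>\<^sub>4 \<and> \<epsilon>\<^sub>5\<close>,
  \<open>\<omega>\<^sub>3 = \<epsilon>\<^sub>4 \<and> \<epsilon>\<^sub>6 - \<epsilon>\<^sub>3 \<and> \<epsilon>\<^sub>5\<close>
  (\<open>hypersurface_normal_form\<close>). The differential of an immersion is injective, hence the five
  functionals separate tangent vectors and, by dimension, form a coframe. All conditions on an
  SU(2)-structure can then be read off (locale \<open>su2_coframe\<close>).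

  What remains is that \<open>d\<close> commutes with pullback (\<open>ext_d_pullback\<close>). The exterior derivative is
  given by the coordinate formula, so this is the chain rule: the terms with second derivatives of
  the map cancel in pairs, because second derivatives are symmetric
  (\<open>symmetric_second_derivative\<close>, \<open>alternating_sum_symmetric_slot_eq_0\<close>).\<close>

section \<open>Calculus of smooth maps on open sets\<close>

lemma ck_on_cong:
  assumes "open S" "\<And>x. x \<in> S \<Longrightarrow> f x = g x" "ck_on k S f"
  shows "ck_on k S g"
  using assms(2,3)
proof (induction k arbitrary: f g)
  case 0
  then show ?case by (simp cong: continuous_on_cong)
next
  case (Suc k)
  have d: "f differentiable (at x)" if "x \<in> S" for x
    using Suc.prems that by simp
  have eq: "frechet_derivative f (at x) = frechet_derivative g (at x)" if "x \<in> S" for x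
    using frechet_derivative_transform_within_open[OF d assms(1)] Suc.prems(1) that by blast
  have "g differentiable (at x)" if "x \<in> S" for x
    using d[OF that] \<open>open S\<close> that Suc.prems(1)
    unfolding differentiable_def by (meson has_derivative_transform_within_open)
  moreover have "ck_on k S (\<lambda>x. frechet_derivative g (at x) v)" for v
    using Suc.IH[of "\<lambda>x. frechet_derivative f (at x) v"] Suc.prems(2) eq by simp
  ultimately show ?case by simp
qed

lemma ck_on_local:
  assumes "\<And>x. x \<in> S \<Longrightarrow> \<exists>T. open T \<and> x \<in> T \<and> ck_on k T f"
  shows "ck_on k S f"
  using assms
proof (induction k arbitrary: f)
  case 0
  then show ?case
    by (auto intro!: continuous_at_imp_continuous_on simp: continuous_on_eq_continuous_at)
       (metis continuous_on_eq_continuous_at)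
next
  case (Suc k)
  have "f differentiable (at x)" if "x \<in> S" for x
    using Suc.prems[OF that] by auto
  moreover have "ck_on k S (\<lambda>x. frechet_derivative f (at x) v)" for v
    using Suc.prems by (intro Suc.IH) (metis ck_on.simps(2))
  ultimately show ?case by simp
qed

lemma ck_on_Suc_imp: "ck_on (Suc k) S f \<Longrightarrow> ck_on k S f"
  by (induction k arbitrary: f)
     (auto intro!: continuous_at_imp_continuous_on differentiable_imp_continuous_within)

lemma ck_on_const: "ck_on k S (\<lambda>x. c)"
  by (induction k arbitrary: c) auto

lemma ck_on_add:
  assumes "open S" "ck_on k S f" "ck_on k S g"
  shows "ck_on k S (\<lambda>x. f x + g x)"
  using assms(2,3)
proof (induction k arbitrary: f g)
  case 0
  then show ?case by (simp add: continuous_on_add)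
next
  case (Suc k)
  have D: "((\<lambda>x. f x + g x) has_derivative
      (\<lambda>v. frechet_derivative f (at x) v + frechet_derivative g (at x) v)) (at x)" if "x \<in> S" for x
    using Suc.prems that by (auto intro!: has_derivative_add simp: frechet_derivative_works[symmetric])
  have "ck_on k S (\<lambda>x. frechet_derivative (\<lambda>x. f x + g x) (at x) v)" for v
  proof (rule ck_on_cong[OF \<open>open S\<close>])
    show "ck_on k S (\<lambda>x. frechet_derivative f (at x) v + frechet_derivative g (at x) v)"
      using Suc by simp
  qed (simp add: frechet_derivative_at[OF D, symmetric])
  then show ?case using Suc.prems by simp
qed

lemma ck_on_sum:
  assumes "open S" "\<And>i. i \<in> I \<Longrightarrow> ck_on k S (f i)"
  shows "ck_on k S (\<lambda>x. \<Sum>i\<in>I. f i x)"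
  using assms(2)
  by (induction I rule: infinite_finite_induct) (auto simp: ck_on_const intro!: ck_on_add[OF assms(1)])

lemma ck_on_bilinear:
  assumes "open S" "bounded_bilinear b" "ck_on k S f" "ck_on k S g"
  shows "ck_on k S (\<lambda>x. b (f x) (g x))"
  using assms(3,4)
proof (induction k arbitrary: f g)
  case 0
  then show ?case using bounded_bilinear.continuous_on[OF assms(2)] by simp
next
  case (Suc k)
  have d: "f differentiable (at x)" "g differentiable (at x)" if "x \<in> S" for x
    using Suc.prems that by auto
  have D: "((\<lambda>x. b (f x) (g x)) has_derivative
      (\<lambda>v. b (f x) (frechet_derivative g (at x) v) + b (frechet_derivative f (at x) v) (g x))) (at x)"
    if "x \<in> S" for x
    using bounded_bilinear.FDERIV[OF assms(2)] d[OF that] by (simp add: frechet_derivative_works)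
  have "ck_on k S (\<lambda>x. frechet_derivative (\<lambda>x. b (f x) (g x)) (at x) v)" for v
  proof (rule ck_on_cong[OF \<open>open S\<close>])
    show "ck_on k S (\<lambda>x. b (f x) (frechet_derivative g (at x) v)
        + b (frechet_derivative f (at x) v) (g x))"
      using Suc.IH Suc.prems ck_on_Suc_imp[OF Suc.prems(1)] ck_on_Suc_imp[OF Suc.prems(2)]
      by (intro ck_on_add \<open>open S\<close>) auto
  qed (simp add: frechet_derivative_at[OF D, symmetric])
  moreover have "(\<lambda>x. b (f x) (g x)) differentiable (at x)" if "x \<in> S" for x
    using D[OF that] differentiableI by blast
  ultimately show ?case by simp
qed

lemma ck_on_linear_comp:
  assumes "open S" "bounded_linear L" "ck_on k S f"
  shows "ck_on k S (\<lambda>x. L (f x))"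
  using assms(3)
proof (induction k arbitrary: f)
  case 0
  then show ?case using assms(2) bounded_linear.continuous_on by auto
next
  case (Suc k)
  have D: "((\<lambda>x. L (f x)) has_derivative (\<lambda>v. L (frechet_derivative f (at x) v))) (at x)"
    if "x \<in> S" for x
    by (rule bounded_linear.has_derivative[OF assms(2)])
      (use Suc.prems that in \<open>simp add: frechet_derivative_works[symmetric]\<close>)
  have "ck_on k S (\<lambda>x. frechet_derivative (\<lambda>x. L (f x)) (at x) v)" for v
    by (rule ck_on_cong[OF \<open>open S\<close>, of "\<lambda>x. L (frechet_derivative f (at x) v)"])
      (use Suc D in \<open>auto simp: frechet_derivative_at[OF D, symmetric]\<close>)
  moreover have "(\<lambda>x. L (f x)) differentiable (at x)" if "x \<in> S" for x
    using D[OF that] differentiableI by blast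
  ultimately show ?case by simp
qed

lemma frechet_derivative_basis_expansion:
  fixes g :: "'a::euclidean_space \<Rightarrow> 'b::real_normed_vector"
  assumes "g differentiable (at y)"
  shows "frechet_derivative g (at y) v = (\<Sum>b\<in>Basis. (v \<bullet> b) *\<^sub>R frechet_derivative g (at y) b)"
proof -
  have l: "linear (frechet_derivative g (at y))"
    using assms linear_frechet_derivative by blast
  have "frechet_derivative g (at y) v = frechet_derivative g (at y) (\<Sum>b\<in>Basis. (v \<bullet> b) *\<^sub>R b)"
    by (simp add: euclidean_representation)
  then show ?thesis using l by (simp only: linear_sum linear_cmul)
qed

text \<open>By the chain rule the first derivatives of \<open>g \<circ> f\<close> are sums of products of first derivatives
  of \<open>f\<close> with compositions of partial derivatives of \<open>g\<close> and \<open>f\<close>, so the order of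
  differentiability can be raised by one at a time.\<close>

lemma ck_on_compose:
  fixes f :: "'a::real_normed_vector \<Rightarrow> 'b::euclidean_space"
    and g :: "'b \<Rightarrow> 'c::real_normed_vector"
  assumes "open S" "f ` S \<subseteq> T" "ck_on k S f" "ck_on k T g"
  shows "ck_on k S (\<lambda>x. g (f x))"
  using assms(3,4)
proof (induction k arbitrary: g)
  case 0
  then show ?case using assms(2) by (auto intro: continuous_on_compose2)
next
  case (Suc k)
  have df: "f differentiable (at x)" if "x \<in> S" for x using Suc.prems that by auto
  have dg: "g differentiable (at (f x))" if "x \<in> S" for x using Suc.prems that assms(2) by auto
  have D: "((\<lambda>x. g (f x)) has_derivative
      (\<lambda>v. frechet_derivative g (at (f x)) (frechet_derivative f (at x) v))) (at x)"
    if "x \<in> S" for x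
    using has_derivative_compose[OF df[OF that, unfolded frechet_derivative_works]]
      dg[OF that, unfolded frechet_derivative_works] by blast
  have partial: "ck_on k S (\<lambda>x. frechet_derivative g (at (f x)) b)" for b
    using Suc.IH[of "\<lambda>y. frechet_derivative g (at y) b"] Suc.prems ck_on_Suc_imp by auto
  have "ck_on k S (\<lambda>x. frechet_derivative (\<lambda>x. g (f x)) (at x) v)" for v
  proof (rule ck_on_cong[OF \<open>open S\<close>])
    show "ck_on k S (\<lambda>x. \<Sum>b\<in>Basis. (frechet_derivative f (at x) v \<bullet> b) *\<^sub>R
        frechet_derivative g (at (f x)) b)"
      using Suc.prems(1)
      by (intro partial ck_on_sum ck_on_bilinear[OF _ bounded_bilinear_scaleR] \<open>open S\<close>
          ck_on_linear_comp[OF _ bounded_linear_inner_left]) auto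
  qed (simp add: frechet_derivative_at[OF D, symmetric]
        frechet_derivative_basis_expansion[OF dg, symmetric])
  moreover have "(\<lambda>x. g (f x)) differentiable (at x)" if "x \<in> S" for x
    using D[OF that] differentiableI by blast
  ultimately show ?case by simp
qed

lemma smooth_on_cong:
  "open S \<Longrightarrow> (\<And>x. x \<in> S \<Longrightarrow> f x = g x) \<Longrightarrow> smooth_on S f \<Longrightarrow> smooth_on S g"
  unfolding smooth_on_def using ck_on_cong by blast

lemma smooth_on_local:
  "(\<And>x. x \<in> S \<Longrightarrow> \<exists>T. open T \<and> x \<in> T \<and> smooth_on T f) \<Longrightarrow> smooth_on S f"
  unfolding smooth_on_def using ck_on_local by meson

lemma smooth_on_const: "smooth_on S (\<lambda>x. c)"
  unfolding smooth_on_def by (simp add: ck_on_const)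

lemma smooth_on_sum:
  "open S \<Longrightarrow> (\<And>i. i \<in> I \<Longrightarrow> smooth_on S (f i)) \<Longrightarrow> smooth_on S (\<lambda>x. \<Sum>i\<in>I. f i x)"
  unfolding smooth_on_def by (simp add: ck_on_sum)

lemma smooth_on_mult:
  fixes f g :: "'a::real_normed_vector \<Rightarrow> real"
  shows "open S \<Longrightarrow> smooth_on S f \<Longrightarrow> smooth_on S g \<Longrightarrow> smooth_on S (\<lambda>x. f x * g x)"
  unfolding smooth_on_def by (simp add: ck_on_bilinear[OF _ bounded_bilinear_mult])

lemma smooth_on_prod:
  fixes f :: "'i \<Rightarrow> 'a::real_normed_vector \<Rightarrow> real"
  shows "open S \<Longrightarrow> (\<And>i. i \<in> I \<Longrightarrow> smooth_on S (f i)) \<Longrightarrow> smooth_on S (\<lambda>x. \<Prod>i\<in>I. f i x)"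
  by (induction I rule: infinite_finite_induct) (auto simp: smooth_on_const intro!: smooth_on_mult)

lemma smooth_on_linear_comp:
  "open S \<Longrightarrow> bounded_linear L \<Longrightarrow> smooth_on S f \<Longrightarrow> smooth_on S (\<lambda>x. L (f x))"
  unfolding smooth_on_def by (simp add: ck_on_linear_comp)

lemma smooth_on_uminus:
  fixes f :: "'a::real_normed_vector \<Rightarrow> real"
  shows "open S \<Longrightarrow> smooth_on S f \<Longrightarrow> smooth_on S (\<lambda>x. - f x)"
  by (rule smooth_on_linear_comp[where L = uminus])
    (auto intro: bounded_linear_minus bounded_linear_ident)

lemma smooth_on_compose:
  fixes f :: "'a::real_normed_vector \<Rightarrow> 'b::euclidean_space"
  shows "open S \<Longrightarrow> f ` S \<subseteq> T \<Longrightarrow> smooth_on S f \<Longrightarrow> smooth_on T g \<Longrightarrow> smooth_on S (\<lambda>x. g (f x))"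
  unfolding smooth_on_def using ck_on_compose by blast

lemma smooth_on_frechet_derivative:
  "smooth_on S f \<Longrightarrow> smooth_on S (\<lambda>x. frechet_derivative f (at x) v)"
  unfolding smooth_on_def using ck_on.simps(2) by blast

lemma smooth_on_differentiable: "smooth_on S f \<Longrightarrow> x \<in> S \<Longrightarrow> f differentiable (at x)"
  unfolding smooth_on_def using ck_on.simps(2) by blast

lemma smooth_on_continuous: "smooth_on S f \<Longrightarrow> continuous_on S f"
  unfolding smooth_on_def using ck_on.simps(1) by blast

text \<open>Symmetry of second derivatives: applying the mean value theorem once in each direction,
  in either order, expresses the second difference
  \<open>f (x + t u + t v) - f (x + t u) - f (x + t v) + f x\<close> as \<open>t\<^sup>2\<close> times either mixed
  derivative at some point that tends to \<open>x\<close> with \<open>t\<close>.\<close>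

lemma second_difference_mean_value:
  fixes f :: "'a::real_normed_vector \<Rightarrow> real"
  assumes "smooth_on S f" "0 < t"
    and S: "\<And>a b. 0 \<le> a \<Longrightarrow> a \<le> t \<Longrightarrow> 0 \<le> b \<Longrightarrow> b \<le> t \<Longrightarrow> x + a *\<^sub>R u + b *\<^sub>R v \<in> S"
  obtains a b where "0 \<le> a" "a \<le> t" "0 \<le> b" "b \<le> t"
    and "f (x + t *\<^sub>R u + t *\<^sub>R v) - f (x + t *\<^sub>R u) - f (x + t *\<^sub>R v) + f x
       = t\<^sup>2 * frechet_derivative (\<lambda>y. frechet_derivative f (at y) u) (at (x + a *\<^sub>R u + b *\<^sub>R v)) v"
proof -
  let ?Du = "\<lambda>y. frechet_derivative f (at y) u"
  have line: "((\<lambda>s. g (p + s *\<^sub>R w)) has_real_derivative frechet_derivative g (at (p + s *\<^sub>R w)) w) (at s)"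
    if "smooth_on S g" "p + s *\<^sub>R w \<in> S" for g :: "'a \<Rightarrow> real" and p w s
  proof -
    have g: "(g has_derivative frechet_derivative g (at (p + s *\<^sub>R w))) (at (p + s *\<^sub>R w))"
      using that smooth_on_differentiable frechet_derivative_works by blast
    have "((\<lambda>s. p + s *\<^sub>R w) has_derivative (\<lambda>h. h *\<^sub>R w)) (at s)"
      by (auto intro!: derivative_eq_intros)
    from has_derivative_compose[OF this g]
    have "((\<lambda>s. g (p + s *\<^sub>R w)) has_derivative
        (\<lambda>h. frechet_derivative g (at (p + s *\<^sub>R w)) (h *\<^sub>R w))) (at s)" .
    moreover have "linear (frechet_derivative g (at (p + s *\<^sub>R w)))"
      using g has_derivative_linear by blast
    ultimately show ?thesis
      by (simp add: has_field_derivative_def linear_cmul mult_commute_abs)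
  qed
  let ?\<phi> = "\<lambda>s. f ((x + t *\<^sub>R v) + s *\<^sub>R u) - f (x + s *\<^sub>R u)"
  have "\<exists>a. a > 0 \<and> a < t \<and> ?\<phi> t - ?\<phi> 0
      = (t - 0) * (?Du ((x + t *\<^sub>R v) + a *\<^sub>R u) - ?Du (x + a *\<^sub>R u))"
  proof (rule MVT2[OF \<open>0 < t\<close>])
    fix s :: real
    assume "0 \<le> s" "s \<le> t"
    then show "(?\<phi> has_real_derivative ?Du ((x + t *\<^sub>R v) + s *\<^sub>R u) - ?Du (x + s *\<^sub>R u)) (at s)"
      using S[of s t] S[of s 0] \<open>0 < t\<close>
      by (intro DERIV_diff line assms(1)) (simp_all add: algebra_simps)
  qed
  then obtain a where a: "0 < a" "a < t"
    "?\<phi> t - ?\<phi> 0 = t * (?Du ((x + t *\<^sub>R v) + a *\<^sub>R u) - ?Du (x + a *\<^sub>R u))" by auto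
  let ?\<psi> = "\<lambda>s. ?Du ((x + a *\<^sub>R u) + s *\<^sub>R v)"
  have "\<exists>b. b > 0 \<and> b < t \<and> ?\<psi> t - ?\<psi> 0
      = (t - 0) * frechet_derivative ?Du (at ((x + a *\<^sub>R u) + b *\<^sub>R v)) v"
    using a S by (intro MVT2[OF \<open>0 < t\<close>] line smooth_on_frechet_derivative assms(1)) auto
  then obtain b where b: "0 < b" "b < t"
    "?\<psi> t - ?\<psi> 0 = t * frechet_derivative ?Du (at ((x + a *\<^sub>R u) + b *\<^sub>R v)) v" by auto
  have comm: "x + t *\<^sub>R v + s *\<^sub>R u = x + s *\<^sub>R u + t *\<^sub>R v" for s
    by (simp add: algebra_simps)
  have "f (x + t *\<^sub>R u + t *\<^sub>R v) - f (x + t *\<^sub>R u) - f (x + t *\<^sub>R v) + f x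
      = t * (t * frechet_derivative ?Du (at (x + a *\<^sub>R u + b *\<^sub>R v)) v)"
    using a(3) b(3) by (simp add: comm)
  then show thesis
    using that[of a b] a b by (simp add: power2_eq_square)
qed

lemma symmetric_second_derivative_real:
  fixes f :: "'a::real_normed_vector \<Rightarrow> real"
  assumes "open S" "smooth_on S f" "x \<in> S"
  shows "frechet_derivative (\<lambda>y. frechet_derivative f (at y) u) (at x) v
       = frechet_derivative (\<lambda>y. frechet_derivative f (at y) v) (at x) u" (is "?P x = ?Q x")
proof (rule ccontr)
  assume ne: "?P x \<noteq> ?Q x"
  define e where "e = \<bar>?P x - ?Q x\<bar> / 2"
  have e: "e > 0" using ne by (simp add: e_def)
  have cont: "continuous_on S ?P" "continuous_on S ?Q"
    using assms(2) by (auto intro!: smooth_on_continuous smooth_on_frechet_derivative)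
  obtain d0 where d0: "d0 > 0" "ball x d0 \<subseteq> S"
    using assms openE by blast
  obtain d1 where d1: "d1 > 0" "\<And>y. y \<in> S \<Longrightarrow> dist y x < d1 \<Longrightarrow> dist (?P y) (?P x) < e"
    using cont(1) e assms(3) unfolding continuous_on_iff by blast
  obtain d2 where d2: "d2 > 0" "\<And>y. y \<in> S \<Longrightarrow> dist y x < d2 \<Longrightarrow> dist (?Q y) (?Q x) < e"
    using cont(2) e assms(3) unfolding continuous_on_iff by blast
  define d where "d = min d0 (min d1 d2)"
  define t where "t = d / (norm u + norm v + 1)"
  have d: "d > 0" using d0 d1 d2 by (simp add: d_def)
  have t: "t > 0" using d by (simp add: t_def add_nonneg_pos)
  have near: "dist (x + a *\<^sub>R u + b *\<^sub>R v) x < d" if "0 \<le> a" "a \<le> t" "0 \<le> b" "b \<le> t" for a b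
  proof -
    have "dist (x + a *\<^sub>R u + b *\<^sub>R v) x \<le> a * norm u + b * norm v"
      using that norm_triangle_ineq[of "a *\<^sub>R u" "b *\<^sub>R v"]
      by (simp add: dist_norm add.assoc)
    also have "\<dots> \<le> t * norm u + t * norm v"
      using that by (intro add_mono mult_right_mono) auto
    also have "\<dots> < t * (norm u + norm v + 1)" using t by (simp add: algebra_simps)
    also have "\<dots> = d"
    proof -
      have "norm u + norm v + 1 \<noteq> 0"
        using norm_ge_zero[of u] norm_ge_zero[of v] by linarith
      then show ?thesis by (simp add: t_def)
    qed
    finally show ?thesis .
  qed
  have inS: "x + a *\<^sub>R u + b *\<^sub>R v \<in> S" if "0 \<le> a" "a \<le> t" "0 \<le> b" "b \<le> t" for a b
    using near[OF that] d0 unfolding d_def by (auto simp: dist_commute)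
  obtain a b where ab: "0 \<le> a" "a \<le> t" "0 \<le> b" "b \<le> t"
    "f (x + t *\<^sub>R u + t *\<^sub>R v) - f (x + t *\<^sub>R u) - f (x + t *\<^sub>R v) + f x
       = t\<^sup>2 * ?P (x + a *\<^sub>R u + b *\<^sub>R v)"
    using second_difference_mean_value[OF assms(2) t inS] by blast
  have inS': "x + b *\<^sub>R v + a *\<^sub>R u \<in> S" if "0 \<le> b" "b \<le> t" "0 \<le> a" "a \<le> t" for a b
    using inS[of a b] that by (simp add: algebra_simps)
  obtain a' b' where ab': "0 \<le> b'" "b' \<le> t" "0 \<le> a'" "a' \<le> t"
    "f (x + t *\<^sub>R v + t *\<^sub>R u) - f (x + t *\<^sub>R v) - f (x + t *\<^sub>R u) + f x
       = t\<^sup>2 * ?Q (x + b' *\<^sub>R v + a' *\<^sub>R u)"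
    using second_difference_mean_value[OF assms(2) t, of x v u] inS' by blast
  have "x + t *\<^sub>R v + t *\<^sub>R u = x + t *\<^sub>R u + t *\<^sub>R v" by (simp add: algebra_simps)
  then have "t\<^sup>2 * ?P (x + a *\<^sub>R u + b *\<^sub>R v) = t\<^sup>2 * ?Q (x + b' *\<^sub>R v + a' *\<^sub>R u)"
    using ab(5) ab'(5) by (simp only:)
  then have eq: "?P (x + a *\<^sub>R u + b *\<^sub>R v) = ?Q (x + b' *\<^sub>R v + a' *\<^sub>R u)"
    using t by simp
  have "dist (?P (x + a *\<^sub>R u + b *\<^sub>R v)) (?P x) < e"
    using near[OF ab(1-4)] inS[OF ab(1-4)] d1 by (simp add: d_def)
  moreover have "dist (x + b' *\<^sub>R v + a' *\<^sub>R u) x < d"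
    using near[of a' b'] ab'(1-4) by (simp add: algebra_simps)
  then have "dist (?Q (x + b' *\<^sub>R v + a' *\<^sub>R u)) (?Q x) < e"
    using inS'[OF ab'(1-4)] d2 by (simp add: d_def)
  ultimately show False
    unfolding eq e_def dist_real_def by (auto simp: abs_if split: if_splits)
qed

lemma symmetric_second_derivative:
  fixes f :: "'a::real_normed_vector \<Rightarrow> 'b::euclidean_space"
  assumes "open S" "smooth_on S f" "x \<in> S"
  shows "frechet_derivative (\<lambda>y. frechet_derivative f (at y) u) (at x) v
       = frechet_derivative (\<lambda>y. frechet_derivative f (at y) v) (at x) u"
proof (rule euclidean_eqI)
  fix b :: 'b
  have component: "frechet_derivative (\<lambda>y. g y \<bullet> b) (at y) w = frechet_derivative g (at y) w \<bullet> b"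
    if "g differentiable (at y)" for g :: "'a \<Rightarrow> 'b" and y w
    using that bounded_linear.has_derivative[OF bounded_linear_inner_left, of g _ _ b]
    by (metis (no_types, lifting) frechet_derivative_at frechet_derivative_works)
  let ?g = "\<lambda>y. f y \<bullet> b"
  have g: "smooth_on S ?g"
    by (intro smooth_on_linear_comp[OF _ bounded_linear_inner_left] assms)
  have second: "frechet_derivative (\<lambda>y. frechet_derivative ?g (at y) w) (at x) w'
      = frechet_derivative (\<lambda>y. frechet_derivative f (at y) w) (at x) w' \<bullet> b" for w w'
  proof -
    have D: "(\<lambda>y. frechet_derivative f (at y) w) differentiable (at x)"
      using assms smooth_on_frechet_derivative smooth_on_differentiable by blast
    have "frechet_derivative (\<lambda>y. frechet_derivative ?g (at y) w) (at x)
        = frechet_derivative (\<lambda>y. frechet_derivative f (at y) w \<bullet> b) (at x)"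
      using assms g
      by (intro frechet_derivative_transform_within_open[OF _ \<open>open S\<close>])
        (auto intro: smooth_on_differentiable smooth_on_frechet_derivative component)
    then show ?thesis by (simp add: component[OF D])
  qed
  show "frechet_derivative (\<lambda>y. frechet_derivative f (at y) u) (at x) v \<bullet> b
       = frechet_derivative (\<lambda>y. frechet_derivative f (at y) v) (at x) u \<bullet> b"
    using symmetric_second_derivative_real[OF \<open>open S\<close> g \<open>x \<in> S\<close>, of u v] by (simp add: second)
qed

section \<open>Tangent spaces and differentials\<close>

lemma smooth_atlas_is_chart: "smooth_atlas A \<Longrightarrow> c \<in> A \<Longrightarrow> is_chart c"
  by (simp add: smooth_atlas_def)

lemma charts_at_iff: "c \<in> charts_at A p \<longleftrightarrow> c \<in> A \<and> p \<in> fst c"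
  by (auto simp: charts_at_def)

lemma charts_at_is_chart: "smooth_atlas A \<Longrightarrow> c \<in> charts_at A p \<Longrightarrow> is_chart c"
  by (simp add: smooth_atlas_is_chart charts_at_iff)

lemma chart_at_in_charts_at:
  assumes "smooth_atlas A"
  shows "chart_at A p \<in> charts_at A p"
proof -
  have "p \<in> (\<Union>c\<in>A. fst c)"
    using assms by (simp add: smooth_atlas_def)
  then have "\<exists>c. c \<in> charts_at A p"
    by (auto simp: charts_at_def)
  then show ?thesis unfolding chart_at_def by (rule someI_ex)
qed

lemma chart_inv_chart: "is_chart c \<Longrightarrow> p \<in> fst c \<Longrightarrow> chart_inv c (snd c p) = p"
  unfolding is_chart_def homeomorphism_def by auto

lemma chart_inv_in: "is_chart c \<Longrightarrow> x \<in> snd c ` fst c \<Longrightarrow> chart_inv c x \<in> fst c"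
  unfolding is_chart_def homeomorphism_def by auto

lemma open_chart_image:
  assumes "is_chart c" "open U"
  shows "open (snd c ` (fst c \<inter> U))"
proof -
  have "snd c ` (fst c \<inter> U) = (snd c ` fst c) \<inter> chart_inv c -` U"
    using chart_inv_chart[OF assms(1)] by force
  moreover have "continuous_on (snd c ` fst c) (chart_inv c)" "open (snd c ` fst c)"
    using assms(1) unfolding is_chart_def homeomorphism_def by auto
  ultimately show ?thesis
    using continuous_open_preimage assms(2) by metis
qed

lemma open_local_rep_domain:
  assumes "smooth_atlas A" "smooth_atlas B" "smooth_map A B f" "c \<in> A" "c' \<in> B"
  shows "open (snd c ` (fst c \<inter> f -` fst c'))"
proof (rule open_chart_image)
  show "is_chart c" using assms smooth_atlas_is_chart by blast
  have "open (fst c')" using assms(2,5) smooth_atlas_is_chart is_chart_def by blast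
  then show "open (f -` fst c')"
    using assms(3) open_vimage unfolding smooth_map_def by blast
qed

text \<open>Transition maps are the local representations of the identity, so that the cocycle
  relations of their derivatives are instances of the chain rule for smooth maps.\<close>

lemma transition_eq_local_rep: "transition c c' = local_rep c c' id"
  by (simp add: transition_def local_rep_def)

lemma smooth_map_id: "smooth_atlas A \<Longrightarrow> smooth_map A A id"
  by (simp add: smooth_map_def smooth_atlas_def transition_eq_local_rep[symmetric])

text \<open>The Jacobian at \<open>p\<close> of a map in the coordinates of two charts.\<close>

abbreviation dloc :: "('m, 'd::finite) chart \<Rightarrow> ('n, 'e::finite) chart \<Rightarrow> ('m \<Rightarrow> 'n) \<Rightarrow> 'm \<Rightarrow>
    real ^ 'd \<Rightarrow> real ^ 'e" where
  "dloc c c' f p \<equiv> frechet_derivative (local_rep c c' f) (at (snd c p))"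

lemma local_rep_differentiable:
  assumes "smooth_map A B f" "c \<in> charts_at A p" "c' \<in> charts_at B (f p)"
  shows "local_rep c c' f differentiable (at (snd c p))"
proof (rule smooth_on_differentiable)
  show "smooth_on (snd c ` (fst c \<inter> f -` fst c')) (local_rep c c' f)"
    using assms by (simp add: smooth_map_def charts_at_iff)
  show "snd c p \<in> snd c ` (fst c \<inter> f -` fst c')"
    using assms(2,3) by (simp add: charts_at_iff)
qed

lemma linear_dloc:
  assumes "smooth_map A B f" "c \<in> charts_at A p" "c' \<in> charts_at B (f p)"
  shows "linear (dloc c c' f p)"
  using local_rep_differentiable[OF assms] linear_frechet_derivative by blast

lemma dloc_comp:
  assumes "smooth_atlas A" "smooth_atlas B" "smooth_map A B f" "smooth_map B C g"
    and "c \<in> charts_at A p" "c' \<in> charts_at B (f p)" "c'' \<in> charts_at C (g (f p))"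
  shows "dloc c c'' (g \<circ> f) p w = dloc c' c'' g (f p) (dloc c c' f p w)"
proof -
  let ?S = "snd c ` (fst c \<inter> f -` fst c')"
  have c: "is_chart c" "is_chart c'"
    using charts_at_is_chart[OF assms(1,5)] charts_at_is_chart[OF assms(2,6)] by simp_all
  have S: "open ?S" "snd c p \<in> ?S"
    using open_local_rep_domain[OF assms(1-3), of c c'] assms(5,6) by (auto simp: charts_at_iff)
  have at: "local_rep c c' f (snd c p) = snd c' (f p)"
    using assms(5) c by (simp add: local_rep_def charts_at_iff chart_inv_chart)
  have d: "local_rep c c' f differentiable (at (snd c p))"
    "local_rep c' c'' g differentiable (at (local_rep c c' f (snd c p)))"
    using local_rep_differentiable[OF assms(3,5,6)] local_rep_differentiable[OF assms(4,6,7)]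
    by (simp_all only: at)
  have "dloc c c'' (g \<circ> f) p = frechet_derivative (local_rep c' c'' g \<circ> local_rep c c' f) (at (snd c p))"
  proof (rule frechet_derivative_transform_within_open[OF _ S, symmetric])
    show "local_rep c' c'' g \<circ> local_rep c c' f differentiable at (snd c p)"
      using differentiable_chain_at[OF d] .
    show "(local_rep c' c'' g \<circ> local_rep c c' f) x = local_rep c c'' (g \<circ> f) x" if "x \<in> ?S" for x
      using that c by (auto simp: local_rep_def chart_inv_chart)
  qed
  then show ?thesis by (simp add: frechet_derivative_compose[OF d] at)
qed

lemma dloc_id_same:
  assumes "smooth_atlas A" "c \<in> charts_at A p"
  shows "dloc c c id p w = w"
proof -
  have c: "is_chart c" by (rule charts_at_is_chart[OF assms])
  have "dloc c c id p = frechet_derivative id (at (snd c p))"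
  proof (rule frechet_derivative_transform_within_open[symmetric])
    show "open (snd c ` fst c)" "snd c p \<in> snd c ` fst c"
      using c assms(2) by (auto simp: is_chart_def charts_at_iff)
  qed (auto simp: local_rep_def c chart_inv_chart id_def)
  then show ?thesis by simp
qed

lemma dloc_transition_comp:
  assumes "smooth_atlas A" "smooth_atlas B" "smooth_map A B f"
    and "c \<in> charts_at A p" "c1 \<in> charts_at A p" "c' \<in> charts_at B (f p)"
  shows "dloc c1 c' f p (dloc c c1 id p w) = dloc c c' f p w"
  using dloc_comp[OF assms(1,1) smooth_map_id[OF assms(1)] assms(3,4), of c1 c' w] assms by simp

lemma dloc_comp_transition:
  assumes "smooth_atlas A" "smooth_atlas B" "smooth_map A B f"
    and "c \<in> charts_at A p" "c' \<in> charts_at B (f p)" "c1 \<in> charts_at B (f p)"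
  shows "dloc c' c1 id (f p) (dloc c c' f p w) = dloc c c1 f p w"
  using dloc_comp[OF assms(1,2,3) smooth_map_id[OF assms(2)] assms(4,5), of c1 w] assms by simp

lemma tangent_space_iff:
  "v \<in> tangent_space A p \<longleftrightarrow>
     (\<forall>c\<in>charts_at A p. \<forall>c'\<in>charts_at A p. v c' = dloc c c' id p (v c)) \<and>
     (\<forall>c. c \<notin> charts_at A p \<longrightarrow> v c = 0)"
  by (simp add: tangent_space_def transition_eq_local_rep)

lemma tvec_of_eq:
  "tvec_of A c p w = (\<lambda>c'. if c' \<in> charts_at A p then dloc c c' id p w else 0)"
  unfolding tvec_of_def transition_eq_local_rep ..

lemma tvec_of_in_tangent_space:
  assumes "smooth_atlas A" "c \<in> charts_at A p"
  shows "tvec_of A c p w \<in> tangent_space A p"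
  unfolding tangent_space_iff tvec_of_eq
  using dloc_transition_comp[OF assms(1,1) smooth_map_id[OF assms(1)] assms(2)] by simp

lemma tvec_of_same:
  assumes "smooth_atlas A" "c \<in> charts_at A p"
  shows "tvec_of A c p w c = w"
  using assms by (simp add: tvec_of_eq dloc_id_same)

lemma tvec_of_coordinates:
  assumes "v \<in> tangent_space A p" "c \<in> charts_at A p"
  shows "tvec_of A c p (v c) = v"
proof
  fix c'
  have "v c' = dloc c c' id p (v c)" if "c' \<in> charts_at A p"
    using assms that unfolding tangent_space_iff by blast
  moreover have "v c' = 0" if "c' \<notin> charts_at A p"
    using assms(1) that unfolding tangent_space_iff by blast
  ultimately show "tvec_of A c p (v c) c' = v c'" by (simp add: tvec_of_eq)
qed

lemma tvec_of_tcomb: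
  assumes "smooth_atlas A" "c \<in> charts_at A p"
  shows "tvec_of A c p (a *\<^sub>R w + b *\<^sub>R w') = tcomb a (tvec_of A c p w) b (tvec_of A c p w')"
proof
  fix c'
  show "tvec_of A c p (a *\<^sub>R w + b *\<^sub>R w') c' = tcomb a (tvec_of A c p w) b (tvec_of A c p w') c'"
  proof (cases "c' \<in> charts_at A p")
    case True
    then have "linear (dloc c c' id p)"
      using linear_dloc[OF smooth_map_id[OF assms(1)] assms(2)] by simp
    then show ?thesis using True by (simp add: tvec_of_eq tcomb_def linear_add linear_cmul)
  qed (simp add: tvec_of_eq tcomb_def)
qed

lemma tangent_space_tcomb:
  assumes "smooth_atlas A" "v \<in> tangent_space A p" "w \<in> tangent_space A p"
  shows "tcomb a v b w \<in> tangent_space A p"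
proof -
  let ?c = "chart_at A p"
  have c: "?c \<in> charts_at A p" by (rule chart_at_in_charts_at[OF assms(1)])
  have "tcomb a v b w = tvec_of A ?c p (a *\<^sub>R v ?c + b *\<^sub>R w ?c)"
    using assms c by (simp add: tvec_of_tcomb tvec_of_coordinates)
  then show ?thesis using tvec_of_in_tangent_space[OF assms(1) c] by simp
qed

lemma differential_coordinates:
  assumes "smooth_atlas A" "smooth_atlas B" "smooth_map A B f"
    and "v \<in> tangent_space A p" "c \<in> charts_at A p" "c' \<in> charts_at B (f p)"
  shows "differential A B f p v c' = dloc c c' f p (v c)"
proof -
  let ?c = "chart_at A p"
  have c: "?c \<in> charts_at A p" by (rule chart_at_in_charts_at[OF assms(1)])
  have "v ?c = dloc c ?c id p (v c)"
    using assms c unfolding tangent_space_iff by blast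
  then show ?thesis
    using assms dloc_transition_comp[OF assms(1-3,5) c assms(6)] by (simp add: differential_def Let_def)
qed

lemma differential_eq_tvec_of:
  assumes "smooth_atlas A" "smooth_atlas B" "smooth_map A B f"
    and "v \<in> tangent_space A p" "c \<in> charts_at A p" "c' \<in> charts_at B (f p)"
  shows "differential A B f p v = tvec_of B c' (f p) (dloc c c' f p (v c))"
proof
  fix c1
  show "differential A B f p v c1 = tvec_of B c' (f p) (dloc c c' f p (v c)) c1"
  proof (cases "c1 \<in> charts_at B (f p)")
    case True
    then show ?thesis
      using differential_coordinates[OF assms(1-5) True]
        dloc_comp_transition[OF assms(1-3,5,6) True] by (simp add: tvec_of_eq)
  qed (simp add: tvec_of_eq differential_def Let_def)
qed

lemma differential_in_tangent_space:
  assumes "smooth_atlas A" "smooth_atlas B" "smooth_map A B f" "v \<in> tangent_space A p"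
  shows "differential A B f p v \<in> tangent_space B (f p)"
  using differential_eq_tvec_of[OF assms chart_at_in_charts_at[OF assms(1)]
      chart_at_in_charts_at[OF assms(2)]]
    tvec_of_in_tangent_space[OF assms(2) chart_at_in_charts_at[OF assms(2)]] by simp

lemma differential_tvec_of:
  assumes "smooth_atlas A" "smooth_atlas B" "smooth_map A B f"
    and "c \<in> charts_at A p" "c' \<in> charts_at B (f p)"
  shows "differential A B f p (tvec_of A c p w) = tvec_of B c' (f p) (dloc c c' f p w)"
  using differential_eq_tvec_of[OF assms(1-3) tvec_of_in_tangent_space assms(4,5)] assms
  by (simp add: tvec_of_same)

lemma differential_tcomb:
  assumes "smooth_atlas A" "smooth_atlas B" "smooth_map A B f"
    and "v \<in> tangent_space A p" "w \<in> tangent_space A p"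
  shows "differential A B f p (tcomb a v b w)
    = tcomb a (differential A B f p v) b (differential A B f p w)"
proof -
  let ?c = "chart_at A p" and ?c' = "chart_at B (f p)"
  have c: "?c \<in> charts_at A p" "?c' \<in> charts_at B (f p)"
    using chart_at_in_charts_at assms(1,2) by blast+
  have "differential A B f p (tcomb a v b w)
      = tvec_of B ?c' (f p) (dloc ?c ?c' f p (a *\<^sub>R v ?c + b *\<^sub>R w ?c))"
    using differential_eq_tvec_of[OF assms(1-3) tangent_space_tcomb[OF assms(1,4,5)] c]
    by (simp add: tcomb_def)
  then show ?thesis
    using differential_eq_tvec_of[OF assms(1-3) assms(4) c]
      differential_eq_tvec_of[OF assms(1-3) assms(5) c] linear_dloc[OF assms(3) c]
    by (simp add: linear_add linear_cmul tvec_of_tcomb[OF assms(2) c(2)])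
qed

section \<open>Alternating forms and their coordinates\<close>

lemma alt_form_cong:
  assumes "alt_form T k \<alpha>" "\<And>i. i < k \<Longrightarrow> v i \<in> T" "\<And>i. i < k \<Longrightarrow> v i = w i"
  shows "\<alpha> v = \<alpha> w"
proof -
  have "\<forall>v w. (\<forall>i<k. v i \<in> T \<and> v i = w i) \<longrightarrow> \<alpha> v = \<alpha> w"
    using assms(1) unfolding alt_form_def by (rule conjunct1)
  then show ?thesis using assms(2,3) by blast
qed

lemma alt_form_tcomb:
  assumes "alt_form T k \<alpha>" "\<And>j. j < k \<Longrightarrow> v j \<in> T" "i < k" "x \<in> T" "y \<in> T"
  shows "\<alpha> (v(i := tcomb a x b y)) = a * \<alpha> (v(i := x)) + b * \<alpha> (v(i := y))"
  using assms unfolding alt_form_def by blast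

lemma alt_form_eq_0:
  assumes "alt_form T k \<alpha>" "\<And>j. j < k \<Longrightarrow> v j \<in> T" "i < k" "j < k" "i \<noteq> j" "v i = v j"
  shows "\<alpha> v = 0"
proof -
  have "i < j \<or> j < i" using assms(5) by linarith
  then show ?thesis
    using assms(1-4,6) unfolding alt_form_def by (metis (mono_tags, lifting))
qed

lemma alt_form_swap:
  assumes "alt_form (tangent_space A p) k \<alpha>" "smooth_atlas A"
    and v: "\<And>l. l < k \<Longrightarrow> v l \<in> tangent_space A p" and ij: "i < k" "j < k" "i \<noteq> j"
  shows "\<alpha> (v \<circ> Transposition.transpose i j) = - \<alpha> v"
proof -
  let ?T = "tangent_space A p"
  let ?s = "tcomb 1 (v i) 1 (v j)"
  have T: "v i \<in> ?T" "v j \<in> ?T" using v ij by auto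
  then have s: "?s \<in> ?T" using tangent_space_tcomb[OF assms(2)] by blast
  have 0: "\<alpha> (v(i := x, j := x)) = 0" if "x \<in> ?T" for x
    using ij v that by (intro alt_form_eq_0[OF assms(1), of _ i j]) auto
  have add: "\<alpha> (v(i := x, j := ?s)) = \<alpha> (v(i := x, j := v i)) + \<alpha> (v(i := x, j := v j))"
    if "x \<in> ?T" for x
    using alt_form_tcomb[OF assms(1), of "v(i := x)" j "v i" "v j" 1 1] v ij T that by simp
  have add': "\<alpha> (v(j := y, i := ?s)) = \<alpha> (v(j := y, i := v i)) + \<alpha> (v(j := y, i := v j))"
    if "y \<in> ?T" for y
    using alt_form_tcomb[OF assms(1), of "v(j := y)" i "v i" "v j" 1 1] v ij T that by simp
  have "0 = \<alpha> (v(i := ?s, j := ?s))" using 0[OF s] by simp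
  also have "\<dots> = \<alpha> (v(j := v i, i := ?s)) + \<alpha> (v(j := v j, i := ?s))"
    using add[OF s] ij by (simp add: fun_upd_twist)
  also have "\<dots> = \<alpha> (v(i := v i, j := v i)) + \<alpha> (v(i := v j, j := v i))
      + (\<alpha> (v(i := v i, j := v j)) + \<alpha> (v(i := v j, j := v j)))"
    using ij by (simp only: add'[OF T(1)] add'[OF T(2)] fun_upd_twist)
  also have "\<dots> = \<alpha> (v(i := v j, j := v i)) + \<alpha> v"
    using 0[OF T(1)] 0[OF T(2)] by simp
  also have "v(i := v j, j := v i) = v \<circ> Transposition.transpose i j"
    using ij by (auto simp: fun_eq_iff Transposition.transpose_def)
  finally show ?thesis by (simp add: comp_def)
qed

lemma alt_form_permutes:
  assumes "alt_form (tangent_space A p) k \<alpha>" "smooth_atlas A"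
    and "\<sigma> permutes {..<k}" "\<And>l. l < k \<Longrightarrow> v l \<in> tangent_space A p"
  shows "\<alpha> (v \<circ> \<sigma>) = of_int (sign \<sigma>) * \<alpha> v"
  using assms(3) finite_lessThan assms(4)
proof (induction arbitrary: v rule: permutes_induct)
  case id
  then show ?case by (simp add: sign_id)
next
  case (swap a b \<sigma>)
  have tr: "Transposition.transpose a b permutes {..<k}"
    using swap.hyps(1,2) by (simp add: permutes_swap_id)
  have T: "(v \<circ> Transposition.transpose a b) l \<in> tangent_space A p" if "l < k" for l
    using swap.prems permutes_in_image[OF tr, of l] that by simp
  have sg: "sign (Transposition.transpose a b \<circ> \<sigma>) = - sign \<sigma>"
    using swap.hyps tr by (subst sign_compose)
      (auto simp: sign_swap_id intro: permutation_permutes[THEN iffD2])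
  have "\<alpha> (v \<circ> (Transposition.transpose a b \<circ> \<sigma>)) = \<alpha> ((v \<circ> Transposition.transpose a b) \<circ> \<sigma>)" by (simp add: comp_assoc)
  also have "\<dots> = of_int (sign \<sigma>) * \<alpha> (v \<circ> Transposition.transpose a b)" by (rule swap.IH[OF T])
  also have "\<alpha> (v \<circ> Transposition.transpose a b) = - \<alpha> v"
    using alt_form_swap[OF assms(1,2), of v a b] swap by auto
  finally show ?case by (simp only: sg)
qed

lemma alt_form_tvec_of_expand_slot:
  fixes c :: "('m::{t2_space, second_countable_topology}, 'd::finite) chart"
  assumes "smooth_atlas A" "c \<in> charts_at A p" "alt_form (tangent_space A p) k \<alpha>"
    and "\<And>j. j < k \<Longrightarrow> v j \<in> tangent_space A p" "i < k"
  shows "\<alpha> (v(i := tvec_of A c p w)) = (\<Sum>j\<in>UNIV. w $ j * \<alpha> (v(i := tvec_of A c p (axis j 1))))"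
proof -
  let ?L = "\<lambda>w. \<alpha> (v(i := tvec_of A c p w))"
  have lin: "?L (a *\<^sub>R x + b *\<^sub>R y) = a * ?L x + b * ?L y" for a b x y
    using alt_form_tcomb[OF assms(3,4,5)] tvec_of_in_tangent_space[OF assms(1,2)]
    by (simp add: tvec_of_tcomb[OF assms(1,2)])
  have L: "linear ?L"
    by (rule linearI) (use lin[of 1 _ 1] lin[of _ _ 0 0] in auto)
  have "w = (\<Sum>j\<in>UNIV. (w $ j) *\<^sub>R axis j 1)"
    using basis_expansion[of w] by (simp add: scalar_mult_eq_scaleR)
  then have "?L w = ?L (\<Sum>j\<in>UNIV. (w $ j) *\<^sub>R axis j 1)" by simp
  then show ?thesis by (simp only: linear_sum[OF L] linear_cmul[OF L] real_scaleR_def)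
qed

text \<open>A form at a point is determined by its components, the values on sequences of coordinate
  vectors. Smoothness and derivatives of expressions in a form reduce to those of the components
  by this expansion.\<close>

lemma alt_form_tvec_of_expand:
  fixes c :: "('m::{t2_space, second_countable_topology}, 'd::finite) chart"
  assumes "smooth_atlas A" "c \<in> charts_at A p" "alt_form (tangent_space A p) k \<alpha>"
  shows "\<alpha> (\<lambda>i. tvec_of A c p (w i)) = (\<Sum>\<phi>\<in>{..<k} \<rightarrow>\<^sub>E UNIV.
    (\<Prod>i<k. w i $ \<phi> i) * \<alpha> (\<lambda>i. tvec_of A c p (axis (\<phi> i) 1)))"
proof -
  let ?t = "tvec_of A c p"
  have T: "?t x \<in> tangent_space A p" for x
    by (rule tvec_of_in_tangent_space[OF assms(1,2)])
  have "\<alpha> (\<lambda>i. ?t (w i)) = (\<Sum>\<phi>\<in>{..<m} \<rightarrow>\<^sub>E UNIV.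
      (\<Prod>i<m. w i $ \<phi> i) * \<alpha> (\<lambda>i. ?t (if i < m then axis (\<phi> i) 1 else w i)))" if "m \<le> k" for m
    using that
  proof (induction m)
    case 0
    then show ?case by simp
  next
    case (Suc m)
    let ?v = "\<lambda>\<phi> i. ?t (if i < m then axis (\<phi> i) 1 else w i)"
    have step: "\<alpha> (?v \<phi>) = (\<Sum>j\<in>UNIV. w m $ j * \<alpha> ((?v \<phi>)(m := ?t (axis j 1))))" for \<phi>
    proof -
      have "?v \<phi> = (?v \<phi>)(m := ?t (w m))" by auto
      then show ?thesis
        using alt_form_tvec_of_expand_slot[OF assms, of "?v \<phi>" m "w m"] T Suc.prems by simp
    qed
    have slot: "(?v \<phi>)(m := ?t (axis j 1))
        = (\<lambda>i. ?t (if i < Suc m then axis ((\<phi>(m := j)) i) 1 else w i))" for \<phi> j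
      by (auto simp: fun_eq_iff)
    have pr: "(\<Prod>i<Suc m. w i $ (\<phi>(m := j)) i) = w m $ j * (\<Prod>i<m. w i $ \<phi> i)" for \<phi> j
      by (simp add: mult.commute)
    have "(\<Sum>\<phi>\<in>{..<Suc m} \<rightarrow>\<^sub>E UNIV.
        (\<Prod>i<Suc m. w i $ \<phi> i) * \<alpha> (\<lambda>i. ?t (if i < Suc m then axis (\<phi> i) 1 else w i)))
      = (\<Sum>(j, \<phi>)\<in>UNIV \<times> ({..<m} \<rightarrow>\<^sub>E UNIV). (\<Prod>i<Suc m. w i $ (\<phi>(m := j)) i)
          * \<alpha> (\<lambda>i. ?t (if i < Suc m then axis ((\<phi>(m := j)) i) 1 else w i)))"
      unfolding lessThan_Suc PiE_insert_eq
      by (subst sum.reindex[OF inj_combinator], simp, rule sum.cong[OF refl])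
        (simp only: comp_def split_paired_all prod.case)
    also have "\<dots> = (\<Sum>(j, \<phi>)\<in>UNIV \<times> ({..<m} \<rightarrow>\<^sub>E UNIV).
        (\<Prod>i<m. w i $ \<phi> i) * (w m $ j * \<alpha> ((?v \<phi>)(m := ?t (axis j 1)))))"
      by (simp only: pr slot) (simp add: mult_ac)
    also have "\<dots> = (\<Sum>\<phi>\<in>{..<m} \<rightarrow>\<^sub>E UNIV. (\<Prod>i<m. w i $ \<phi> i) * \<alpha> (?v \<phi>))"
      by (subst sum.cartesian_product[symmetric], subst sum.swap)
        (simp only: step sum_distrib_left)
    finally show ?case using Suc by simp
  qed
  from this[of k] have "\<alpha> (\<lambda>i. ?t (w i)) = (\<Sum>\<phi>\<in>{..<k} \<rightarrow>\<^sub>E UNIV.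
      (\<Prod>i<k. w i $ \<phi> i) * \<alpha> (\<lambda>i. ?t (if i < k then axis (\<phi> i) 1 else w i)))" by simp
  moreover have "\<alpha> (\<lambda>i. ?t (if i < k then axis (\<phi> i) 1 else w i)) = \<alpha> (\<lambda>i. ?t (axis (\<phi> i) 1))" for \<phi>
    by (rule alt_form_cong[OF assms(3)]) (simp_all add: T)
  ultimately show ?thesis by simp
qed

lemma smooth_form_alt_form: "smooth_form A k \<alpha> \<Longrightarrow> alt_form (tangent_space A p) k (\<alpha> p)"
  by (simp add: smooth_form_on_def)

lemma smooth_form_coordinates:
  "smooth_form A k \<alpha> \<Longrightarrow> c \<in> A \<Longrightarrow>
    smooth_on (snd c ` fst c) (\<lambda>x. \<alpha> (chart_inv c x) (\<lambda>i. tvec_of A c (chart_inv c x) (w i)))"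
  by (simp add: smooth_form_on_def)

text \<open>Evaluating a smooth form on vector fields along a map \<open>h\<close>, given by their coordinates \<open>u\<close> in a
  chart, is polynomial in \<open>u\<close> with coefficients that are smooth functions of \<open>h\<close>. Pullbacks and
  contractions with fields along a map are both of this shape.\<close>

lemma smooth_form_eval_smooth:
  fixes c :: "('m::{t2_space, second_countable_topology}, 'd::finite) chart"
    and h :: "'a::real_normed_vector \<Rightarrow> real ^ 'd"
  assumes A: "smooth_atlas A" "c \<in> A" "smooth_form A k \<alpha>"
    and S: "open S" "smooth_on S h" "h ` S \<subseteq> snd c ` fst c"
    and u: "\<And>i. i < k \<Longrightarrow> smooth_on S (u i)"
  shows "smooth_on S (\<lambda>x. \<alpha> (chart_inv c (h x)) (\<lambda>i. tvec_of A c (chart_inv c (h x)) (u i x)))"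
proof (rule smooth_on_cong[OF S(1)])
  let ?C = "\<lambda>\<phi> y. \<alpha> (chart_inv c y) (\<lambda>i. tvec_of A c (chart_inv c y) (axis (\<phi> i) 1))"
  have C: "smooth_on S (\<lambda>x. ?C \<phi> (h x))" for \<phi>
    by (rule smooth_on_compose[OF S(1) S(3) S(2) smooth_form_coordinates[OF A(3,2)]])
  have P: "smooth_on S (\<lambda>x. \<Prod>i<k. u i x $ \<phi> i)" for \<phi>
    using u by (intro smooth_on_prod S(1) smooth_on_linear_comp[OF _ bounded_linear_vec_nth]) simp
  show "smooth_on S (\<lambda>x. \<Sum>\<phi>\<in>{..<k} \<rightarrow>\<^sub>E UNIV. (\<Prod>i<k. u i x $ \<phi> i) * ?C \<phi> (h x))"
    by (intro smooth_on_sum smooth_on_mult S(1) C P)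
  fix x assume "x \<in> S"
  then have "h x \<in> snd c ` fst c" using S(3) by blast
  then have "c \<in> charts_at A (chart_inv c (h x))"
    using chart_inv_in[OF smooth_atlas_is_chart[OF A(1,2)]] A(2) by (simp add: charts_at_iff)
  then show "(\<Sum>\<phi>\<in>{..<k} \<rightarrow>\<^sub>E UNIV. (\<Prod>i<k. u i x $ \<phi> i) * ?C \<phi> (h x))
      = \<alpha> (chart_inv c (h x)) (\<lambda>i. tvec_of A c (chart_inv c (h x)) (u i x))"
    using alt_form_tvec_of_expand[OF A(1) _ smooth_form_alt_form[OF A(3)]] by simp
qed

section \<open>Pullback and exterior derivative\<close>

lemma alt_form_pull:
  assumes "smooth_atlas A" "smooth_atlas B" "smooth_map A B f"
    and "alt_form (tangent_space B (f p)) k (\<beta> p)"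
  shows "alt_form (tangent_space A p) k (pull A B f \<beta> p)"
proof -
  let ?D = "differential A B f p"
  note T = differential_in_tangent_space[OF assms(1-3)]
  have upd: "(\<lambda>j. ?D ((v(i := x)) j)) = (\<lambda>j. ?D (v j))(i := ?D x)" for v i x
    by auto
  show ?thesis
    unfolding alt_form_def pull_def
  proof (intro conjI allI impI)
    fix v w :: "nat \<Rightarrow> ('a, 'b) tvec"
    assume "\<forall>i<k. v i \<in> tangent_space A p \<and> v i = w i"
    then show "\<beta> p (\<lambda>i. ?D (v i)) = \<beta> p (\<lambda>i. ?D (w i))"
      by (intro alt_form_cong[OF assms(4)]) (blast intro: T, simp)
  next
    fix v :: "nat \<Rightarrow> ('a, 'b) tvec" and i a x b y
    assume "(\<forall>j<k. v j \<in> tangent_space A p) \<and> i < k \<and> x \<in> tangent_space A p \<and> y \<in> tangent_space A p"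
    then show "\<beta> p (\<lambda>j. ?D ((v(i := tcomb a x b y)) j)) =
        a * \<beta> p (\<lambda>j. ?D ((v(i := x)) j)) + b * \<beta> p (\<lambda>j. ?D ((v(i := y)) j))"
      unfolding upd using differential_tcomb[OF assms(1-3)]
      by (simp add: alt_form_tcomb[OF assms(4)] T)
  next
    fix v :: "nat \<Rightarrow> ('a, 'b) tvec" and i j
    assume "(\<forall>l<k. v l \<in> tangent_space A p) \<and> i < j \<and> j < k \<and> v i = v j"
    then show "\<beta> p (\<lambda>i. ?D (v i)) = 0"
      by (intro alt_form_eq_0[OF assms(4), of _ i j]) (auto intro: T)
  qed
qed

lemma alt_form_contract:
  assumes "alt_form T (Suc k) \<alpha>" "X \<in> T"
  shows "alt_form T k (contract X \<alpha>)"
proof -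
  have upd: "case_nat X (v(i := x)) = (case_nat X v)(Suc i := x)" for v i x
    by (auto simp: fun_eq_iff split: nat.split)
  have T: "case_nat X v i \<in> T" if "i < Suc k" "\<forall>j<k. v j \<in> T" for v i
    using that assms(2) by (auto split: nat.split)
  show ?thesis
    unfolding alt_form_def contract_def
  proof (intro conjI allI impI)
    fix v w :: "nat \<Rightarrow> ('a, 'b) tvec"
    assume "\<forall>i<k. v i \<in> T \<and> v i = w i"
    then show "\<alpha> (case_nat X v) = \<alpha> (case_nat X w)"
      by (intro alt_form_cong[OF assms(1)]) ((rule T; blast), auto split: nat.split)
  next
    fix v :: "nat \<Rightarrow> ('a, 'b) tvec" and i a x b y
    assume "(\<forall>j<k. v j \<in> T) \<and> i < k \<and> x \<in> T \<and> y \<in> T"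
    then show "\<alpha> (case_nat X (v(i := tcomb a x b y)))
        = a * \<alpha> (case_nat X (v(i := x))) + b * \<alpha> (case_nat X (v(i := y)))"
      unfolding upd by (intro alt_form_tcomb[OF assms(1)]) (auto intro: T)
  next
    fix v :: "nat \<Rightarrow> ('a, 'b) tvec" and i j
    assume "(\<forall>l<k. v l \<in> T) \<and> i < j \<and> j < k \<and> v i = v j"
    then show "\<alpha> (case_nat X v) = 0"
      by (intro alt_form_eq_0[OF assms(1), of _ "Suc i" "Suc j"]) (auto intro: T)
  qed
qed

lemma alt_form_uminus: "alt_form T k \<alpha> \<Longrightarrow> alt_form T k (\<lambda>v. - \<alpha> v)"
  unfolding alt_form_def by (simp add: algebra_simps) metis

text \<open>To check that a pulled back form is smooth it suffices to work in one chart of the target at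
  a time, because smoothness is local.\<close>

lemma smooth_form_pullI:
  fixes A :: "('n::{t2_space, second_countable_topology}, 'd::finite) chart set"
    and B :: "('m::{t2_space, second_countable_topology}, 'e::finite) chart set"
  assumes "smooth_atlas A" "smooth_atlas B" "smooth_map A B f"
    and alt: "\<And>p. alt_form (tangent_space B (f p)) k (\<beta> p)"
    and smooth: "\<And>c c' w. c \<in> A \<Longrightarrow> c' \<in> B \<Longrightarrow> smooth_on (snd c ` (fst c \<inter> f -` fst c'))
      (\<lambda>x. \<beta> (chart_inv c x) (\<lambda>i. tvec_of B c' (f (chart_inv c x))
         (frechet_derivative (local_rep c c' f) (at x) (w i))))"
  shows "smooth_form A k (pull A B f \<beta>)"
  unfolding smooth_form_on_def
proof (intro conjI ballI allI)
  show "alt_form (tangent_space A p) k (pull A B f \<beta> p)" for p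
    using alt_form_pull[OF assms(1-3) alt] .
next
  fix c w assume c: "c \<in> A"
  have "smooth_on (snd c ` fst c)
    (\<lambda>x. pull A B f \<beta> (chart_inv c x) (\<lambda>i. tvec_of A c (chart_inv c x) (w i)))"
  proof (rule smooth_on_local)
    fix x assume "x \<in> snd c ` fst c"
    then obtain p where p: "p \<in> fst c" "x = snd c p" by blast
    let ?c' = "chart_at B (f p)"
    have c': "?c' \<in> B" "f p \<in> fst ?c'"
      using chart_at_in_charts_at[OF assms(2), of "f p"] by (auto simp: charts_at_iff)
    let ?S = "snd c ` (fst c \<inter> f -` fst ?c')"
    have S: "open ?S" by (rule open_local_rep_domain[OF assms(1-3) c c'(1)])
    have "smooth_on ?S
      (\<lambda>x. pull A B f \<beta> (chart_inv c x) (\<lambda>i. tvec_of A c (chart_inv c x) (w i)))"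
    proof (rule smooth_on_cong[OF S _ smooth[OF c c'(1), of w]])
      fix y assume "y \<in> ?S"
      then obtain q where q: "q \<in> fst c" "f q \<in> fst ?c'" "y = snd c q" by blast
      have "chart_inv c y = q" using q c smooth_atlas_is_chart[OF assms(1)] chart_inv_chart by blast
      then show "\<beta> (chart_inv c y) (\<lambda>i. tvec_of B ?c' (f (chart_inv c y))
         (frechet_derivative (local_rep c ?c' f) (at y) (w i)))
        = pull A B f \<beta> (chart_inv c y) (\<lambda>i. tvec_of A c (chart_inv c y) (w i))"
        using differential_tvec_of[OF assms(1-3), of c q ?c'] q c c'
        by (simp add: pull_def charts_at_iff)
    qed
    moreover have "x \<in> ?S" using p c' by blast
    ultimately show "\<exists>T. open T \<and> x \<in> T \<and> smooth_on T
      (\<lambda>x. pull A B f \<beta> (chart_inv c x) (\<lambda>i. tvec_of A c (chart_inv c x) (w i)))"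
      using S by blast
  qed
  then show "smooth_on (snd c ` (fst c \<inter> UNIV))
    (\<lambda>x. pull A B f \<beta> (chart_inv c x) (\<lambda>i. tvec_of A c (chart_inv c x) (w i)))" by simp
qed

lemma local_rep_smooth:
  "smooth_map A B f \<Longrightarrow> c \<in> A \<Longrightarrow> c' \<in> B \<Longrightarrow> smooth_on (snd c ` (fst c \<inter> f -` fst c')) (local_rep c c' f)"
  by (simp add: smooth_map_def)

lemma chart_inv_local_rep:
  assumes "is_chart c" "is_chart c'" "x \<in> snd c ` (fst c \<inter> f -` fst c')"
  shows "chart_inv c' (local_rep c c' f x) = f (chart_inv c x)"
  using assms by (auto simp: local_rep_def chart_inv_chart)

lemma local_rep_image:
  assumes "is_chart c"
  shows "local_rep c c' f ` (snd c ` (fst c \<inter> f -` fst c')) \<subseteq> snd c' ` fst c'"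
  using assms by (auto simp: local_rep_def chart_inv_chart)

lemma smooth_form_pullback:
  fixes A :: "('n::{t2_space, second_countable_topology}, 'd::finite) chart set"
    and B :: "('m::{t2_space, second_countable_topology}, 'e::finite) chart set"
  assumes "smooth_atlas A" "smooth_atlas B" "smooth_map A B f" "smooth_form B k \<alpha>"
  shows "smooth_form A k (pullback A B f \<alpha>)"
  unfolding pullback_def
proof (rule smooth_form_pullI[OF assms(1-3)])
  show "alt_form (tangent_space B (f p)) k (\<alpha> (f p))" for p
    by (rule smooth_form_alt_form[OF assms(4)])
  fix c c' w assume c: "c \<in> A" "c' \<in> B"
  let ?S = "snd c ` (fst c \<inter> f -` fst c')"
  note charts = smooth_atlas_is_chart[OF assms(1) c(1)] smooth_atlas_is_chart[OF assms(2) c(2)]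
  note S = open_local_rep_domain[OF assms(1-3) c]
  note h = local_rep_smooth[OF assms(3) c]
  show "smooth_on ?S (\<lambda>x. \<alpha> (f (chart_inv c x)) (\<lambda>i. tvec_of B c' (f (chart_inv c x))
      (frechet_derivative (local_rep c c' f) (at x) (w i))))"
    by (rule smooth_on_cong[OF S _ smooth_form_eval_smooth[OF assms(2) c(2) assms(4) S h
            local_rep_image[OF charts(1)] smooth_on_frechet_derivative[OF h]]])
      (simp add: chart_inv_local_rep[OF charts])
qed

lemma smooth_form_pull_contract:
  fixes A :: "('n::{t2_space, second_countable_topology}, 'd::finite) chart set"
    and B :: "('m::{t2_space, second_countable_topology}, 'e::finite) chart set"
  assumes "smooth_atlas A" "smooth_atlas B" "smooth_map A B f" "smooth_form B (Suc k) \<alpha>"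
    and \<nu>: "smooth_field_along A B f \<nu>"
  shows "smooth_form A k (pull A B f (\<lambda>p. contract (\<nu> p) (\<alpha> (f p))))"
proof (rule smooth_form_pullI[OF assms(1-3)])
  show "alt_form (tangent_space B (f p)) k (contract (\<nu> p) (\<alpha> (f p)))" for p
    using \<nu> by (intro alt_form_contract smooth_form_alt_form[OF assms(4)])
      (simp add: smooth_field_along_def)
  fix c c' w assume c: "c \<in> A" "c' \<in> B"
  let ?S = "snd c ` (fst c \<inter> f -` fst c')"
  note charts = smooth_atlas_is_chart[OF assms(1) c(1)] smooth_atlas_is_chart[OF assms(2) c(2)]
  note S = open_local_rep_domain[OF assms(1-3) c]
  note h = local_rep_smooth[OF assms(3) c]
  let ?u = "\<lambda>i x. case i of 0 \<Rightarrow> \<nu> (chart_inv c x) c'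
    | Suc j \<Rightarrow> frechet_derivative (local_rep c c' f) (at x) (w j)"
  have u: "smooth_on ?S (?u i)" for i
    using \<nu> c smooth_on_frechet_derivative[OF h]
    by (cases i) (auto simp: smooth_field_along_def)
  show "smooth_on ?S (\<lambda>x. contract (\<nu> (chart_inv c x)) (\<alpha> (f (chart_inv c x)))
      (\<lambda>i. tvec_of B c' (f (chart_inv c x)) (frechet_derivative (local_rep c c' f) (at x) (w i))))"
  proof (rule smooth_on_cong[OF S _ smooth_form_eval_smooth[OF assms(2) c(2) assms(4) S h
            local_rep_image[OF charts(1)] u]])
    fix x assume x: "x \<in> ?S"
    let ?q = "chart_inv c x"
    have "f ?q \<in> fst c'" using x charts by (auto simp: chart_inv_chart)
    then have "tvec_of B c' (f ?q) (\<nu> ?q c') = \<nu> ?q"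
      using c \<nu> by (intro tvec_of_coordinates) (auto simp: charts_at_iff smooth_field_along_def)
    then have "(\<lambda>i. tvec_of B c' (f ?q) (?u i x)) = case_nat (\<nu> ?q)
      (\<lambda>i. tvec_of B c' (f ?q) (frechet_derivative (local_rep c c' f) (at x) (w i)))"
      by (auto simp: fun_eq_iff split: nat.split)
    then show "\<alpha> (chart_inv c' (local_rep c c' f x))
        (\<lambda>i. tvec_of B c' (chart_inv c' (local_rep c c' f x)) (?u i x))
      = contract (\<nu> ?q) (\<alpha> (f ?q))
        (\<lambda>i. tvec_of B c' (f ?q) (frechet_derivative (local_rep c c' f) (at x) (w i)))"
      by (simp add: contract_def chart_inv_local_rep[OF charts x])
  qed
qed

lemma smooth_form_uminus:
  assumes "smooth_atlas A" "smooth_form A k \<alpha>"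
  shows "smooth_form A k (\<lambda>p v. - \<alpha> p v)"
proof -
  have "open (snd c ` fst c)" if "c \<in> A" for c
    using smooth_atlas_is_chart[OF assms(1) that] by (simp add: is_chart_def)
  then show ?thesis
    using assms(2) unfolding smooth_form_on_def
    by (auto intro!: alt_form_uminus smooth_on_uminus)
qed

text \<open>The product rule for the evaluation of a form on vector fields along a map: the first term
  differentiates the form in the direction \<open>h' t\<close>, the others one vector field each.\<close>

lemma has_derivative_form_along_map:
  fixes c :: "('m::{t2_space, second_countable_topology}, 'd::finite) chart"
    and h :: "'a::real_normed_vector \<Rightarrow> real ^ 'd" and \<alpha> :: "('m, 'd) form"
    and A :: "('m, 'd) chart set"
  defines "a \<equiv> \<lambda>y w. \<alpha> (chart_inv c y) (\<lambda>i. tvec_of A c (chart_inv c y) (w i))"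
  assumes A: "smooth_atlas A" "c \<in> A" "smooth_form A k \<alpha>"
    and S: "open S" "x \<in> S" "h ` S \<subseteq> snd c ` fst c"
    and h: "(h has_derivative h') (at x)"
    and u: "\<And>i. i < k \<Longrightarrow> (u i has_derivative u' i) (at x)"
  shows "((\<lambda>x. a (h x) (\<lambda>i. u i x)) has_derivative (\<lambda>t.
      frechet_derivative (\<lambda>y. a y (\<lambda>i. u i x)) (at (h x)) (h' t)
      + (\<Sum>j<k. a (h x) ((\<lambda>i. u i x)(j := u' j t))))) (at x)"
proof -
  let ?V = "snd c ` fst c" and ?\<Phi> = "{..<k} \<rightarrow>\<^sub>E (UNIV :: 'd set)"
  define C where "C = (\<lambda>\<phi> y. a y (\<lambda>i. axis (\<phi> i) 1))"
  have chart: "is_chart c" using smooth_atlas_is_chart A by blast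
  then have V: "open ?V" by (simp add: is_chart_def)
  have hx: "h x \<in> ?V" using S by blast
  have expand: "a y w = (\<Sum>\<phi>\<in>?\<Phi>. (\<Prod>i<k. w i $ \<phi> i) * C \<phi> y)" if "y \<in> ?V" for y w
  proof -
    have "c \<in> charts_at A (chart_inv c y)"
      using chart_inv_in[OF chart that] A(2) by (simp add: charts_at_iff)
    then show ?thesis
      using alt_form_tvec_of_expand[OF A(1) _ smooth_form_alt_form[OF A(3)]]
      by (simp add: a_def C_def)
  qed
  have C: "(C \<phi> has_derivative frechet_derivative (C \<phi>) (at y)) (at y)" if "y \<in> ?V" for \<phi> y
  proof -
    have "smooth_on ?V (C \<phi>)"
      unfolding C_def a_def by (rule smooth_form_coordinates[OF A(3,2)])
    then show ?thesis
      using smooth_on_differentiable[OF _ that] frechet_derivative_works by blast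
  qed
  have point: "frechet_derivative (\<lambda>y. a y w) (at (h x))
      = (\<lambda>s. \<Sum>\<phi>\<in>?\<Phi>. (\<Prod>i<k. w i $ \<phi> i) * frechet_derivative (C \<phi>) (at (h x)) s)" for w
  proof -
    have "((\<lambda>y. \<Sum>\<phi>\<in>?\<Phi>. (\<Prod>i<k. w i $ \<phi> i) * C \<phi> y) has_derivative
        (\<lambda>s. \<Sum>\<phi>\<in>?\<Phi>. (\<Prod>i<k. w i $ \<phi> i) * frechet_derivative (C \<phi>) (at (h x)) s)) (at (h x))"
      by (intro has_derivative_sum has_derivative_mult_right C hx)
    then have "((\<lambda>y. a y w) has_derivative
        (\<lambda>s. \<Sum>\<phi>\<in>?\<Phi>. (\<Prod>i<k. w i $ \<phi> i) * frechet_derivative (C \<phi>) (at (h x)) s)) (at (h x))"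
      by (rule has_derivative_transform_within_open[OF _ V hx]) (simp add: expand)
    then show ?thesis by (rule frechet_derivative_at[symmetric])
  qed
  have slot: "a (h x) ((\<lambda>i. u i x)(j := z))
      = (\<Sum>\<phi>\<in>?\<Phi>. (z $ \<phi> j * (\<Prod>i\<in>{..<k} - {j}. u i x $ \<phi> i)) * C \<phi> (h x))" if "j < k" for j z
  proof -
    have "(\<Prod>i<k. ((\<lambda>i. u i x)(j := z)) i $ \<phi> i) = z $ \<phi> j * (\<Prod>i\<in>{..<k} - {j}. u i x $ \<phi> i)" for \<phi>
      using that by (subst prod.remove[of _ j]) (auto intro!: prod.cong)
    then show ?thesis by (simp only: expand[OF hx])
  qed
  have comp: "((\<lambda>x. u i x $ m) has_derivative (\<lambda>t. u' i t $ m)) (at x)" if "i < k" for i m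
    using bounded_linear.has_derivative[OF bounded_linear_vec_nth u[OF that]] .
  have "((\<lambda>x. \<Sum>\<phi>\<in>?\<Phi>. (\<Prod>i<k. u i x $ \<phi> i) * C \<phi> (h x)) has_derivative
      (\<lambda>t. \<Sum>\<phi>\<in>?\<Phi>. (\<Prod>i<k. u i x $ \<phi> i) * frechet_derivative (C \<phi>) (at (h x)) (h' t)
        + (\<Sum>j<k. u' j t $ \<phi> j * (\<Prod>i\<in>{..<k} - {j}. u i x $ \<phi> i)) * C \<phi> (h x))) (at x)"
    by (intro has_derivative_sum has_derivative_mult has_derivative_prod comp
        has_derivative_compose[OF h C[OF hx]]) simp
  also have "(\<lambda>t. \<Sum>\<phi>\<in>?\<Phi>. (\<Prod>i<k. u i x $ \<phi> i) * frechet_derivative (C \<phi>) (at (h x)) (h' t)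
        + (\<Sum>j<k. u' j t $ \<phi> j * (\<Prod>i\<in>{..<k} - {j}. u i x $ \<phi> i)) * C \<phi> (h x))
    = (\<lambda>t. frechet_derivative (\<lambda>y. a y (\<lambda>i. u i x)) (at (h x)) (h' t)
      + (\<Sum>j<k. a (h x) ((\<lambda>i. u i x)(j := u' j t))))"
    by (simp add: point slot sum.distrib sum_distrib_right fun_eq_iff)
      (subst sum.swap, simp)
  finally show ?thesis
    by (rule has_derivative_transform_within_open[OF _ S(1,2)])
      (use S(3) in \<open>auto simp: expand\<close>)
qed

text \<open>The index map \<open>\<lambda>l. if l < i then l else Suc l\<close> omits the entry \<open>i\<close> of a sequence. An
  entry \<open>b\<close> that stands in for entry \<open>j = i + n + 1\<close> can be moved to the position of entry \<open>i\<close> by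
  \<open>n\<close> neighbour swaps; the other entries then form the sequence with entry \<open>j\<close> omitted.\<close>

lemma alt_form_move_slot:
  assumes "smooth_atlas A" "alt_form (tangent_space A p) k \<alpha>"
    and "\<And>l. l \<le> k \<Longrightarrow> w l \<in> tangent_space A p" "b \<in> tangent_space A p" "i + n < k"
  shows "\<alpha> ((\<lambda>l. w (if l < i then l else Suc l))(i + n := b))
    = (- 1) ^ n * \<alpha> ((\<lambda>l. w (if l < Suc (i + n) then l else Suc l))(i := b))"
  using assms(3,5)
proof (induction n arbitrary: w)
  case 0
  have "(\<lambda>l. w (if l < i then l else Suc l))(i := b)
      = (\<lambda>l. w (if l < Suc i then l else Suc l))(i := b)"
    by (auto simp: fun_eq_iff)
  then show ?case by simp
next
  case (Suc n)
  let ?v = "(\<lambda>l. w (if l < i then l else Suc l))(i + Suc n := b)"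
  \<comment> \<open>swapping the slots \<open>i + n\<close> and \<open>i + n + 1\<close> moves \<open>b\<close> one step down and leaves entry \<open>i + n + 1\<close>
    of \<open>w\<close> one slot further up, where \<open>?w\<close> places it\<close>
  let ?w = "w(Suc (Suc (i + n)) := w (Suc (i + n)))"
  have "?v l \<in> tangent_space A p" if "l < k" for l
    using that Suc.prems assms(4) by auto
  then have swap: "\<alpha> (?v \<circ> Transposition.transpose (i + n) (Suc (i + n))) = - \<alpha> ?v"
    using Suc.prems by (intro alt_form_swap[OF assms(2,1)]) auto
  have "?v \<circ> Transposition.transpose (i + n) (Suc (i + n))
      = (\<lambda>l. ?w (if l < i then l else Suc l))(i + n := b)"
    by (auto simp: fun_eq_iff Transposition.transpose_def)
  moreover have "\<alpha> ((\<lambda>l. ?w (if l < i then l else Suc l))(i + n := b))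
      = (- 1) ^ n * \<alpha> ((\<lambda>l. ?w (if l < Suc (i + n) then l else Suc l))(i := b))"
    using Suc.prems by (intro Suc.IH) auto
  moreover have "(\<lambda>l. ?w (if l < Suc (i + n) then l else Suc l))
      = (\<lambda>l. w (if l < Suc (i + Suc n) then l else Suc l))"
    by (auto simp: fun_eq_iff less_Suc_eq)
  ultimately have "- \<alpha> ?v
      = (- 1) ^ n * \<alpha> ((\<lambda>l. w (if l < Suc (i + Suc n) then l else Suc l))(i := b))"
    using swap by (simp only:)
  moreover have "x = (- 1) ^ Suc n * y" if "- x = (- 1) ^ n * y" for x y :: real
    using that by simp
  ultimately show ?case by blast
qed

text \<open>The term with \<open>b i j\<close> in the place of entry \<open>j\<close> and entry \<open>i\<close> omitted cancels against the
  term with the roles of \<open>i\<close> and \<open>j\<close> exchanged: for \<open>i < j\<close> moving the exceptional slot costs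
  \<open>(- 1) ^ (j - i - 1)\<close>, whereas the signs in front differ by \<open>(- 1) ^ (j - i)\<close>.\<close>

lemma alternating_sum_symmetric_slot_eq_0:
  assumes "smooth_atlas A" "alt_form (tangent_space A p) k \<alpha>"
    and w: "\<And>l. l \<le> k \<Longrightarrow> w l \<in> tangent_space A p"
    and b: "\<And>i j. i \<le> k \<Longrightarrow> j \<le> k \<Longrightarrow> b i j \<in> tangent_space A p"
    and sym: "\<And>i j. i \<le> k \<Longrightarrow> j \<le> k \<Longrightarrow> b i j = b j i"
  shows "(\<Sum>i\<le>k. (- 1) ^ i * (\<Sum>j<k. \<alpha> ((\<lambda>l. w (if l < i then l else Suc l))
      (j := b i (if j < i then j else Suc j))))) = 0"
proof -
  let ?t = "\<lambda>i j. (- 1) ^ i * \<alpha> ((\<lambda>l. w (if l < i then l else Suc l))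
      (j := b i (if j < i then j else Suc j)))"
  let ?P = "{..k} \<times> {..<k}"
  \<comment> \<open>The pair \<open>(i, j)\<close> stands for the omitted entry \<open>i\<close> and the entry \<open>m = (if j < i then j else Suc j)\<close>
    in slot \<open>j\<close>; the involution \<open>?\<tau>\<close> exchanges \<open>i\<close> and \<open>m\<close>.\<close>
  let ?\<tau> = "\<lambda>(i, j). if j < i then (j, i - 1) else (Suc j, i)"
  have up: "?t (Suc j) i = - ?t i j" if "i \<le> j" "j < k" for i j
  proof -
    have "?t i j = (- 1) ^ i * \<alpha> ((\<lambda>l. w (if l < i then l else Suc l))(i + (j - i) := b i (Suc j)))"
      using that by simp
    also have "\<dots> = (- 1) ^ i * ((- 1) ^ (j - i) * \<alpha> ((\<lambda>l. w (if l < Suc j then l else Suc l))(i := b i (Suc j))))"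
      using that w b
        alt_form_move_slot[OF assms(1,2), where w = w and b = "b i (Suc j)" and i = i and n = "j - i"]
      by simp
    also have "\<dots> = (- 1) ^ j * \<alpha> ((\<lambda>l. w (if l < Suc j then l else Suc l))(i := b (Suc j) i))"
      using that sym[of i "Suc j"] by (simp add: power_add[symmetric] mult.assoc[symmetric])
    finally show ?thesis using that by simp
  qed
  have anti: "case_prod ?t (?\<tau> q) = - case_prod ?t q" if qP: "q \<in> ?P" for q
  proof -
    obtain i j where q: "q = (i, j)" "i \<le> k" "j < k" using qP by auto
    show ?thesis
    proof (cases "j < i")
      case True
      then obtain i' where "i = Suc i'" by (cases i) auto
      then show ?thesis using up[of j i'] q True by simp
    next
      case False
      then show ?thesis using up[of i j] q by simp
    qed
  qed
  have "(\<Sum>q\<in>?P. case_prod ?t q) = (\<Sum>q\<in>?P. case_prod ?t (?\<tau> q))"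
    by (rule sum.reindex_bij_witness[where i = ?\<tau> and j = ?\<tau>]) (auto split: if_splits)
  also have "\<dots> = - (\<Sum>q\<in>?P. case_prod ?t q)"
    by (simp only: anti sum_negf cong: sum.cong)
  finally have "(\<Sum>q\<in>?P. case_prod ?t q) = 0" by simp
  then show ?thesis
    by (simp add: sum.cartesian_product sum_distrib_left)
qed

text \<open>By the chain rule the derivative of the pulled back components consists of the pulled back
  derivative and of terms with a second derivative of the local representation of the map in one
  slot. The latter cancel because second derivatives are symmetric.\<close>

lemma ext_d_pullback:
  fixes A :: "('n::{t2_space, second_countable_topology}, 'd::finite) chart set"
    and B :: "('m::{t2_space, second_countable_topology}, 'e::finite) chart set"
  assumes "smooth_atlas A" "smooth_atlas B" "smooth_map A B f" "smooth_form B k \<alpha>"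
  shows "ext_d A k (pullback A B f \<alpha>) p v = ext_d B k \<alpha> (f p) (\<lambda>i. differential A B f p (v i))"
proof -
  let ?c = "chart_at A p" and ?c' = "chart_at B (f p)"
  have cA: "?c \<in> charts_at A p" and cB: "?c' \<in> charts_at B (f p)"
    using chart_at_in_charts_at assms(1,2) by blast+
  then have c: "?c \<in> A" "?c' \<in> B" "p \<in> fst ?c" "f p \<in> fst ?c'" by (auto simp: charts_at_iff)
  let ?S = "snd ?c ` (fst ?c \<inter> f -` fst ?c')" and ?x = "snd ?c p"
  let ?h = "local_rep ?c ?c' f"
  let ?dh = "\<lambda>w x. frechet_derivative ?h (at x) w"
  let ?a = "\<lambda>y w. \<alpha> (chart_inv ?c' y) (\<lambda>i. tvec_of B ?c' (chart_inv ?c' y) (w i))"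
  let ?skip = "\<lambda>i j. if j < i then j else Suc j"
  let ?w = "\<lambda>j. v j ?c"
  note charts = smooth_atlas_is_chart[OF assms(1) c(1)] smooth_atlas_is_chart[OF assms(2) c(2)]
  note S = open_local_rep_domain[OF assms(1-3) c(1,2)]
  note h = local_rep_smooth[OF assms(3) c(1,2)]
  have x: "?x \<in> ?S" using c by blast
  have hx: "chart_inv ?c' (?h ?x) = f p"
    using chart_inv_local_rep[OF charts x] c charts by (simp add: chart_inv_chart)
  have dh: "smooth_on ?S (?dh w)" for w by (rule smooth_on_frechet_derivative[OF h])
  have at: "?h ?x = snd ?c' (f p)"
    using c charts by (simp add: local_rep_def chart_inv_chart)
  have dif: "differential A B f p u ?c' = ?dh (u ?c) ?x" for u
    using cB by (simp add: differential_def Let_def)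
  have "frechet_derivative (\<lambda>x. pullback A B f \<alpha> (chart_inv ?c x)
        (\<lambda>j. tvec_of A ?c (chart_inv ?c x) (w j))) (at ?x) t
      = frechet_derivative (\<lambda>y. ?a y (\<lambda>j. ?dh (w j) ?x)) (at (?h ?x)) (?dh t ?x)
      + (\<Sum>j<k. ?a (?h ?x) ((\<lambda>i. ?dh (w i) ?x)(j := frechet_derivative (?dh (w j)) (at ?x) t)))"
    for w t
  proof -
    have "((\<lambda>x. ?a (?h x) (\<lambda>j. ?dh (w j) x)) has_derivative (\<lambda>t.
        frechet_derivative (\<lambda>y. ?a y (\<lambda>j. ?dh (w j) ?x)) (at (?h ?x)) (?dh t ?x)
      + (\<Sum>j<k. ?a (?h ?x) ((\<lambda>i. ?dh (w i) ?x)(j := frechet_derivative (?dh (w j)) (at ?x) t))))) (at ?x)"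
      by (rule has_derivative_form_along_map[OF assms(2) c(2) assms(4) S x local_rep_image[OF charts(1)]])
        (use smooth_on_differentiable[OF h x] smooth_on_differentiable[OF dh x] in
          \<open>simp_all add: frechet_derivative_works\<close>)
    then have "((\<lambda>x. pullback A B f \<alpha> (chart_inv ?c x)
        (\<lambda>j. tvec_of A ?c (chart_inv ?c x) (w j))) has_derivative (\<lambda>t.
        frechet_derivative (\<lambda>y. ?a y (\<lambda>j. ?dh (w j) ?x)) (at (?h ?x)) (?dh t ?x)
      + (\<Sum>j<k. ?a (?h ?x) ((\<lambda>i. ?dh (w i) ?x)(j := frechet_derivative (?dh (w j)) (at ?x) t))))) (at ?x)"
    proof (rule has_derivative_transform_within_open[OF _ S x])
      fix y assume y: "y \<in> ?S"
      then obtain q where q: "q \<in> fst ?c" "f q \<in> fst ?c'" "y = snd ?c q" by blast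
      have "chart_inv ?c y = q" using q charts chart_inv_chart by blast
      then show "?a (?h y) (\<lambda>j. ?dh (w j) y)
          = pullback A B f \<alpha> (chart_inv ?c y) (\<lambda>j. tvec_of A ?c (chart_inv ?c y) (w j))"
        using differential_tvec_of[OF assms(1-3), of ?c q ?c'] q c chart_inv_local_rep[OF charts y]
        by (simp add: pullback_def pull_def charts_at_iff)
    qed
    then show ?thesis by (simp add: frechet_derivative_at[symmetric])
  qed
  then have "ext_d A k (pullback A B f \<alpha>) p v = (\<Sum>i\<le>k. (- 1) ^ i *
      (frechet_derivative (\<lambda>y. ?a y (\<lambda>j. ?dh (?w (?skip i j)) ?x)) (at (?h ?x)) (?dh (?w i) ?x)
      + (\<Sum>j<k. ?a (?h ?x) ((\<lambda>l. ?dh (?w (?skip i l)) ?x)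
          (j := frechet_derivative (?dh (?w (?skip i j))) (at ?x) (?w i))))))"
    by (simp only: ext_d_def Let_def)
  also have "\<dots> = ext_d B k \<alpha> (f p) (\<lambda>i. differential A B f p (v i))
      + (\<Sum>i\<le>k. (- 1) ^ i * (\<Sum>j<k. ?a (?h ?x) ((\<lambda>l. ?dh (?w (?skip i l)) ?x)
          (j := frechet_derivative (?dh (?w (?skip i j))) (at ?x) (?w i)))))"
    by (simp only: ext_d_def Let_def dif at distrib_left sum.distrib)
  also have "(\<Sum>i\<le>k. (- 1) ^ i * (\<Sum>j<k. ?a (?h ?x) ((\<lambda>l. ?dh (?w (?skip i l)) ?x)
          (j := frechet_derivative (?dh (?w (?skip i j))) (at ?x) (?w i))))) = 0"
  proof -
    let ?t = "tvec_of B ?c' (f p)"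
    have T: "?t z \<in> tangent_space B (f p)" for z
      by (rule tvec_of_in_tangent_space[OF assms(2) cB])
    have upd: "(\<lambda>l. ?t ((u(j := z)) l)) = (\<lambda>l. ?t (u l))(j := ?t z)" for u j z
      by auto
    show ?thesis
      unfolding hx upd
      by (rule alternating_sum_symmetric_slot_eq_0[OF assms(2) smooth_form_alt_form[OF assms(4)],
            where w = "\<lambda>l. ?t (?dh (?w l) ?x)"
              and b = "\<lambda>i j. ?t (frechet_derivative (?dh (?w j)) (at ?x) (?w i))"])
        (simp_all only: T symmetric_second_derivative[OF S h x])
  qed
  finally show ?thesis by simp
qed

lemma ext_d_cong:
  fixes A :: "('n::{t2_space, second_countable_topology}, 'd::finite) chart set"
  assumes "smooth_atlas A" "smooth_form A k \<alpha>"
    and eq: "\<And>q. form_eq (tangent_space A q) k (\<alpha> q) (\<beta> q)"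
  shows "ext_d A k \<alpha> p v = ext_d A k \<beta> p v"
proof -
  let ?c = "chart_at A p"
  have c: "?c \<in> A" "p \<in> fst ?c"
    using chart_at_in_charts_at[OF assms(1), of p] by (auto simp: charts_at_iff)
  have chart: "is_chart ?c" by (rule smooth_atlas_is_chart[OF assms(1) c(1)])
  have "frechet_derivative (\<lambda>x. \<alpha> (chart_inv ?c x) (\<lambda>j. tvec_of A ?c (chart_inv ?c x) (w j))) (at (snd ?c p))
      = frechet_derivative (\<lambda>x. \<beta> (chart_inv ?c x) (\<lambda>j. tvec_of A ?c (chart_inv ?c x) (w j))) (at (snd ?c p))"
    for w
  proof (rule frechet_derivative_transform_within_open)
    show "open (snd ?c ` fst ?c)" "snd ?c p \<in> snd ?c ` fst ?c"
      using chart c by (auto simp: is_chart_def)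
    then show "(\<lambda>x. \<alpha> (chart_inv ?c x) (\<lambda>j. tvec_of A ?c (chart_inv ?c x) (w j)))
        differentiable at (snd ?c p)"
      by (intro smooth_on_differentiable[OF smooth_form_coordinates[OF assms(2) c(1)]])
    fix x assume "x \<in> snd ?c ` fst ?c"
    then have cx: "?c \<in> charts_at A (chart_inv ?c x)"
      using c chart_inv_in[OF chart] by (simp add: charts_at_iff)
    show "\<alpha> (chart_inv ?c x) (\<lambda>j. tvec_of A ?c (chart_inv ?c x) (w j))
        = \<beta> (chart_inv ?c x) (\<lambda>j. tvec_of A ?c (chart_inv ?c x) (w j))"
      using eq[of "chart_inv ?c x"] tvec_of_in_tangent_space[OF assms(1) cx]
      by (simp add: form_eq_def)
  qed
  then show ?thesis by (simp add: ext_d_def Let_def)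
qed

section \<open>Wedge products\<close>

text \<open>Composition with the transposition of two equal arguments permutes the summands of a wedge
  product and reverses their signs, so that the sum vanishes.\<close>

lemma alt_form_wedge:
  fixes \<alpha> \<beta> :: "(nat \<Rightarrow> ('m, 'd::finite) tvec) \<Rightarrow> real"
  assumes "alt_form T k \<alpha>" "alt_form T l \<beta>" "\<And>a x b y. x \<in> T \<Longrightarrow> y \<in> T \<Longrightarrow> tcomb a x b y \<in> T"
  shows "alt_form T (k + l) (wedge k l \<alpha> \<beta>)"
proof -
  let ?S = "{\<sigma>. \<sigma> permutes {..<k + l}}"
  let ?g = "\<lambda>\<sigma> v. of_int (sign \<sigma>) * \<alpha> (\<lambda>i. v (\<sigma> i)) * \<beta> (\<lambda>i. v (\<sigma> (k + i)))"
  have T: "v (\<sigma> i) \<in> T" if "\<forall>i<k + l. v i \<in> T" "\<sigma> \<in> ?S" "i < k + l" for v \<sigma> i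
    using that permutes_in_image[of \<sigma> "{..<k + l}" i] by auto
  show ?thesis
    unfolding alt_form_def
  proof (intro conjI allI impI)
    fix v w :: "nat \<Rightarrow> ('m, 'd) tvec"
    assume vw: "\<forall>i<k + l. v i \<in> T \<and> v i = w i"
    have "?g \<sigma> v = ?g \<sigma> w" if \<sigma>: "\<sigma> \<in> ?S" for \<sigma>
    proof -
      have \<sigma>i: "\<sigma> i < k + l" if "i < k + l" for i
        using \<sigma> permutes_in_image[of \<sigma> "{..<k + l}" i] that by simp
      have vT: "v (\<sigma> i) \<in> T" and vw_eq: "v (\<sigma> i) = w (\<sigma> i)" if "i < k + l" for i
        using vw \<sigma>i[OF that] by blast+
      have "\<alpha> (\<lambda>i. v (\<sigma> i)) = \<alpha> (\<lambda>i. w (\<sigma> i))"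
        by (rule alt_form_cong[OF assms(1)], rule vT, simp, rule vw_eq, simp)
      moreover have "\<beta> (\<lambda>i. v (\<sigma> (k + i))) = \<beta> (\<lambda>i. w (\<sigma> (k + i)))"
        by (rule alt_form_cong[OF assms(2)], rule vT, simp, rule vw_eq, simp)
      ultimately show ?thesis by simp
    qed
    then show "wedge k l \<alpha> \<beta> v = wedge k l \<alpha> \<beta> w"
      unfolding wedge_def by (intro arg_cong2[where f = "(/)"] sum.cong refl) auto
  next
    fix v :: "nat \<Rightarrow> ('m, 'd) tvec" and i a x b y
    assume as: "(\<forall>j<k + l. v j \<in> T) \<and> i < k + l \<and> x \<in> T \<and> y \<in> T"
    have "?g \<sigma> (v(i := tcomb a x b y)) = a * ?g \<sigma> (v(i := x)) + b * ?g \<sigma> (v(i := y))"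
      if \<sigma>: "\<sigma> \<in> ?S" for \<sigma>
    proof -
      from \<sigma> have \<sigma>p: "\<sigma> permutes {..<k + l}" by simp
      obtain m where m: "m < k + l" "\<sigma> m = i"
        using as permutes_image[OF \<sigma>p] by (metis imageE lessThan_iff)
      have inj: "\<sigma> j = i \<longleftrightarrow> j = m" for j
        using permutes_inj[OF \<sigma>p] m by (auto dest: injD)
      have up: "(\<lambda>j. (v(i := z)) (\<sigma> j)) = (\<lambda>j. v (\<sigma> j))(m := z)" for z
        using inj by (auto simp: fun_eq_iff)
      have up2: "(\<lambda>j. (v(i := z)) (\<sigma> (k + j)))
          = (if m < k then (\<lambda>j. v (\<sigma> (k + j))) else (\<lambda>j. v (\<sigma> (k + j)))(m - k := z))" for z
        using inj by (auto simp: fun_eq_iff)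
      show ?thesis
      proof (cases "m < k")
        case True
        have "\<alpha> ((\<lambda>j. v (\<sigma> j))(m := tcomb a x b y))
            = a * \<alpha> ((\<lambda>j. v (\<sigma> j))(m := x)) + b * \<alpha> ((\<lambda>j. v (\<sigma> j))(m := y))"
          using as T[OF _ \<sigma>] True by (intro alt_form_tcomb[OF assms(1)]) auto
        then show ?thesis unfolding up up2 using True by (simp add: algebra_simps)
      next
        case False
        have "\<beta> ((\<lambda>j. v (\<sigma> (k + j)))(m - k := tcomb a x b y))
            = a * \<beta> ((\<lambda>j. v (\<sigma> (k + j)))(m - k := x)) + b * \<beta> ((\<lambda>j. v (\<sigma> (k + j)))(m - k := y))"
          using as T[OF _ \<sigma>] False m by (intro alt_form_tcomb[OF assms(2)]) auto
        moreover have "\<alpha> ((\<lambda>j. v (\<sigma> j))(m := z)) = \<alpha> (\<lambda>j. v (\<sigma> j))" if "z \<in> T" for z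
          using as T[OF _ \<sigma>] False by (intro alt_form_cong[OF assms(1)]) auto
        ultimately show ?thesis
          unfolding up up2 using False as assms(3) by (simp add: algebra_simps)
      qed
    qed
    then have "(\<Sum>\<sigma>\<in>?S. ?g \<sigma> (v(i := tcomb a x b y)))
        = a * (\<Sum>\<sigma>\<in>?S. ?g \<sigma> (v(i := x))) + b * (\<Sum>\<sigma>\<in>?S. ?g \<sigma> (v(i := y)))"
      by (simp only: sum_distrib_left sum.distrib cong: sum.cong)
    then show "wedge k l \<alpha> \<beta> (v(i := tcomb a x b y))
        = a * wedge k l \<alpha> \<beta> (v(i := x)) + b * wedge k l \<alpha> \<beta> (v(i := y))"
      unfolding wedge_def by (simp only: add_divide_distrib times_divide_eq_right)
  next
    fix v :: "nat \<Rightarrow> ('m, 'd) tvec" and i j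
    assume as: "(\<forall>m<k + l. v m \<in> T) \<and> i < j \<and> j < k + l \<and> v i = v j"
    let ?\<tau> = "Transposition.transpose i j"
    have \<tau>: "?\<tau> permutes {..<k + l}" using as by (intro permutes_swap_id) auto
    have v: "v (?\<tau> m) = v m" for m
      using as by (auto simp: Transposition.transpose_def)
    have "?g (?\<tau> \<circ> \<sigma>) v = - ?g \<sigma> v" if "\<sigma> \<in> ?S" for \<sigma>
    proof -
      have "permutation \<sigma>" "permutation ?\<tau>"
        using that \<tau> permutation_permutes by auto
      then have "sign (?\<tau> \<circ> \<sigma>) = - sign \<sigma>"
        using as by (simp add: sign_compose sign_swap_id)
      then show ?thesis by (simp only: comp_apply v)
    qed
    then have "(\<Sum>\<sigma>\<in>?S. ?g (?\<tau> \<circ> \<sigma>) v) = - (\<Sum>\<sigma>\<in>?S. ?g \<sigma> v)"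
      by (simp only: sum_negf cong: sum.cong)
    moreover have "(\<Sum>\<sigma>\<in>?S. ?g (?\<tau> \<circ> \<sigma>) v) = (\<Sum>\<sigma>\<in>?S. ?g \<sigma> v)"
      by (rule setum_permutations_compose_left[OF \<tau>, symmetric])
    ultimately have "(\<Sum>\<sigma>\<in>?S. ?g \<sigma> v) = 0" by linarith
    then show "wedge k l \<alpha> \<beta> v = 0" unfolding wedge_def by (simp only: div_0)
  qed
qed

lemma smooth_form_wedge:
  assumes "smooth_atlas A" "smooth_form A k \<alpha>" "smooth_form A l \<beta>"
  shows "smooth_form A (k + l) (\<lambda>p. wedge k l (\<alpha> p) (\<beta> p))"
  unfolding smooth_form_on_def
proof (intro conjI ballI allI)
  show "alt_form (tangent_space A p) (k + l) (wedge k l (\<alpha> p) (\<beta> p))" for p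
    by (intro alt_form_wedge smooth_form_alt_form[OF assms(2)] smooth_form_alt_form[OF assms(3)]
        tangent_space_tcomb[OF assms(1)])
  fix c w assume c: "c \<in> A"
  have S: "open (snd c ` fst c)"
    using smooth_atlas_is_chart[OF assms(1) c] by (simp add: is_chart_def)
  show "smooth_on (snd c ` (fst c \<inter> UNIV))
      (\<lambda>x. wedge k l (\<alpha> (chart_inv c x)) (\<beta> (chart_inv c x)) (\<lambda>i. tvec_of A c (chart_inv c x) (w i)))"
    unfolding wedge_def divide_inverse Int_UNIV_right
    by (intro smooth_on_sum smooth_on_mult smooth_on_const S
        smooth_form_coordinates[OF assms(2) c] smooth_form_coordinates[OF assms(3) c])
qed

text \<open>In low degree the sum over all permutations collapses to one over shuffles, because the factors
  are antisymmetric. An alternating form on \<open>T\<close> is pinned down only for arguments in \<open>T\<close>, so the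
  factors are described there by functions \<open>a\<close>, \<open>b\<close> of individual vectors.\<close>

lemma wedge_1_1:
  assumes "\<And>u. u 0 \<in> T \<Longrightarrow> \<alpha> u = a (u 0)" "\<And>u. u 0 \<in> T \<Longrightarrow> \<beta> u = b (u 0)"
    and v: "v 0 \<in> T" "v 1 \<in> T"
  shows "wedge 1 1 \<alpha> \<beta> v = a (v 0) * b (v 1) - a (v 1) * b (v 0)"
proof -
  have S: "{..<1 + 1} = insert 0 {1::nat}" by auto
  have f: "finite {1::nat}" "0 \<notin> {1::nat}" by auto
  have "wedge 1 1 \<alpha> \<beta> v = (\<Sum>\<sigma> | \<sigma> permutes {..<1 + 1}.
      of_int (sign \<sigma>) * a (v (\<sigma> 0)) * b (v (\<sigma> 1))) / (fact 1 * fact 1)"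
    unfolding wedge_def
  proof (intro arg_cong2[where f = "(/)"] sum.cong refl)
    fix \<sigma> :: "nat \<Rightarrow> nat" assume "\<sigma> \<in> {\<sigma>. \<sigma> permutes {..<1 + 1}}"
    then have "\<sigma> i < 2" if "i < 2" for i
      using permutes_in_image[of \<sigma> "{..<1 + 1}" i] that by simp
    moreover have "v i \<in> T" if "i < 2" for i
      using that v by (auto simp: less_Suc_eq numeral_eq_Suc)
    ultimately show "of_int (sign \<sigma>) * \<alpha> (\<lambda>i. v (\<sigma> i)) * \<beta> (\<lambda>i. v (\<sigma> (1 + i)))
        = of_int (sign \<sigma>) * a (v (\<sigma> 0)) * b (v (\<sigma> 1))"
      using assms(1,2) by simp
  qed
  then show ?thesis
    unfolding S sum_over_permutations_insert[OF f] permutes_sing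
    by (simp add: sign_swap_id sign_id Transposition.transpose_def)
qed

lemma wedge_1_2:
  assumes "\<And>u. u 0 \<in> T \<Longrightarrow> \<alpha> u = a (u 0)"
    and "\<And>u. u 0 \<in> T \<Longrightarrow> u 1 \<in> T \<Longrightarrow> \<beta> u = b (u 0) (u 1)"
    and "\<And>x y. x \<in> T \<Longrightarrow> y \<in> T \<Longrightarrow> b y x = - b x y"
    and v: "v 0 \<in> T" "v 1 \<in> T" "v 2 \<in> T"
  shows "wedge 1 2 \<alpha> \<beta> v = a (v 0) * b (v 1) (v 2) - a (v 1) * b (v 0) (v 2) + a (v 2) * b (v 0) (v 1)" (is "_ = ?rhs")
proof -
  have S: "{..<1 + 2} = insert 0 (insert 1 {2::nat})" by auto
  have f: "finite {2::nat}" "1 \<notin> {2::nat}" "finite {1, 2::nat}" "0 \<notin> {1, 2::nat}" by auto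
  have sw: "b (v 1) (v 0) = - b (v 0) (v 1)" "b (v 2) (v 0) = - b (v 0) (v 2)"
    "b (v 2) (v 1) = - b (v 1) (v 2)"
    using assms(3) v by blast+
  have "wedge 1 2 \<alpha> \<beta> v = (\<Sum>\<sigma> | \<sigma> permutes {..<1 + 2}.
      of_int (sign \<sigma>) * a (v (\<sigma> 0)) * b (v (\<sigma> 1)) (v (\<sigma> 2))) / (fact 1 * fact 2)"
    unfolding wedge_def
  proof (intro arg_cong2[where f = "(/)"] sum.cong refl)
    fix \<sigma> :: "nat \<Rightarrow> nat" assume "\<sigma> \<in> {\<sigma>. \<sigma> permutes {..<1 + 2}}"
    then have "\<sigma> i < 3" if "i < 3" for i
      using permutes_in_image[of \<sigma> "{..<1 + 2}" i] that by simp
    moreover have "v i \<in> T" if "i < 3" for i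
      using that v by (auto simp: less_Suc_eq numeral_eq_Suc)
    ultimately show "of_int (sign \<sigma>) * \<alpha> (\<lambda>i. v (\<sigma> i)) * \<beta> (\<lambda>i. v (\<sigma> (1 + i)))
        = of_int (sign \<sigma>) * a (v (\<sigma> 0)) * b (v (\<sigma> 1)) (v (\<sigma> 2))"
      using assms(1,2) by (simp add: numeral_2_eq_2 numeral_3_eq_3)
  qed
  then have "wedge 1 2 \<alpha> \<beta> v * 2 = ?rhs * 2"
    unfolding S sum_over_permutations_insert[OF f(3,4)]
      sum_over_permutations_insert[OF f(1,2)] permutes_sing
    by (simp add: sign_swap_id sign_id sign_compose permutation_swap_id
        Transposition.transpose_def algebra_simps sw[unfolded One_nat_def])
  then show ?thesis by (rule mult_right_cancel[THEN iffD1, rotated]) simp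
qed

lemma wedge_2_1:
  assumes "\<And>u. u 0 \<in> T \<Longrightarrow> u 1 \<in> T \<Longrightarrow> \<alpha> u = a (u 0) (u 1)"
    and "\<And>x y. x \<in> T \<Longrightarrow> y \<in> T \<Longrightarrow> a y x = - a x y"
    and "\<And>u. u 0 \<in> T \<Longrightarrow> \<beta> u = b (u 0)"
    and v: "v 0 \<in> T" "v 1 \<in> T" "v 2 \<in> T"
  shows "wedge 2 1 \<alpha> \<beta> v = a (v 0) (v 1) * b (v 2) - a (v 0) (v 2) * b (v 1) + a (v 1) (v 2) * b (v 0)" (is "_ = ?rhs")
proof -
  have S: "{..<2 + 1} = insert 0 (insert 1 {2::nat})" by auto
  have f: "finite {2::nat}" "1 \<notin> {2::nat}" "finite {1, 2::nat}" "0 \<notin> {1, 2::nat}" by auto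
  have sw: "a (v 1) (v 0) = - a (v 0) (v 1)" "a (v 2) (v 0) = - a (v 0) (v 2)"
    "a (v 2) (v 1) = - a (v 1) (v 2)"
    using assms(2) v by blast+
  have "wedge 2 1 \<alpha> \<beta> v = (\<Sum>\<sigma> | \<sigma> permutes {..<2 + 1}.
      of_int (sign \<sigma>) * a (v (\<sigma> 0)) (v (\<sigma> 1)) * b (v (\<sigma> 2))) / (fact 2 * fact 1)"
    unfolding wedge_def
  proof (intro arg_cong2[where f = "(/)"] sum.cong refl)
    fix \<sigma> :: "nat \<Rightarrow> nat" assume "\<sigma> \<in> {\<sigma>. \<sigma> permutes {..<2 + 1}}"
    then have "\<sigma> i < 3" if "i < 3" for i
      using permutes_in_image[of \<sigma> "{..<2 + 1}" i] that by simp
    moreover have "v i \<in> T" if "i < 3" for i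
      using that v by (auto simp: less_Suc_eq numeral_eq_Suc)
    ultimately show "of_int (sign \<sigma>) * \<alpha> (\<lambda>i. v (\<sigma> i)) * \<beta> (\<lambda>i. v (\<sigma> (2 + i)))
        = of_int (sign \<sigma>) * a (v (\<sigma> 0)) (v (\<sigma> 1)) * b (v (\<sigma> 2))"
      using assms(1,3) by (simp add: numeral_2_eq_2 numeral_3_eq_3)
  qed
  then have "wedge 2 1 \<alpha> \<beta> v * 2 = ?rhs * 2"
    unfolding S sum_over_permutations_insert[OF f(3,4)]
      sum_over_permutations_insert[OF f(1,2)] permutes_sing
    by (simp add: sign_swap_id sign_id sign_compose permutation_swap_id
        Transposition.transpose_def algebra_simps sw[unfolded One_nat_def])
  then show ?thesis by (rule mult_right_cancel[THEN iffD1, rotated]) simp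
qed

lemma wedge_2_2:
  assumes "\<And>u. u 0 \<in> T \<Longrightarrow> u 1 \<in> T \<Longrightarrow> \<alpha> u = a (u 0) (u 1)"
    and "\<And>x y. x \<in> T \<Longrightarrow> y \<in> T \<Longrightarrow> a y x = - a x y"
    and "\<And>u. u 0 \<in> T \<Longrightarrow> u 1 \<in> T \<Longrightarrow> \<beta> u = b (u 0) (u 1)"
    and "\<And>x y. x \<in> T \<Longrightarrow> y \<in> T \<Longrightarrow> b y x = - b x y"
    and v: "v 0 \<in> T" "v 1 \<in> T" "v 2 \<in> T" "v 3 \<in> T"
  shows "wedge 2 2 \<alpha> \<beta> v =
      a (v 0) (v 1) * b (v 2) (v 3) - a (v 0) (v 2) * b (v 1) (v 3) + a (v 0) (v 3) * b (v 1) (v 2)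
    + a (v 1) (v 2) * b (v 0) (v 3) - a (v 1) (v 3) * b (v 0) (v 2) + a (v 2) (v 3) * b (v 0) (v 1)" (is "_ = ?rhs")
proof -
  have S: "{..<2 + 2} = insert 0 (insert 1 (insert 2 {3::nat}))" by auto
  have f: "finite {3::nat}" "2 \<notin> {3::nat}" "finite {2, 3::nat}" "1 \<notin> {2, 3::nat}"
    "finite {1, 2, 3::nat}" "0 \<notin> {1, 2, 3::nat}" by auto
  have sa: "a (v 1) (v 0) = - a (v 0) (v 1)" "a (v 2) (v 0) = - a (v 0) (v 2)"
    "a (v 3) (v 0) = - a (v 0) (v 3)" "a (v 2) (v 1) = - a (v 1) (v 2)"
    "a (v 3) (v 1) = - a (v 1) (v 3)" "a (v 3) (v 2) = - a (v 2) (v 3)"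
    using assms(2) v by blast+
  have sb: "b (v 1) (v 0) = - b (v 0) (v 1)" "b (v 2) (v 0) = - b (v 0) (v 2)"
    "b (v 3) (v 0) = - b (v 0) (v 3)" "b (v 2) (v 1) = - b (v 1) (v 2)"
    "b (v 3) (v 1) = - b (v 1) (v 3)" "b (v 3) (v 2) = - b (v 2) (v 3)"
    using assms(4) v by blast+
  have "wedge 2 2 \<alpha> \<beta> v = (\<Sum>\<sigma> | \<sigma> permutes {..<2 + 2}.
      of_int (sign \<sigma>) * a (v (\<sigma> 0)) (v (\<sigma> 1)) * b (v (\<sigma> 2)) (v (\<sigma> 3))) / (fact 2 * fact 2)"
    unfolding wedge_def
  proof (intro arg_cong2[where f = "(/)"] sum.cong refl)
    fix \<sigma> :: "nat \<Rightarrow> nat" assume "\<sigma> \<in> {\<sigma>. \<sigma> permutes {..<2 + 2}}"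
    then have "\<sigma> i < 4" if "i < 4" for i
      using permutes_in_image[of \<sigma> "{..<2 + 2}" i] that by simp
    moreover have "v i \<in> T" if "i < 4" for i
      using that v by (auto simp: less_Suc_eq numeral_eq_Suc)
    ultimately show "of_int (sign \<sigma>) * \<alpha> (\<lambda>i. v (\<sigma> i)) * \<beta> (\<lambda>i. v (\<sigma> (2 + i)))
        = of_int (sign \<sigma>) * a (v (\<sigma> 0)) (v (\<sigma> 1)) * b (v (\<sigma> 2)) (v (\<sigma> 3))"
      using assms(1,3) by (simp add: numeral_2_eq_2 numeral_3_eq_3)
  qed
  then have "wedge 2 2 \<alpha> \<beta> v * 4 = ?rhs * 4"
    unfolding S sum_over_permutations_insert[OF f(5,6)]
      sum_over_permutations_insert[OF f(3,4)] sum_over_permutations_insert[OF f(1,2)] permutes_sing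
    by (simp add: sign_swap_id sign_id sign_compose permutation_swap_id
        permutation_compose Transposition.transpose_def algebra_simps sa[unfolded One_nat_def] sb[unfolded One_nat_def])
  then show ?thesis by (rule mult_right_cancel[THEN iffD1, rotated]) simp
qed

text \<open>If a 1-form vanishes on all but the last of the vectors, only the permutations that fix the
  last index contribute, and they contribute equally.\<close>

lemma wedge_covector_last:
  fixes \<alpha> \<beta> :: "(nat \<Rightarrow> ('m::{t2_space, second_countable_topology}, 'd::finite) tvec) \<Rightarrow> real"
  assumes "smooth_atlas A" "alt_form (tangent_space A p) k \<alpha>" "alt_form (tangent_space A p) 1 \<beta>"
    and v: "\<And>i. i \<le> k \<Longrightarrow> v i \<in> tangent_space A p" "\<And>i. i < k \<Longrightarrow> \<beta> (\<lambda>_. v i) = 0"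
  shows "wedge k 1 \<alpha> \<beta> v = \<alpha> v * \<beta> (\<lambda>_. v k)"
proof -
  let ?S = "{\<sigma>. \<sigma> permutes {..<k + 1}}"
  let ?g = "\<lambda>\<sigma>. of_int (sign \<sigma>) * \<alpha> (\<lambda>i. v (\<sigma> i)) * \<beta> (\<lambda>i. v (\<sigma> (k + i)))"
  have \<beta>: "\<beta> (\<lambda>i. v (\<sigma> (k + i))) = \<beta> (\<lambda>_. v (\<sigma> k))" if "\<sigma> \<in> ?S" for \<sigma>
    using that v(1) permutes_in_image[of \<sigma> "{..<k + 1}" k]
    by (intro alt_form_cong[OF assms(3)]) auto
  have fix_k: "{\<sigma> \<in> ?S. \<sigma> k = k} = {\<sigma>. \<sigma> permutes {..<k}}"
  proof (intro equalityI subsetI)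
    fix \<sigma> assume \<sigma>: "\<sigma> \<in> {\<sigma> \<in> ?S. \<sigma> k = k}"
    then have "\<sigma> permutes {..<k + 1}" by simp
    then have "\<sigma> permutes {..<k}"
      by (rule permutes_superset) (use \<sigma> in auto)
    then show "\<sigma> \<in> {\<sigma>. \<sigma> permutes {..<k}}" by simp
  next
    fix \<sigma> assume "\<sigma> \<in> {\<sigma>. \<sigma> permutes {..<k}}"
    then have "\<sigma> permutes {..<k}" by simp
    then show "\<sigma> \<in> {\<sigma> \<in> ?S. \<sigma> k = k}"
      using permutes_subset[of \<sigma> "{..<k}" "{..<k + 1}"] permutes_not_in[of \<sigma> "{..<k}" k] by auto
  qed
  have "(\<Sum>\<sigma>\<in>?S. ?g \<sigma>) = (\<Sum>\<sigma> | \<sigma> permutes {..<k}. ?g \<sigma>)"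
    unfolding fix_k[symmetric]
  proof (rule sum.mono_neutral_right)
    show "finite ?S" by (simp add: finite_permutations)
    show "\<forall>\<sigma>\<in>?S - {\<sigma> \<in> ?S. \<sigma> k = k}. ?g \<sigma> = 0"
    proof
      fix \<sigma> assume \<sigma>: "\<sigma> \<in> ?S - {\<sigma> \<in> ?S. \<sigma> k = k}"
      then have "\<sigma> k < k" using permutes_in_image[of \<sigma> "{..<k + 1}" k] by auto
      then show "?g \<sigma> = 0" using \<beta> \<sigma> v(2) by simp
    qed
  qed auto
  also have "\<dots> = (\<Sum>\<sigma> | \<sigma> permutes {..<k}. \<alpha> v * \<beta> (\<lambda>_. v k))"
  proof (rule sum.cong[OF refl])
    fix \<sigma> assume "\<sigma> \<in> {\<sigma>. \<sigma> permutes {..<k}}"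
    then have \<sigma>: "\<sigma> permutes {..<k}" "\<sigma> \<in> ?S" "\<sigma> k = k" using fix_k by auto
    have "\<alpha> (\<lambda>i. v (\<sigma> i)) = of_int (sign \<sigma>) * \<alpha> v"
      using alt_form_permutes[OF assms(2,1) \<sigma>(1), of v] v(1) by (simp add: comp_def)
    moreover have "of_int (sign \<sigma>) * of_int (sign \<sigma>) = (1::real)"
      by (simp add: sign_def)
    ultimately show "?g \<sigma> = \<alpha> v * \<beta> (\<lambda>_. v k)" using \<beta>[OF \<sigma>(2)] \<sigma>(3) by simp
  qed
  also have "\<dots> = fact k * (\<alpha> v * \<beta> (\<lambda>_. v k))"
    by (simp add: card_permutations)
  finally show ?thesis unfolding wedge_def by simp
qed

section \<open>Unitary frames of complex three-space\<close>

text \<open>The Hermitian product is antilinear in the first argument; with this convention its imaginary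
  part is the form \<open>F\<close> of an SU(3)-structure in adapted coordinates, with the right sign.\<close>

definition hprod :: "complex ^ 3 \<Rightarrow> complex ^ 3 \<Rightarrow> complex" where
  "hprod x y = (\<Sum>k\<in>UNIV. cnj (x $ k) * y $ k)"

definition cvol :: "complex ^ 3 \<Rightarrow> complex ^ 3 \<Rightarrow> complex ^ 3 \<Rightarrow> complex" where
  "cvol x y z = det (vector [x, y, z])"

lemma hprod_sum: "hprod x y = cnj (x$1) * y$1 + cnj (x$2) * y$2 + cnj (x$3) * y$3"
  by (simp add: hprod_def sum_3)

lemma cvol_expand: "cvol x y z =
    x$1 * y$2 * z$3 + x$2 * y$3 * z$1 + x$3 * y$1 * z$2
  - x$1 * y$3 * z$2 - x$2 * y$1 * z$3 - x$3 * y$2 * z$1"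
  by (simp add: cvol_def det_3)

lemma hprod_cnj: "hprod y x = cnj (hprod x y)"
  by (simp add: hprod_sum mult_ac)

lemma ex_unit_orthogonal:
  obtains w where "hprod w w = 1" "hprod n w = 0"
proof (cases "n$1 = 0 \<and> n$2 = 0")
  case True
  then show ?thesis
    by (intro that[of "vector [1, 0, 0]"]) (simp_all add: hprod_sum)
next
  case False
  let ?r = "sqrt ((norm (n$1))\<^sup>2 + (norm (n$2))\<^sup>2)"
  have r: "?r \<noteq> 0"
    using False by (simp add: sum_power2_eq_zero_iff)
  have r2: "complex_of_real ?r * complex_of_real ?r = n$1 * cnj (n$1) + n$2 * cnj (n$2)"
    by (simp add: of_real_mult[symmetric] complex_norm_square[symmetric] del: of_real_mult)
  have nz: "n$1 * cnj (n$1) + n$2 * cnj (n$2) \<noteq> 0"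
    using r unfolding r2[symmetric] by simp
  show ?thesis
  proof (rule that[of "vector [- cnj (n$2) / ?r, cnj (n$1) / ?r, 0]"])
    show "hprod (vector [- cnj (n$2) / ?r, cnj (n$1) / ?r, 0]) (vector [- cnj (n$2) / ?r, cnj (n$1) / ?r, 0]) = 1"
      using nz by (simp add: hprod_sum r2 add_divide_distrib[symmetric] add.commute)
    show "hprod n (vector [- cnj (n$2) / ?r, cnj (n$1) / ?r, 0]) = 0"
      by (simp add: hprod_sum)
  qed
qed

text \<open>The rows \<open>cnj n\<close>, \<open>cnj w\<close> and \<open>n \<times> w\<close> form a matrix in \<open>SU(3)\<close>, so that the coordinates
  \<open>hprod n\<close>, \<open>hprod w\<close>, \<open>cvol n w\<close> preserve the Hermitian product and the complex volume. This is
  the algebraic form of the transitivity of \<open>SU(3)\<close> on the unit sphere.\<close>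

lemma
  assumes n: "hprod n n = 1" and w: "hprod w w = 1" and nw: "hprod n w = 0"
  shows hprod_unitary_frame: "hprod x y = cnj (hprod n x) * hprod n y
      + cnj (hprod w x) * hprod w y + cnj (cvol n w x) * cvol n w y"
    and cvol_unitary_frame: "cvol x y z = cvol (vector [hprod n x, hprod w x, cvol n w x])
      (vector [hprod n y, hprod w y, cvol n w y]) (vector [hprod n z, hprod w z, cvol n w z])"
proof -
  let ?u = "vector [n$2 * w$3 - n$3 * w$2, n$3 * w$1 - n$1 * w$3, n$1 * w$2 - n$2 * w$1] :: complex ^ 3"
  let ?M = "vector [vector [cnj (n$1), cnj (n$2), cnj (n$3)],
    vector [cnj (w$1), cnj (w$2), cnj (w$3)], ?u] :: complex ^ 3 ^ 3"
  let ?H = "(\<chi> i j. cnj (?M $ j $ i)) :: complex ^ 3 ^ 3"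
  have wn: "hprod w n = 0" using nw hprod_cnj[of n w] by simp
  \<comment> \<open>Lagrange's identity \<open>|n \<times> w|\<^sup>2 = |n|\<^sup>2 |w|\<^sup>2 - |\<langle>n, w\<rangle>|\<^sup>2\<close>; it also computes the determinant of \<open>?M\<close>\<close>
  have lagrange: "cnj (?u$1) * ?u$1 + cnj (?u$2) * ?u$2 + cnj (?u$3) * ?u$3
      = hprod n n * hprod w w - hprod n w * hprod w n"
    by (simp add: hprod_sum algebra_simps)
  have u: "hprod ?u ?u = 1"
    using lagrange by (simp only: n w nw wn hprod_sum[of ?u]) simp
  have M: "?M *v x = vector [hprod n x, hprod w x, cvol n w x]" for x
    by (simp add: vec_eq_iff forall_3 matrix_vector_mult_def sum_3 hprod_sum cvol_expand algebra_simps)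
  have "?M ** ?H = mat 1"
    using n w nw wn u
    by (simp add: vec_eq_iff forall_3 matrix_matrix_mult_def sum_3 mat_def hprod_sum)
       (simp add: algebra_simps)
  then have H: "?H ** ?M = mat 1" by (simp add: matrix_left_right_inverse)
  have adj: "hprod (?M *v x) y = hprod x (?H *v y)" for x y
    by (simp add: hprod_sum matrix_vector_mult_def sum_3 algebra_simps)
  have "hprod (?M *v x) (?M *v y) = hprod x y"
    unfolding adj by (simp add: matrix_vector_mul_assoc H)
  then show "hprod x y = cnj (hprod n x) * hprod n y
      + cnj (hprod w x) * hprod w y + cnj (cvol n w x) * cvol n w y"
    by (simp only: M hprod_sum[of "vector _"]) simp
  have "det ?M = hprod ?u ?u"
    by (simp add: det_3 hprod_sum algebra_simps)
  then have det: "det ?M = 1" using u by simp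
  have "vector [?M *v x, ?M *v y, ?M *v z] = (vector [x, y, z] :: complex ^ 3 ^ 3) ** transpose ?M"
    by (simp add: vec_eq_iff forall_3 matrix_matrix_mult_def matrix_vector_mult_def transpose_def
        sum_3 mult_ac)
  then have "cvol (?M *v x) (?M *v y) (?M *v z) = cvol x y z"
    by (simp add: cvol_def det_mul det_transpose det)
  then show "cvol x y z = cvol (vector [hprod n x, hprod w x, cvol n w x])
      (vector [hprod n y, hprod w y, cvol n w y]) (vector [hprod n z, hprod w z, cvol n w z])"
    by (simp only: M)
qed

section \<open>Linear functionals on tangent spaces\<close>

lemma covector_eval:
  assumes "alt_form T 1 \<alpha>" "v 0 \<in> T"
  shows "\<alpha> v = \<alpha> (\<lambda>_. v 0)"
  using assms by (intro alt_form_cong[OF assms(1)]) auto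

lemma covector_tcomb:
  assumes "alt_form T 1 \<alpha>" "x \<in> T" "y \<in> T" "tcomb a x b y \<in> T"
  shows "\<alpha> (\<lambda>_. tcomb a x b y) = a * \<alpha> (\<lambda>_. x) + b * \<alpha> (\<lambda>_. y)"
proof -
  have *: "\<alpha> ((\<lambda>_. x)(0 := z)) = \<alpha> (\<lambda>_. z)" if "z \<in> T" for z
    using covector_eval[OF assms(1), of "(\<lambda>_. x)(0 := z)"] that by simp
  show ?thesis
    using alt_form_tcomb[OF assms(1), of "\<lambda>_. x" 0 x y a b] assms(2-4) by (simp add: *)
qed

lemma zero_in_tangent_space: "smooth_atlas A \<Longrightarrow> (\<lambda>_. 0) \<in> tangent_space A p"
  using tvec_of_in_tangent_space[OF _ chart_at_in_charts_at, of A p 0]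
    tvec_of_tcomb[OF _ chart_at_in_charts_at, of A p 0 0 0 0]
  by (simp add: tcomb_def)

lemma tvec_of_0: "smooth_atlas A \<Longrightarrow> c \<in> charts_at A p \<Longrightarrow> tvec_of A c p 0 = (\<lambda>_. 0)"
  using tvec_of_tcomb[of A c p 0 0 0 0] by (simp add: tcomb_def)

lemma linear_functional_tvec_of:
  assumes "smooth_atlas A" "c \<in> charts_at A p"
    and "\<And>a X b Y. X \<in> tangent_space A p \<Longrightarrow> Y \<in> tangent_space A p \<Longrightarrow>
      \<epsilon> (tcomb a X b Y) = a * \<epsilon> X + b * \<epsilon> Y"
  shows "linear (\<lambda>w. \<epsilon> (tvec_of A c p w) :: real)"
proof -
  have "\<epsilon> (tvec_of A c p (a *\<^sub>R x + b *\<^sub>R y)) = a * \<epsilon> (tvec_of A c p x) + b * \<epsilon> (tvec_of A c p y)" for a b x y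
    by (simp add: tvec_of_tcomb[OF assms(1,2)] assms(3) tvec_of_in_tangent_space[OF assms(1,2)])
  from this[of 1 _ 1] this[of _ _ 0 0] show ?thesis by (intro linearI) auto
qed

text \<open>By dimension count, as many linear functionals as the dimension of the tangent space attain
  arbitrary values simultaneously as soon as they separate points.\<close>

lemma separating_functionals_surjective:
  fixes A :: "('m::{t2_space, second_countable_topology}, 'd::finite) chart set"
  assumes "smooth_atlas A" "card I = CARD('d)"
    and lin: "\<And>i a X b Y. X \<in> tangent_space A p \<Longrightarrow> Y \<in> tangent_space A p \<Longrightarrow>
      \<epsilon> i (tcomb a X b Y) = a * \<epsilon> i X + b * \<epsilon> i Y"
    and sep: "\<And>X. X \<in> tangent_space A p \<Longrightarrow> (\<And>i. i \<in> I \<Longrightarrow> \<epsilon> i X = 0) \<Longrightarrow> X = (\<lambda>_. 0)"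
  obtains X where "X \<in> tangent_space A p" "\<And>i. i \<in> I \<Longrightarrow> \<epsilon> i X = (r i :: real)"
proof -
  let ?c = "chart_at A p"
  have c: "?c \<in> charts_at A p" by (rule chart_at_in_charts_at[OF assms(1)])
  note T = tvec_of_in_tangent_space[OF assms(1) c]
  have "finite I" using assms(2) by (simp add: card_ge_0_finite)
  then obtain g where g: "bij_betw g (UNIV :: 'd set) I"
    using finite_same_card_bij[of "UNIV :: 'd set" I] assms(2) by auto
  have I: "I = range g" using g by (simp add: bij_betw_def)
  let ?L = "\<lambda>w. \<chi> j. \<epsilon> (g j) (tvec_of A ?c p w)"
  have L: "linear ?L"
    using linear_functional_tvec_of[OF assms(1) c, where \<epsilon> = "\<epsilon> _", OF lin]
    by (auto simp: linear_iff vec_eq_iff)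
  have "w = 0" if "?L w = 0" for w
  proof -
    have "\<epsilon> (g j) (tvec_of A ?c p w) = 0" for j using that by (simp add: vec_eq_iff)
    then have "tvec_of A ?c p w = (\<lambda>_. 0)"
      using I by (intro sep T) auto
    then show "w = 0" using tvec_of_same[OF assms(1) c, of w] by simp
  qed
  then have "inj ?L" using linear_injective_0[OF L] by blast
  then have surj: "surj ?L" by (intro linear_inj_imp_surj L)
  obtain w where w: "(\<chi> j. r (g j)) = ?L w" using surjD[OF surj] by blast
  show thesis
  proof (rule that[OF T[of w]])
    fix i assume "i \<in> I"
    then obtain j where "i = g j" using I by blast
    then show "\<epsilon> i (tvec_of A ?c p w) = r i" using w by (simp add: vec_eq_iff)
  qed
qed

text \<open>Row rank equals column rank: linear independence of the members of a coframe makes the matrix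
  of their components invertible.\<close>

lemma coframe_separates:
  fixes A :: "('m::{t2_space, second_countable_topology}, 'd::finite) chart set"
  assumes "smooth_atlas A" "coframe_on A U e" "p \<in> U" "X \<in> tangent_space A p"
    and zero: "\<And>i. i \<in> {1..CARD('d)} \<Longrightarrow> e i p (\<lambda>_. X) = 0"
  shows "X = (\<lambda>_. 0)"
proof -
  let ?c = "chart_at A p"
  have c: "?c \<in> charts_at A p" by (rule chart_at_in_charts_at[OF assms(1)])
  note T = tvec_of_in_tangent_space[OF assms(1) c]
  obtain g where g: "bij_betw g (UNIV :: 'd set) {1..CARD('d)}"
    using finite_same_card_bij[of "UNIV :: 'd set" "{1..CARD('d)}"] by auto
  have gI: "g i \<in> {1..CARD('d)}" for i using g by (auto simp: bij_betw_def)
  have alt: "alt_form (tangent_space A p) 1 (e (g i) p)" for i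
    using assms(2,3) gI unfolding coframe_on_def smooth_form_on_def by blast
  define M where "M = (\<chi> i j. e (g i) p (\<lambda>_. tvec_of A ?c p (axis j 1)))"
  have Mv: "(M *v w) $ i = e (g i) p (\<lambda>_. tvec_of A ?c p w)" for w i
  proof -
    have lin: "linear (\<lambda>w. e (g i) p (\<lambda>_. tvec_of A ?c p w))"
      by (rule linear_functional_tvec_of[OF assms(1) c, where \<epsilon> = "\<lambda>X. e (g i) p (\<lambda>_. X)"])
        (intro covector_tcomb[OF alt] tangent_space_tcomb[OF assms(1)])
    have "e (g i) p (\<lambda>_. tvec_of A ?c p (\<Sum>j\<in>UNIV. (w $ j) *\<^sub>R axis j 1))
        = (\<Sum>j\<in>UNIV. (w $ j) *\<^sub>R e (g i) p (\<lambda>_. tvec_of A ?c p (axis j 1)))"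
      using linear_sum[OF lin, of "\<lambda>j. (w $ j) *\<^sub>R axis j 1" UNIV] linear_cmul[OF lin] by simp
    moreover have "(\<Sum>j\<in>UNIV. (w $ j) *\<^sub>R axis j 1) = w"
      using basis_expansion[of w] by (simp add: scalar_mult_eq_scaleR)
    ultimately show ?thesis
      by (simp add: M_def matrix_vector_mult_def mult.commute)
  qed
  have ker: "a = 0" if a: "transpose M *v a = 0" for a :: "real ^ 'd"
  proof -
    let ?a = "\<lambda>i. a $ inv g i"
    have inj: "inj g" using g by (simp add: bij_betw_def)
    have eq0: "form_eq (tangent_space A p) 1 (\<lambda>v. \<Sum>i\<in>{1..CARD('d)}. ?a i * e i p v) (\<lambda>v. 0)"
      unfolding form_eq_def
    proof (intro allI impI)
      fix v :: "nat \<Rightarrow> ('m, 'd) tvec" assume "\<forall>i<1. v i \<in> tangent_space A p"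
      then have v: "v 0 \<in> tangent_space A p" by simp
      have "(\<Sum>i\<in>{1..CARD('d)}. ?a i * e i p v) = (\<Sum>i\<in>UNIV. ?a (g i) * e (g i) p v)"
        by (rule sum.reindex_bij_betw[OF g, symmetric])
      also have "\<dots> = (\<Sum>i\<in>UNIV. a $ i * (M *v v 0 ?c) $ i)"
        using covector_eval[OF alt, of v] v by (simp add: inj Mv tvec_of_coordinates[OF v c])
      also have "\<dots> = a \<bullet> (M *v v 0 ?c)" by (simp add: inner_vec_def)
      also have "\<dots> = (transpose M *v a) \<bullet> v 0 ?c"
        by (simp add: dot_lmul_matrix)
      finally show "(\<Sum>i\<in>{1..CARD('d)}. ?a i * e i p v) = 0" using a by simp
    qed
    have indep: "\<forall>i\<in>{1..CARD('d)}. b i = 0"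
      if "form_eq (tangent_space A p) 1 (\<lambda>v. \<Sum>i\<in>{1..CARD('d)}. b i * e i p v) (\<lambda>v. 0)" for b
      using assms(2,3) that unfolding coframe_on_def by blast
    have "\<forall>i\<in>{1..CARD('d)}. ?a i = 0" by (rule indep[OF eq0])
    then have "?a (g i) = 0" for i using gI by blast
    then show ?thesis by (simp add: vec_eq_iff inj)
  qed
  then obtain N where "N ** transpose M = mat 1"
    using matrix_left_invertible_ker[of "transpose M"] by blast
  then have "transpose (N ** transpose M) = mat 1" by simp
  then have "M ** transpose N = mat 1" by (simp add: matrix_transpose_mul)
  then have inv: "transpose N ** M = mat 1" by (simp add: matrix_left_right_inverse)
  have "M *v X ?c = 0"
    using zero[OF gI] by (simp add: vec_eq_iff Mv tvec_of_coordinates[OF assms(4) c])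
  then have "(transpose N ** M) *v X ?c = 0" by (simp add: matrix_vector_mul_assoc[symmetric])
  then have "X ?c = 0" by (simp add: inv)
  then show ?thesis using tvec_of_coordinates[OF assms(4) c] tvec_of_0[OF assms(1) c] by simp
qed

section \<open>Unit normals in SU(3)-structures\<close>

definition unitary_coords :: "(nat \<Rightarrow> ('m, 6) form) \<Rightarrow> 'm \<Rightarrow> ('m, 6) tvec \<Rightarrow> complex ^ 3" where
  "unitary_coords e p X = vector [Complex (e 1 p (\<lambda>_. X)) (e 2 p (\<lambda>_. X)),
     Complex (e 3 p (\<lambda>_. X)) (e 4 p (\<lambda>_. X)), Complex (e 5 p (\<lambda>_. X)) (e 6 p (\<lambda>_. X))]"

lemma atLeastAtMost_1_6: "{1..6::nat} = {1, 2, 3, 4, 5, 6}"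
  by auto

lemma
  fixes B :: "('m::{t2_space, second_countable_topology}, 6) chart set"
  assumes B: "smooth_atlas B" and e: "adapted_coframe_on B F \<Psi>p \<Psi>m U e" and p: "p \<in> U"
  shows adapted_coframe_F: "\<And>v. v 0 \<in> tangent_space B p \<Longrightarrow> v 1 \<in> tangent_space B p \<Longrightarrow>
      F p v = Im (hprod (unitary_coords e p (v 0)) (unitary_coords e p (v 1)))" (is "PROP ?PF")
    and adapted_coframe_\<Psi>: "\<And>v. v 0 \<in> tangent_space B p \<Longrightarrow> v 1 \<in> tangent_space B p \<Longrightarrow>
      v 2 \<in> tangent_space B p \<Longrightarrow> Complex (\<Psi>p p v) (\<Psi>m p v)
        = cvol (unitary_coords e p (v 0)) (unitary_coords e p (v 1)) (unitary_coords e p (v 2))"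
      (is "PROP ?P\<Psi>")
    and unitary_coords_tcomb: "\<And>a X b Y. X \<in> tangent_space B p \<Longrightarrow> Y \<in> tangent_space B p \<Longrightarrow>
      unitary_coords e p (tcomb a X b Y) = a *\<^sub>R unitary_coords e p X + b *\<^sub>R unitary_coords e p Y"
      (is "PROP ?Ptcomb")
    and unitary_coords_eq_0: "\<And>X. X \<in> tangent_space B p \<Longrightarrow> unitary_coords e p X = 0 \<Longrightarrow> X = (\<lambda>_. 0)"
      (is "PROP ?P0")
proof -
  let ?T = "tangent_space B p"
  have cof: "coframe_on B U e" using e by (simp add: adapted_coframe_on_def)
  have alt: "alt_form ?T 1 (e i p)" if "i \<in> {1..6}" for i
    using cof p that unfolding coframe_on_def smooth_form_on_def by simp
  have ev: "e i p u = e i p (\<lambda>_. u 0)" if "i \<in> {1..6}" "u 0 \<in> ?T" for i u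
    using covector_eval[OF alt[OF that(1)], of u] that(2) by blast
  show "PROP ?PF"
  proof -
    fix v :: "nat \<Rightarrow> ('m, 6) tvec" assume v: "v 0 \<in> ?T" "v 1 \<in> ?T"
    then have "\<forall>i<2. v i \<in> ?T" by (auto simp: less_2_cases_iff)
    then have "F p v = wedge 1 1 (e 1 p) (e 2 p) v + wedge 1 1 (e 3 p) (e 4 p) v
        + wedge 1 1 (e 5 p) (e 6 p) v"
      using e p unfolding adapted_coframe_on_def form_eq_def by blast
    moreover have "wedge 1 1 (e i p) (e j p) v
        = e i p (\<lambda>_. v 0) * e j p (\<lambda>_. v 1) - e i p (\<lambda>_. v 1) * e j p (\<lambda>_. v 0)"
      if "i \<in> {1..6}" "j \<in> {1..6}" for i j
      by (rule wedge_1_1[where T = ?T and a = "\<lambda>X. e i p (\<lambda>_. X)" and b = "\<lambda>X. e j p (\<lambda>_. X)"])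
        (use ev that v in \<open>blast+\<close>)
    ultimately show "F p v = Im (hprod (unitary_coords e p (v 0)) (unitary_coords e p (v 1)))"
      by (simp add: hprod_sum unitary_coords_def)
  qed
  show "PROP ?P\<Psi>"
  proof -
    fix v :: "nat \<Rightarrow> ('m, 6) tvec" assume v: "v 0 \<in> ?T" "v 1 \<in> ?T" "v 2 \<in> ?T"
    define \<theta> where "\<theta> = (\<lambda>i X. complex_of_real (e i p (\<lambda>_. X)) + \<i> * complex_of_real (e (Suc i) p (\<lambda>_. X)))"
    have \<theta>: "complex_of_real (e i p u) + \<i> * complex_of_real (e (Suc i) p u) = \<theta> i (u 0)"
      if "i \<in> {1..5}" "u 0 \<in> ?T" for i u
      using ev[of i u] ev[of "Suc i" u] that by (simp add: \<theta>_def)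
    have \<theta>1: "complex_of_real (e 1 p u) + \<i> * complex_of_real (e 2 p u) = \<theta> 1 (u 0)"
      and \<theta>3: "complex_of_real (e 3 p u) + \<i> * complex_of_real (e 4 p u) = \<theta> 3 (u 0)"
      and \<theta>5: "complex_of_real (e 5 p u) + \<i> * complex_of_real (e 6 p u) = \<theta> 5 (u 0)"
      if "u 0 \<in> ?T" for u
      using \<theta>[of 1 u] \<theta>[of 3 u] \<theta>[of 5 u] that by (simp_all add: eval_nat_numeral)
    let ?w2 = "wedge 1 1 (\<lambda>v. complex_of_real (e 1 p v) + \<i> * complex_of_real (e 2 p v))
                         (\<lambda>v. complex_of_real (e 3 p v) + \<i> * complex_of_real (e 4 p v))"
    have "\<forall>i<3. v i \<in> ?T" using v by (auto simp: less_Suc_eq numeral_eq_Suc)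
    then have "complex_of_real (\<Psi>p p v) + \<i> * complex_of_real (\<Psi>m p v)
        = wedge 2 1 ?w2 (\<lambda>v. complex_of_real (e 5 p v) + \<i> * complex_of_real (e 6 p v)) v"
      using e p unfolding adapted_coframe_on_def form_eq_def by blast
    moreover have "?w2 u = \<theta> 1 (u 0) * \<theta> 3 (u 1) - \<theta> 1 (u 1) * \<theta> 3 (u 0)" if "u 0 \<in> ?T" "u 1 \<in> ?T" for u
      by (rule wedge_1_1[OF \<theta>1 \<theta>3 that])
    then have "wedge 2 1 ?w2 (\<lambda>v. complex_of_real (e 5 p v) + \<i> * complex_of_real (e 6 p v)) v
       = (\<theta> 1 (v 0) * \<theta> 3 (v 1) - \<theta> 1 (v 1) * \<theta> 3 (v 0)) * \<theta> 5 (v 2)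
       - (\<theta> 1 (v 0) * \<theta> 3 (v 2) - \<theta> 1 (v 2) * \<theta> 3 (v 0)) * \<theta> 5 (v 1)
       + (\<theta> 1 (v 1) * \<theta> 3 (v 2) - \<theta> 1 (v 2) * \<theta> 3 (v 1)) * \<theta> 5 (v 0)"
      by (intro wedge_2_1[where T = ?T and a = "\<lambda>X Y. \<theta> 1 X * \<theta> 3 Y - \<theta> 1 Y * \<theta> 3 X" and b = "\<theta> 5"]
          \<theta>5 v) simp_all
    moreover have "unitary_coords e p X $ 1 = \<theta> 1 X" "unitary_coords e p X $ 2 = \<theta> 3 X"
      "unitary_coords e p X $ 3 = \<theta> 5 X" for X
      by (simp_all add: unitary_coords_def \<theta>_def complex_eq_iff eval_nat_numeral)
    ultimately show "Complex (\<Psi>p p v) (\<Psi>m p v)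
        = cvol (unitary_coords e p (v 0)) (unitary_coords e p (v 1)) (unitary_coords e p (v 2))"
      by (simp add: Complex_eq cvol_expand algebra_simps)
  qed
  show "PROP ?Ptcomb"
  proof -
    fix a X b Y assume XY: "X \<in> ?T" "Y \<in> ?T"
    have "e i p (\<lambda>_. tcomb a X b Y) = a * e i p (\<lambda>_. X) + b * e i p (\<lambda>_. Y)" if "i \<in> {1..6}" for i
      using covector_tcomb[OF alt[OF that] XY tangent_space_tcomb[OF B XY]] .
    then show "unitary_coords e p (tcomb a X b Y)
        = a *\<^sub>R unitary_coords e p X + b *\<^sub>R unitary_coords e p Y"
      by (simp add: unitary_coords_def vec_eq_iff forall_3 complex_eq_iff)
  qed
  show "PROP ?P0"
  proof -
    fix X assume X: "X \<in> ?T" "unitary_coords e p X = 0"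
    then have "\<forall>i\<in>{1..6}. e i p (\<lambda>_. X) = 0"
      unfolding atLeastAtMost_1_6
      by (simp add: unitary_coords_def vec_eq_iff forall_3 complex_eq_iff)
    then show "X = (\<lambda>_. 0)" using coframe_separates[OF B cof p X(1)] by simp
  qed
qed

text \<open>The metric is computed with some adapted coframe near the point, and the argument needs to
  know that one and the same coframe expresses the metric and the forms.\<close>

lemma su3_metric_adapted_coframe:
  assumes "su3_structure B F \<Psi>p \<Psi>m"
  obtains U e where "p \<in> U" "adapted_coframe_on B F \<Psi>p \<Psi>m U e"
    and "\<And>X Y. su3_metric B F \<Psi>p \<Psi>m p X Y = Re (hprod (unitary_coords e p X) (unitary_coords e p Y))"
proof -
  let ?P = "\<lambda>e. \<exists>U. open U \<and> p \<in> U \<and> adapted_coframe_on B F \<Psi>p \<Psi>m U e"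
  have "\<exists>e. ?P e" using assms unfolding su3_structure_def by blast
  then have "?P (SOME e. ?P e)" by (rule someI_ex)
  then obtain U where U: "p \<in> U" "adapted_coframe_on B F \<Psi>p \<Psi>m U (SOME e. ?P e)" by blast
  have "su3_metric B F \<Psi>p \<Psi>m p X Y
      = Re (hprod (unitary_coords (SOME e. ?P e) p X) (unitary_coords (SOME e. ?P e) p Y))" for X Y
    unfolding su3_metric_def Let_def atLeastAtMost_1_6
    by (simp add: hprod_sum unitary_coords_def)
  with U show thesis using that by blast
qed

text \<open>The 2-form \<open>\<epsilon>\<^sub>i \<and> \<epsilon>\<^sub>j\<close>.\<close>

definition minor :: "(nat \<Rightarrow> 'v \<Rightarrow> real) \<Rightarrow> nat \<Rightarrow> nat \<Rightarrow> 'v \<Rightarrow> 'v \<Rightarrow> real" where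
  "minor \<epsilon> i j X Y = \<epsilon> i X * \<epsilon> j Y - \<epsilon> i Y * \<epsilon> j X"

lemma hprod_self_eq_0: "hprod x x = 0 \<Longrightarrow> x = 0"
proof -
  assume "hprod x x = 0"
  moreover have "hprod x x = of_real ((norm (x$1))\<^sup>2 + (norm (x$2))\<^sup>2 + (norm (x$3))\<^sup>2)"
    by (simp add: hprod_sum complex_norm_square mult.commute del: of_real_power)
  ultimately have "(norm (x$1))\<^sup>2 + (norm (x$2))\<^sup>2 + (norm (x$3))\<^sup>2 = 0"
    by (simp only: of_real_eq_0_iff)
  then have "norm (x$1) = 0 \<and> norm (x$2) = 0 \<and> norm (x$3) = 0"
    using zero_le_power2[of "norm (x$1)"] zero_le_power2[of "norm (x$2)"] zero_le_power2[of "norm (x$3)"]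
    by (smt (verit) zero_eq_power2)
  then show "x = 0" by (simp add: vec_eq_iff forall_3)
qed

text \<open>Functionals on the tangent space of the hypersurface that put all data in normal form: \<open>\<epsilon> 2\<close>
  is the normal contraction of \<open>F\<close>, and \<open>\<epsilon> 3 + \<i> \<epsilon> 4\<close>, \<open>\<epsilon> 5 + \<i> \<epsilon> 6\<close> are the coordinates with
  respect to a unitary frame whose first vector is the normal. The remaining coordinate along the
  normal itself has real part 0, because the metric is the real part of the Hermitian product.\<close>

lemma hypersurface_normal_form:
  fixes A :: "('n::{t2_space, second_countable_topology}, 5) chart set"
    and B :: "('m::{t2_space, second_countable_topology}, 6) chart set" and p :: 'n
  assumes A: "smooth_atlas A" and B: "smooth_atlas B" and su3: "su3_structure B F \<Psi>p \<Psi>m"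
    and imm: "immersion A B f" and \<nu>: "unit_normal_field A B f F \<Psi>p \<Psi>m \<nu>"
  defines "T \<equiv> tangent_space A p" and "D \<equiv> differential A B f p"
  obtains \<epsilon> where
    "\<And>i a X b Y. X \<in> T \<Longrightarrow> Y \<in> T \<Longrightarrow> \<epsilon> i (tcomb a X b Y) = a * \<epsilon> i X + b * \<epsilon> i Y"
    "\<And>X. X \<in> T \<Longrightarrow> (\<And>i. i \<in> {2..6} \<Longrightarrow> \<epsilon> i X = 0) \<Longrightarrow> X = (\<lambda>_. 0)"
    "\<And>v. v 0 \<in> T \<Longrightarrow> contract (\<nu> p) (F (f p)) (\<lambda>i. D (v i)) = \<epsilon> 2 (v 0)"
    "\<And>v. v 0 \<in> T \<Longrightarrow> v 1 \<in> T \<Longrightarrow>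
       F (f p) (\<lambda>i. D (v i)) = minor \<epsilon> 3 4 (v 0) (v 1) + minor \<epsilon> 5 6 (v 0) (v 1)"
    "\<And>v. v 0 \<in> T \<Longrightarrow> v 1 \<in> T \<Longrightarrow> contract (\<nu> p) (\<Psi>p (f p)) (\<lambda>i. D (v i))
       = minor \<epsilon> 3 5 (v 0) (v 1) - minor \<epsilon> 4 6 (v 0) (v 1)"
    "\<And>v. v 0 \<in> T \<Longrightarrow> v 1 \<in> T \<Longrightarrow> contract (\<nu> p) (\<Psi>m (f p)) (\<lambda>i. D (v i))
       = minor \<epsilon> 3 6 (v 0) (v 1) + minor \<epsilon> 4 5 (v 0) (v 1)"
    "\<And>v. v 0 \<in> T \<Longrightarrow> v 1 \<in> T \<Longrightarrow> v 2 \<in> T \<Longrightarrow> \<Psi>p (f p) (\<lambda>i. D (v i))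
       = - \<epsilon> 2 (v 0) * (minor \<epsilon> 3 6 (v 1) (v 2) + minor \<epsilon> 4 5 (v 1) (v 2))
       + \<epsilon> 2 (v 1) * (minor \<epsilon> 3 6 (v 0) (v 2) + minor \<epsilon> 4 5 (v 0) (v 2))
       - \<epsilon> 2 (v 2) * (minor \<epsilon> 3 6 (v 0) (v 1) + minor \<epsilon> 4 5 (v 0) (v 1))"
    "\<And>v. v 0 \<in> T \<Longrightarrow> v 1 \<in> T \<Longrightarrow> v 2 \<in> T \<Longrightarrow> \<Psi>m (f p) (\<lambda>i. D (v i))
       = \<epsilon> 2 (v 0) * (minor \<epsilon> 3 5 (v 1) (v 2) - minor \<epsilon> 4 6 (v 1) (v 2))
       - \<epsilon> 2 (v 1) * (minor \<epsilon> 3 5 (v 0) (v 2) - minor \<epsilon> 4 6 (v 0) (v 2))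
       + \<epsilon> 2 (v 2) * (minor \<epsilon> 3 5 (v 0) (v 1) - minor \<epsilon> 4 6 (v 0) (v 1))"
proof -
  let ?T' = "tangent_space B (f p)"
  have f: "smooth_map A B f" and inj: "inj_on D T"
    using imm by (auto simp: immersion_def D_def T_def)
  have DT: "D X \<in> ?T'" if "X \<in> T" for X
    using differential_in_tangent_space[OF A B f] that by (simp add: D_def T_def)
  have \<nu>T: "\<nu> p \<in> ?T'"
    using \<nu> by (simp add: unit_normal_field_def smooth_field_along_def)
  obtain U e where e: "f p \<in> U" "adapted_coframe_on B F \<Psi>p \<Psi>m U e"
    and metric: "\<And>X Y. su3_metric B F \<Psi>p \<Psi>m (f p) X Y
      = Re (hprod (unitary_coords e (f p) X) (unitary_coords e (f p) Y))"
    using su3_metric_adapted_coframe[OF su3] by metis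
  define z where "z = unitary_coords e (f p)"
  define n where "n = z (\<nu> p)"
  note eF = adapted_coframe_F[OF B e(2,1), folded z_def]
  note e\<Psi> = adapted_coframe_\<Psi>[OF B e(2,1), folded z_def]
  have "Re (hprod n n) = 1"
    using \<nu> by (simp add: unit_normal_field_def n_def z_def metric[symmetric])
  moreover have "Im (hprod n n) = 0" by (simp add: hprod_sum)
  ultimately have n: "hprod n n = 1" by (simp add: complex_eq_iff)
  obtain w where w: "hprod w w = 1" "hprod n w = 0" by (rule ex_unit_orthogonal)
  note frame = hprod_unitary_frame[OF n w] cvol_unitary_frame[OF n w]
  have wn: "hprod w n = 0" using w(2) hprod_cnj[of n w] by simp
  have cn: "cvol n w n = 0" by (simp add: cvol_expand)
  define \<epsilon> where "\<epsilon> = (\<lambda>i X. if i = 2 then Im (hprod n (z (D X)))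
      else if i = 3 then Re (hprod w (z (D X))) else if i = 4 then Im (hprod w (z (D X)))
      else if i = 5 then Re (cvol n w (z (D X))) else if i = (6::nat) then Im (cvol n w (z (D X))) else 0)"
  have a: "hprod n (z (D X)) = Complex 0 (\<epsilon> 2 X)" if "X \<in> T" for X
    using \<nu> that
    by (simp add: unit_normal_field_def n_def z_def complex_eq_iff \<epsilon>_def D_def T_def metric[symmetric])
  have b: "hprod w (z (D X)) = Complex (\<epsilon> 3 X) (\<epsilon> 4 X)"
    and c: "cvol n w (z (D X)) = Complex (\<epsilon> 5 X) (\<epsilon> 6 X)" for X
    by (simp_all add: complex_eq_iff \<epsilon>_def)
  have \<Psi>: "cvol (z (D X)) (z (D Y)) (z (D Z)) = cvol
      (vector [Complex 0 (\<epsilon> 2 X), Complex (\<epsilon> 3 X) (\<epsilon> 4 X), Complex (\<epsilon> 5 X) (\<epsilon> 6 X)])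
      (vector [Complex 0 (\<epsilon> 2 Y), Complex (\<epsilon> 3 Y) (\<epsilon> 4 Y), Complex (\<epsilon> 5 Y) (\<epsilon> 6 Y)])
      (vector [Complex 0 (\<epsilon> 2 Z), Complex (\<epsilon> 3 Z) (\<epsilon> 4 Z), Complex (\<epsilon> 5 Z) (\<epsilon> 6 Z)])"
    if "X \<in> T" "Y \<in> T" "Z \<in> T" for X Y Z
    using frame(2)[of "z (D X)" "z (D Y)" "z (D Z)"] that by (simp only: a b c)
  have N\<Psi>: "cvol n (z (D X)) (z (D Y)) = cvol (vector [1, 0, 0])
      (vector [Complex 0 (\<epsilon> 2 X), Complex (\<epsilon> 3 X) (\<epsilon> 4 X), Complex (\<epsilon> 5 X) (\<epsilon> 6 X)])
      (vector [Complex 0 (\<epsilon> 2 Y), Complex (\<epsilon> 3 Y) (\<epsilon> 4 Y), Complex (\<epsilon> 5 Y) (\<epsilon> 6 Y)])"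
    if "X \<in> T" "Y \<in> T" for X Y
    using frame(2)[of n "z (D X)" "z (D Y)"] that by (simp only: a b c n wn cn)
  have \<Psi>v: "Complex (\<Psi>p (f p) (\<lambda>i. D (v i))) (\<Psi>m (f p) (\<lambda>i. D (v i)))
      = cvol (z (D (v 0))) (z (D (v 1))) (z (D (v 2)))" if "v 0 \<in> T" "v 1 \<in> T" "v 2 \<in> T" for v
    using e\<Psi>[of "\<lambda>i. D (v i)"] that DT by simp
  have N\<Psi>v: "Complex (contract (\<nu> p) (\<Psi>p (f p)) (\<lambda>i. D (v i))) (contract (\<nu> p) (\<Psi>m (f p)) (\<lambda>i. D (v i)))
      = cvol n (z (D (v 0))) (z (D (v 1)))" if "v 0 \<in> T" "v 1 \<in> T" for v
    using e\<Psi>[of "case_nat (\<nu> p) (\<lambda>i. D (v i))"] that DT \<nu>T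
    by (simp add: contract_def n_def numeral_2_eq_2)
  show thesis
  proof (rule that)
    fix i a X b Y assume XY: "X \<in> T" "Y \<in> T"
    have zD: "z (D (tcomb a X b Y)) = a *\<^sub>R z (D X) + b *\<^sub>R z (D Y)"
      using unitary_coords_tcomb[OF B e(2,1) DT[OF XY(1)] DT[OF XY(2)]]
        differential_tcomb[OF A B f] XY by (simp add: z_def D_def T_def)
    have "hprod x (a *\<^sub>R y + b *\<^sub>R y') = a *\<^sub>R hprod x y + b *\<^sub>R hprod x y'" for x y y'
      by (simp add: hprod_sum algebra_simps)
    moreover have "cvol n w (a *\<^sub>R y + b *\<^sub>R y') = a *\<^sub>R cvol n w y + b *\<^sub>R cvol n w y'" for y y'
      by (simp add: cvol_expand algebra_simps)
    ultimately show "\<epsilon> i (tcomb a X b Y) = a * \<epsilon> i X + b * \<epsilon> i Y"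
      by (simp add: \<epsilon>_def zD)
  next
    fix X assume X: "X \<in> T" and 0: "\<And>i. i \<in> {2..6} \<Longrightarrow> \<epsilon> i X = 0"
    have "hprod (z (D X)) (z (D X)) = 0"
      unfolding frame(1)[of "z (D X)" "z (D X)"] a[OF X] b c using 0 by (simp add: complex_eq_iff)
    then have "z (D X) = 0" by (rule hprod_self_eq_0)
    then have "D X = (\<lambda>_. 0)"
      using unitary_coords_eq_0[OF B e(2,1) DT[OF X]] by (simp add: z_def)
    moreover have "D (\<lambda>_. 0) = (\<lambda>_. 0)"
      using differential_tcomb[OF A B f zero_in_tangent_space[OF A] zero_in_tangent_space[OF A], of p 0 0]
      by (simp add: tcomb_def D_def)
    ultimately show "X = (\<lambda>_. 0)"
      using inj X zero_in_tangent_space[OF A, of p] by (simp add: T_def inj_on_def)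
  next
    fix v :: "nat \<Rightarrow> ('n, 5) tvec" assume v: "v 0 \<in> T"
    show "contract (\<nu> p) (F (f p)) (\<lambda>i. D (v i)) = \<epsilon> 2 (v 0)"
      using eF[of "case_nat (\<nu> p) (\<lambda>i. D (v i))"] v DT \<nu>T a[OF v] by (simp add: contract_def n_def)
  next
    fix v :: "nat \<Rightarrow> ('n, 5) tvec" assume v: "v 0 \<in> T" "v 1 \<in> T"
    have "F (f p) (\<lambda>i. D (v i)) = Im (hprod (z (D (v 0))) (z (D (v 1))))"
      using eF[of "\<lambda>i. D (v i)"] v DT by simp
    also have "\<dots> = minor \<epsilon> 3 4 (v 0) (v 1) + minor \<epsilon> 5 6 (v 0) (v 1)"
      unfolding frame(1)[of "z (D (v 0))"] a[OF v(1)] a[OF v(2)] b c by (simp add: minor_def)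
    finally show "F (f p) (\<lambda>i. D (v i)) = minor \<epsilon> 3 4 (v 0) (v 1) + minor \<epsilon> 5 6 (v 0) (v 1)" .
    show "contract (\<nu> p) (\<Psi>p (f p)) (\<lambda>i. D (v i)) = minor \<epsilon> 3 5 (v 0) (v 1) - minor \<epsilon> 4 6 (v 0) (v 1)"
      using arg_cong[OF N\<Psi>v[OF v], of Re] unfolding N\<Psi>[OF v]
      by (simp add: cvol_expand minor_def algebra_simps)
    show "contract (\<nu> p) (\<Psi>m (f p)) (\<lambda>i. D (v i)) = minor \<epsilon> 3 6 (v 0) (v 1) + minor \<epsilon> 4 5 (v 0) (v 1)"
      using arg_cong[OF N\<Psi>v[OF v], of Im] unfolding N\<Psi>[OF v]
      by (simp add: cvol_expand minor_def algebra_simps)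
  next
    fix v :: "nat \<Rightarrow> ('n, 5) tvec" assume v: "v 0 \<in> T" "v 1 \<in> T" "v 2 \<in> T"
    show "\<Psi>p (f p) (\<lambda>i. D (v i))
       = - \<epsilon> 2 (v 0) * (minor \<epsilon> 3 6 (v 1) (v 2) + minor \<epsilon> 4 5 (v 1) (v 2))
       + \<epsilon> 2 (v 1) * (minor \<epsilon> 3 6 (v 0) (v 2) + minor \<epsilon> 4 5 (v 0) (v 2))
       - \<epsilon> 2 (v 2) * (minor \<epsilon> 3 6 (v 0) (v 1) + minor \<epsilon> 4 5 (v 0) (v 1))"
      using arg_cong[OF \<Psi>v[OF v], of Re] unfolding \<Psi>[OF v]
      by (simp add: cvol_expand minor_def algebra_simps)
    show "\<Psi>m (f p) (\<lambda>i. D (v i))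
       = \<epsilon> 2 (v 0) * (minor \<epsilon> 3 5 (v 1) (v 2) - minor \<epsilon> 4 6 (v 1) (v 2))
       - \<epsilon> 2 (v 1) * (minor \<epsilon> 3 5 (v 0) (v 2) - minor \<epsilon> 4 6 (v 0) (v 2))
       + \<epsilon> 2 (v 2) * (minor \<epsilon> 3 5 (v 0) (v 1) - minor \<epsilon> 4 6 (v 0) (v 1))"
      using arg_cong[OF \<Psi>v[OF v], of Im] unfolding \<Psi>[OF v]
      by (simp add: cvol_expand minor_def algebra_simps)
  qed
qed

section \<open>Pointwise SU(2)-geometry\<close>

text \<open>The 4-form \<open>\<epsilon>\<^sub>a \<and> \<epsilon>\<^sub>b \<and> \<epsilon>\<^sub>c \<and> \<epsilon>\<^sub>d\<close>, as the product of two minors expanded over the partitions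
  of the arguments into two pairs (Laplace expansion). Its symmetries reduce the wedge products of
  the forms of an SU(2)-structure to the case \<open>a b c d = 3 4 5 6\<close>.\<close>

definition minor_product :: "(nat \<Rightarrow> 'v \<Rightarrow> real) \<Rightarrow> nat \<Rightarrow> nat \<Rightarrow> nat \<Rightarrow> nat \<Rightarrow> (nat \<Rightarrow> 'v) \<Rightarrow> real" where
  "minor_product \<epsilon> a b c d v =
      minor \<epsilon> a b (v 0) (v 1) * minor \<epsilon> c d (v 2) (v 3) - minor \<epsilon> a b (v 0) (v 2) * minor \<epsilon> c d (v 1) (v 3)
    + minor \<epsilon> a b (v 0) (v 3) * minor \<epsilon> c d (v 1) (v 2) + minor \<epsilon> a b (v 1) (v 2) * minor \<epsilon> c d (v 0) (v 3)
    - minor \<epsilon> a b (v 1) (v 3) * minor \<epsilon> c d (v 0) (v 2) + minor \<epsilon> a b (v 2) (v 3) * minor \<epsilon> c d (v 0) (v 1)"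

lemma minor_product_commute: "minor_product \<epsilon> a b c d v = minor_product \<epsilon> c d a b v"
  by (simp add: minor_product_def algebra_simps)

lemma minor_product_first: "minor_product \<epsilon> b a c d v = - minor_product \<epsilon> a b c d v"
  by (simp add: minor_product_def minor_def algebra_simps)

lemma minor_product_last: "minor_product \<epsilon> a b d c v = - minor_product \<epsilon> a b c d v"
  using minor_product_commute minor_product_first by metis

lemma minor_product_swap: "minor_product \<epsilon> a c b d v = - minor_product \<epsilon> a b c d v"
  by (simp add: minor_product_def minor_def algebra_simps)

lemma minor_product_repeated:
  "minor_product \<epsilon> a b a c v = 0" "minor_product \<epsilon> a b c a v = 0"
  "minor_product \<epsilon> b a a c v = 0" "minor_product \<epsilon> b a c a v = 0"
proof -
  show *: "minor_product \<epsilon> a b a c v = 0" for a b c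
    using minor_product_swap[of \<epsilon> a b a c v] by (simp add: minor_product_def minor_def)
  show "minor_product \<epsilon> a b c a v = 0" "minor_product \<epsilon> b a a c v = 0" "minor_product \<epsilon> b a c a v = 0"
    using *[of a b c] minor_product_first[of \<epsilon> b a] minor_product_last[of \<epsilon> _ _ c a]
    by (simp_all only: minus_zero)
qed

text \<open>The standard SU(2)-structure on a five-dimensional tangent space. The coframe is numbered from
  2 to 6 so that its entries keep the numbers that they have in the adapted coframe of the ambient
  six-dimensional space, where 1 belongs to the normal direction.\<close>

locale su2_coframe =
  fixes A :: "('n::{t2_space, second_countable_topology}, 5) chart set" and p :: 'n
    and \<epsilon> :: "nat \<Rightarrow> ('n, 5) tvec \<Rightarrow> real"
    and \<eta> :: "(nat \<Rightarrow> ('n, 5) tvec) \<Rightarrow> real" and \<omega> :: "nat \<Rightarrow> (nat \<Rightarrow> ('n, 5) tvec) \<Rightarrow> real"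
  assumes atlas: "smooth_atlas A"
    and lin: "\<And>i a X b Y. X \<in> tangent_space A p \<Longrightarrow> Y \<in> tangent_space A p \<Longrightarrow>
      \<epsilon> i (tcomb a X b Y) = a * \<epsilon> i X + b * \<epsilon> i Y"
    and separates: "\<And>X. X \<in> tangent_space A p \<Longrightarrow> (\<And>i. i \<in> {2..6} \<Longrightarrow> \<epsilon> i X = 0) \<Longrightarrow> X = (\<lambda>_. 0)"
    and \<eta>: "\<And>v. v 0 \<in> tangent_space A p \<Longrightarrow> \<eta> v = - \<epsilon> 2 (v 0)"
    and \<omega>1: "\<And>v. v 0 \<in> tangent_space A p \<Longrightarrow> v 1 \<in> tangent_space A p \<Longrightarrow>
      \<omega> 1 v = minor \<epsilon> 3 4 (v 0) (v 1) + minor \<epsilon> 5 6 (v 0) (v 1)"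
    and \<omega>2: "\<And>v. v 0 \<in> tangent_space A p \<Longrightarrow> v 1 \<in> tangent_space A p \<Longrightarrow>
      \<omega> 2 v = minor \<epsilon> 3 6 (v 0) (v 1) + minor \<epsilon> 4 5 (v 0) (v 1)"
    and \<omega>3: "\<And>v. v 0 \<in> tangent_space A p \<Longrightarrow> v 1 \<in> tangent_space A p \<Longrightarrow>
      \<omega> 3 v = minor \<epsilon> 4 6 (v 0) (v 1) - minor \<epsilon> 3 5 (v 0) (v 1)"
begin

abbreviation "T \<equiv> tangent_space A p"

lemma dual_vector:
  fixes r :: "nat \<Rightarrow> real"
  obtains X where "X \<in> T" "\<And>i. i \<in> {2..6} \<Longrightarrow> \<epsilon> i X = r i"
proof -
  have card: "card {2..6::nat} = CARD(5)" by simp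
  show thesis
    by (rule separating_functionals_surjective[where A = A and p = p and \<epsilon> = \<epsilon> and I = "{2..6}" and r = r,
          OF atlas card lin separates];
          (rule that)?; blast)
qed

lemma wedge_\<omega>_\<omega>:
  assumes "i \<in> {1..3}" "j \<in> {1..3}"
  shows "form_eq T 4 (wedge 2 2 (\<omega> i) (\<omega> j)) (\<lambda>v. if i = j then wedge 2 2 (\<omega> 1) (\<omega> 1) v else 0)"
  unfolding form_eq_def
proof (intro allI impI)
  fix v :: "nat \<Rightarrow> ('n, 5) tvec" assume "\<forall>i<4. v i \<in> T"
  then have v: "v 0 \<in> T" "v 1 \<in> T" "v 2 \<in> T" "v 3 \<in> T" by auto
  define w where "w = (\<lambda>i::nat. if i = 1 then (\<lambda>X Y. minor \<epsilon> 3 4 X Y + minor \<epsilon> 5 6 X Y)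
    else if i = 2 then (\<lambda>X Y. minor \<epsilon> 3 6 X Y + minor \<epsilon> 4 5 X Y)
    else (\<lambda>X Y. minor \<epsilon> 4 6 X Y - minor \<epsilon> 3 5 X Y))"
  have cases: "k = 1 \<or> k = 2 \<or> k = 3" if "k \<in> {1..3}" for k :: nat using that by auto
  have w: "\<omega> k u = w k (u 0) (u 1)" if "k \<in> {1..3}" "u 0 \<in> T" "u 1 \<in> T" for k u
    using cases[OF that(1)] \<omega>1[OF that(2,3)] \<omega>2[OF that(2,3)] \<omega>3[OF that(2,3)] by (auto simp: w_def)
  have anti: "w k Y X = - w k X Y" for k X Y by (simp add: w_def minor_def)
  have W: "wedge 2 2 (\<omega> k) (\<omega> l) v =
      w k (v 0) (v 1) * w l (v 2) (v 3) - w k (v 0) (v 2) * w l (v 1) (v 3) + w k (v 0) (v 3) * w l (v 1) (v 2)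
    + w k (v 1) (v 2) * w l (v 0) (v 3) - w k (v 1) (v 3) * w l (v 0) (v 2) + w k (v 2) (v 3) * w l (v 0) (v 1)"
    if "k \<in> {1..3}" "l \<in> {1..3}" for k l
    by (rule wedge_2_2[where T = T and a = "w k" and b = "w l"]) (use w that anti v in blast)+
  let ?Q = "\<lambda>a b c d. minor_product \<epsilon> a b c d v"
  have expand: "wedge 2 2 (\<omega> 1) (\<omega> 1) v = ?Q 3 4 3 4 + ?Q 3 4 5 6 + ?Q 5 6 3 4 + ?Q 5 6 5 6"
    "wedge 2 2 (\<omega> 1) (\<omega> 2) v = ?Q 3 4 3 6 + ?Q 3 4 4 5 + ?Q 5 6 3 6 + ?Q 5 6 4 5"
    "wedge 2 2 (\<omega> 1) (\<omega> 3) v = ?Q 3 4 4 6 - ?Q 3 4 3 5 + ?Q 5 6 4 6 - ?Q 5 6 3 5"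
    "wedge 2 2 (\<omega> 2) (\<omega> 1) v = ?Q 3 6 3 4 + ?Q 3 6 5 6 + ?Q 4 5 3 4 + ?Q 4 5 5 6"
    "wedge 2 2 (\<omega> 2) (\<omega> 2) v = ?Q 3 6 3 6 + ?Q 3 6 4 5 + ?Q 4 5 3 6 + ?Q 4 5 4 5"
    "wedge 2 2 (\<omega> 2) (\<omega> 3) v = ?Q 3 6 4 6 - ?Q 3 6 3 5 + ?Q 4 5 4 6 - ?Q 4 5 3 5"
    "wedge 2 2 (\<omega> 3) (\<omega> 1) v = ?Q 4 6 3 4 + ?Q 4 6 5 6 - ?Q 3 5 3 4 - ?Q 3 5 5 6"
    "wedge 2 2 (\<omega> 3) (\<omega> 2) v = ?Q 4 6 3 6 + ?Q 4 6 4 5 - ?Q 3 5 3 6 - ?Q 3 5 4 5"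
    "wedge 2 2 (\<omega> 3) (\<omega> 3) v = ?Q 4 6 4 6 - ?Q 4 6 3 5 - ?Q 3 5 4 6 + ?Q 3 5 3 5"
    by (simp_all add: W w_def minor_product_def algebra_simps)
  have Q: "?Q 5 6 3 4 = ?Q 3 4 5 6" "?Q 3 6 4 5 = ?Q 3 4 5 6" "?Q 4 5 3 6 = ?Q 3 4 5 6"
    "?Q 3 5 4 6 = - ?Q 3 4 5 6" "?Q 4 6 3 5 = - ?Q 3 4 5 6"
    using minor_product_swap[of \<epsilon> 3 5 4 6 v] minor_product_swap[of \<epsilon> 3 6 4 5 v]
      minor_product_last[of \<epsilon> 3 4 6 5 v]
      minor_product_commute[of \<epsilon> 5 6 3 4 v] minor_product_commute[of \<epsilon> 4 5 3 6 v]
      minor_product_commute[of \<epsilon> 4 6 3 5 v] by linarith+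
  show "wedge 2 2 (\<omega> i) (\<omega> j) v = (if i = j then wedge 2 2 (\<omega> 1) (\<omega> 1) v else 0)"
    using cases[OF assms(1)] cases[OF assms(2)]
    by (elim disjE; simp only: expand minor_product_repeated Q) simp_all
qed

lemma wedge_\<eta>_\<omega>2:
  assumes v: "v 0 \<in> T" "v 1 \<in> T" "v 2 \<in> T"
  shows "wedge 1 2 \<eta> (\<omega> 2) v =
    - \<epsilon> 2 (v 0) * (minor \<epsilon> 3 6 (v 1) (v 2) + minor \<epsilon> 4 5 (v 1) (v 2))
    + \<epsilon> 2 (v 1) * (minor \<epsilon> 3 6 (v 0) (v 2) + minor \<epsilon> 4 5 (v 0) (v 2))
    - \<epsilon> 2 (v 2) * (minor \<epsilon> 3 6 (v 0) (v 1) + minor \<epsilon> 4 5 (v 0) (v 1))"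
  using wedge_1_2[where T = T and a = "\<lambda>X. - \<epsilon> 2 X" and b = "\<lambda>X Y. minor \<epsilon> 3 6 X Y + minor \<epsilon> 4 5 X Y",
      where \<alpha> = \<eta> and \<beta> = "\<omega> 2" and v = v, OF \<eta> \<omega>2 _ v] by (simp add: minor_def)

lemma wedge_\<eta>_\<omega>3:
  assumes v: "v 0 \<in> T" "v 1 \<in> T" "v 2 \<in> T"
  shows "wedge 1 2 \<eta> (\<omega> 3) v =
    \<epsilon> 2 (v 0) * (minor \<epsilon> 3 5 (v 1) (v 2) - minor \<epsilon> 4 6 (v 1) (v 2))
    - \<epsilon> 2 (v 1) * (minor \<epsilon> 3 5 (v 0) (v 2) - minor \<epsilon> 4 6 (v 0) (v 2))
    + \<epsilon> 2 (v 2) * (minor \<epsilon> 3 5 (v 0) (v 1) - minor \<epsilon> 4 6 (v 0) (v 1))"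
  using wedge_1_2[where T = T and a = "\<lambda>X. - \<epsilon> 2 X" and b = "\<lambda>X Y. minor \<epsilon> 4 6 X Y - minor \<epsilon> 3 5 X Y",
      where \<alpha> = \<eta> and \<beta> = "\<omega> 3" and v = v, OF \<eta> \<omega>3 _ v] by (simp add: minor_def algebra_simps)

text \<open>On the basis dual to the coframe the 5-form takes the value \<open>- 2\<close>.\<close>

lemma wedge_volume_nonzero:
  assumes "alt_form T 1 \<eta>" "alt_form T 2 (\<omega> 1)"
  shows "\<not> form_eq T 5 (wedge 4 1 (wedge 2 2 (\<omega> 1) (\<omega> 1)) \<eta>) (\<lambda>v. 0)"
proof
  assume eq: "form_eq T 5 (wedge 4 1 (wedge 2 2 (\<omega> 1) (\<omega> 1)) \<eta>) (\<lambda>v. 0)"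
  \<comment> \<open>the basis dual to \<open>\<epsilon> 3, \<epsilon> 4, \<epsilon> 5, \<epsilon> 6, \<epsilon> 2\<close>, in this order\<close>
  define k where "k = (\<lambda>i. if i = 4 then 2 else i + 3 :: nat)"
  have "\<exists>X\<in>T. \<forall>j\<in>{2..6}. \<epsilon> j X = (if j = k i then 1 else 0)" for i
    by (rule dual_vector[of "\<lambda>j. if j = k i then 1 else 0"]) blast
  then obtain v where v: "\<And>i. v i \<in> T"
    "\<And>i j. j \<in> {2..6} \<Longrightarrow> \<epsilon> j (v i) = (if j = k i then 1 else 0)" by metis
  have alt: "alt_form T 4 (wedge 2 2 (\<omega> 1) (\<omega> 1))"
    using alt_form_wedge[OF assms(2,2) tangent_space_tcomb[OF atlas]] by simp
  have "wedge 4 1 (wedge 2 2 (\<omega> 1) (\<omega> 1)) \<eta> v = wedge 2 2 (\<omega> 1) (\<omega> 1) v * \<eta> (\<lambda>_. v 4)"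
  proof (rule wedge_covector_last[OF atlas alt assms(1)])
    show "\<eta> (\<lambda>_. v i) = 0" if "i < 4" for i
      using that v by (simp add: \<eta> k_def)
  qed (simp add: v)
  also have "\<eta> (\<lambda>_. v 4) = - 1" using v by (simp add: \<eta> k_def)
  also have "wedge 2 2 (\<omega> 1) (\<omega> 1) v = 2"
    using wedge_2_2[where T = T and a = "\<lambda>X Y. minor \<epsilon> 3 4 X Y + minor \<epsilon> 5 6 X Y"
        and b = "\<lambda>X Y. minor \<epsilon> 3 4 X Y + minor \<epsilon> 5 6 X Y"
        and \<alpha> = "\<omega> 1" and \<beta> = "\<omega> 1" and v = v, OF \<omega>1 _ \<omega>1 _ v(1) v(1) v(1) v(1)] v(2)
    by (simp add: minor_def k_def)
  finally show False using eq v(1) by (simp add: form_eq_def)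
qed

text \<open>The three forms are related by almost complex structures, so that the hypothesis determines
  the components 3 to 6 of \<open>Y\<close> as a rotation of those of \<open>X\<close>, and \<open>\<omega> 3\<close> becomes the sum of the
  squares of these components. Testing the hypothesis on dual vectors gives the rotation.\<close>

lemma \<omega>3_nonneg:
  assumes X: "X \<in> T" and Y: "Y \<in> T" and eq: "form_eq T 1 (contract X (\<omega> 1)) (contract Y (\<omega> 2))"
  shows "0 \<le> contract X (\<omega> 3) (\<lambda>_. Y)"
proof -
  have Z: "minor \<epsilon> 3 4 X Z + minor \<epsilon> 5 6 X Z = minor \<epsilon> 3 6 Y Z + minor \<epsilon> 4 5 Y Z" if "Z \<in> T" for Z
  proof -
    have "contract X (\<omega> 1) (\<lambda>_. Z) = contract Y (\<omega> 2) (\<lambda>_. Z)"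
      using eq that by (simp add: form_eq_def)
    then show ?thesis
      using X Y that \<omega>1[of "case_nat X (\<lambda>_. Z)"] \<omega>2[of "case_nat Y (\<lambda>_. Z)"]
      by (simp add: contract_def)
  qed
  obtain Z3 where "Z3 \<in> T" "\<epsilon> 3 Z3 = 1" "\<epsilon> 4 Z3 = 0" "\<epsilon> 5 Z3 = 0" "\<epsilon> 6 Z3 = 0"
    by (rule dual_vector[of "\<lambda>i. if i = 3 then 1 else 0"]) simp
  then have "\<epsilon> 6 Y = \<epsilon> 4 X" using Z[of Z3] by (simp add: minor_def)
  moreover obtain Z4 where "Z4 \<in> T" "\<epsilon> 3 Z4 = 0" "\<epsilon> 4 Z4 = 1" "\<epsilon> 5 Z4 = 0" "\<epsilon> 6 Z4 = 0"
    by (rule dual_vector[of "\<lambda>i. if i = 4 then 1 else 0"]) simp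
  then have "\<epsilon> 5 Y = - \<epsilon> 3 X" using Z[of Z4] by (simp add: minor_def)
  moreover obtain Z5 where "Z5 \<in> T" "\<epsilon> 3 Z5 = 0" "\<epsilon> 4 Z5 = 0" "\<epsilon> 5 Z5 = 1" "\<epsilon> 6 Z5 = 0"
    by (rule dual_vector[of "\<lambda>i. if i = 5 then 1 else 0"]) simp
  then have "\<epsilon> 4 Y = - \<epsilon> 6 X" using Z[of Z5] by (simp add: minor_def)
  moreover obtain Z6 where "Z6 \<in> T" "\<epsilon> 3 Z6 = 0" "\<epsilon> 4 Z6 = 0" "\<epsilon> 5 Z6 = 0" "\<epsilon> 6 Z6 = 1"
    by (rule dual_vector[of "\<lambda>i. if i = 6 then 1 else 0"]) simp
  then have "\<epsilon> 3 Y = \<epsilon> 5 X" using Z[of Z6] by (simp add: minor_def)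
  ultimately have "contract X (\<omega> 3) (\<lambda>_. Y)
      = \<epsilon> 3 X * \<epsilon> 3 X + \<epsilon> 4 X * \<epsilon> 4 X + \<epsilon> 5 X * \<epsilon> 5 X + \<epsilon> 6 X * \<epsilon> 6 X"
    using X Y by (simp add: contract_def \<omega>3 minor_def)
  then show ?thesis by simp
qed

end

section \<open>Hypersurfaces of nearly Kaehler manifolds\<close>

text \<open>The second equation differentiates a product of two forms that both involve the normal, but
  this product is the pullback of \<open>\<Psi>\<^sub>-\<close>, so the derivative of the normal field does not enter.\<close>

theorem proposition3p5:
  fixes A :: "('n::{t2_space, second_countable_topology}, 5) chart set"
    and B :: "('m::{t2_space, second_countable_topology}, 6) chart set"
    and f :: "'n \<Rightarrow> 'm"
    and F \<Psi>p \<Psi>m :: "('m, 6) form"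
    and \<nu> :: "'n \<Rightarrow> ('m, 6) tvec"
    and \<eta> :: "('n, 5) form"
    and \<omega> :: "nat \<Rightarrow> ('n, 5) form"
  assumes "oriented_atlas A"
    and "oriented_atlas B"
    and "nearly_kaehler B F \<Psi>p \<Psi>m"
    and "immersion A B f"
    and "unit_normal_field A B f F \<Psi>p \<Psi>m \<nu>"
    and "\<eta> = pull A B f (\<lambda>p v. - contract (\<nu> p) (F (f p)) v)"
    and "\<omega> 1 = pullback A B f F"
    and "\<omega> 2 = pull A B f (\<lambda>p. contract (\<nu> p) (\<Psi>m (f p)))"
    and "\<omega> 3 = pull A B f (\<lambda>p v. - contract (\<nu> p) (\<Psi>p (f p)) v)"
  shows "nearly_hypo A \<eta> \<omega>"
proof -
  have A: "smooth_atlas A" and B: "smooth_atlas B"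
    using assms(1,2) by (simp_all add: oriented_atlas_def)
  have su3: "su3_structure B F \<Psi>p \<Psi>m"
    and dF: "\<And>p. form_eq (tangent_space B p) 3 (ext_d B 2 F p) (\<lambda>v. 3 * \<Psi>p p v)"
    and d\<Psi>m: "\<And>p. form_eq (tangent_space B p) 4 (ext_d B 3 \<Psi>m p) (\<lambda>v. - 2 * wedge 2 2 (F p) (F p) v)"
    using assms(3) by (simp_all add: nearly_kaehler_def)
  have smooth: "smooth_form B 2 F" "smooth_form B 3 \<Psi>p" "smooth_form B 3 \<Psi>m"
    using su3 by (simp_all add: su3_structure_def)
  have f: "smooth_map A B f" using assms(4) by (simp add: immersion_def)
  have \<nu>: "smooth_field_along A B f \<nu>" using assms(5) by (simp add: unit_normal_field_def)
  have D: "differential A B f p X \<in> tangent_space B (f p)" if "X \<in> tangent_space A p" for p X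
    using differential_in_tangent_space[OF A B f that] .

  have s\<eta>: "smooth_form A 1 \<eta>"
    using smooth_form_uminus[OF A smooth_form_pull_contract[OF A B f _ \<nu>, of 1 F]] smooth(1)
    unfolding assms(6) by (simp add: pull_def numeral_2_eq_2)
  have s\<omega>1: "smooth_form A 2 (\<omega> 1)"
    unfolding assms(7) by (rule smooth_form_pullback[OF A B f smooth(1)])
  have s\<omega>2: "smooth_form A 2 (\<omega> 2)"
    unfolding assms(8) using smooth_form_pull_contract[OF A B f _ \<nu>, of 2 \<Psi>m] smooth(3)
    by (simp add: numeral_3_eq_3 numeral_2_eq_2)
  have s\<omega>3: "smooth_form A 2 (\<omega> 3)"
    using smooth_form_uminus[OF A smooth_form_pull_contract[OF A B f _ \<nu>, of 2 \<Psi>p]] smooth(2)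
    unfolding assms(9) by (simp add: pull_def numeral_3_eq_3 numeral_2_eq_2)
  have alt: "alt_form (tangent_space A p) 1 (\<eta> p)" "alt_form (tangent_space A p) 2 (\<omega> 1 p)" for p
    using smooth_form_alt_form[OF s\<eta>] smooth_form_alt_form[OF s\<omega>1] by blast+

  have pointwise: "\<exists>\<epsilon>. su2_coframe A p \<epsilon> (\<eta> p) (\<lambda>i. \<omega> i p)
      \<and> (\<forall>v. (\<forall>i<3. v i \<in> tangent_space A p) \<longrightarrow>
          \<Psi>p (f p) (\<lambda>i. differential A B f p (v i)) = wedge 1 2 (\<eta> p) (\<omega> 2 p) v
        \<and> \<Psi>m (f p) (\<lambda>i. differential A B f p (v i)) = wedge 1 2 (\<eta> p) (\<omega> 3 p) v)" for p
  proof -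
    obtain \<epsilon> where lin: "\<And>i a X b Y. X \<in> tangent_space A p \<Longrightarrow> Y \<in> tangent_space A p \<Longrightarrow>
        \<epsilon> i (tcomb a X b Y) = a * \<epsilon> i X + b * \<epsilon> i Y"
      and sep: "\<And>X. X \<in> tangent_space A p \<Longrightarrow> (\<And>i. i \<in> {2..6} \<Longrightarrow> \<epsilon> i X = 0) \<Longrightarrow> X = (\<lambda>_. 0)"
      and nf: "\<And>v. v 0 \<in> tangent_space A p \<Longrightarrow>
          contract (\<nu> p) (F (f p)) (\<lambda>i. differential A B f p (v i)) = \<epsilon> 2 (v 0)"
        "\<And>v. v 0 \<in> tangent_space A p \<Longrightarrow> v 1 \<in> tangent_space A p \<Longrightarrow>
          F (f p) (\<lambda>i. differential A B f p (v i)) = minor \<epsilon> 3 4 (v 0) (v 1) + minor \<epsilon> 5 6 (v 0) (v 1)"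
        "\<And>v. v 0 \<in> tangent_space A p \<Longrightarrow> v 1 \<in> tangent_space A p \<Longrightarrow>
          contract (\<nu> p) (\<Psi>p (f p)) (\<lambda>i. differential A B f p (v i))
            = minor \<epsilon> 3 5 (v 0) (v 1) - minor \<epsilon> 4 6 (v 0) (v 1)"
        "\<And>v. v 0 \<in> tangent_space A p \<Longrightarrow> v 1 \<in> tangent_space A p \<Longrightarrow>
          contract (\<nu> p) (\<Psi>m (f p)) (\<lambda>i. differential A B f p (v i))
            = minor \<epsilon> 3 6 (v 0) (v 1) + minor \<epsilon> 4 5 (v 0) (v 1)"
      and vol: "\<And>v. v 0 \<in> tangent_space A p \<Longrightarrow> v 1 \<in> tangent_space A p \<Longrightarrow> v 2 \<in> tangent_space A p \<Longrightarrow>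
          \<Psi>p (f p) (\<lambda>i. differential A B f p (v i))
            = - \<epsilon> 2 (v 0) * (minor \<epsilon> 3 6 (v 1) (v 2) + minor \<epsilon> 4 5 (v 1) (v 2))
            + \<epsilon> 2 (v 1) * (minor \<epsilon> 3 6 (v 0) (v 2) + minor \<epsilon> 4 5 (v 0) (v 2))
            - \<epsilon> 2 (v 2) * (minor \<epsilon> 3 6 (v 0) (v 1) + minor \<epsilon> 4 5 (v 0) (v 1))"
        "\<And>v. v 0 \<in> tangent_space A p \<Longrightarrow> v 1 \<in> tangent_space A p \<Longrightarrow> v 2 \<in> tangent_space A p \<Longrightarrow>
          \<Psi>m (f p) (\<lambda>i. differential A B f p (v i))
            = \<epsilon> 2 (v 0) * (minor \<epsilon> 3 5 (v 1) (v 2) - minor \<epsilon> 4 6 (v 1) (v 2))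
            - \<epsilon> 2 (v 1) * (minor \<epsilon> 3 5 (v 0) (v 2) - minor \<epsilon> 4 6 (v 0) (v 2))
            + \<epsilon> 2 (v 2) * (minor \<epsilon> 3 5 (v 0) (v 1) - minor \<epsilon> 4 6 (v 0) (v 1))"
      by (rule hypersurface_normal_form[OF A B su3 assms(4,5), of p]) blast
    interpret su2_coframe A p \<epsilon> "\<eta> p" "\<lambda>i. \<omega> i p"
      by unfold_locales
        (simp_all only: A lin sep nf assms(6-9) pull_def pullback_def minus_diff_eq)
    have "\<Psi>p (f p) (\<lambda>i. differential A B f p (v i)) = wedge 1 2 (\<eta> p) (\<omega> 2 p) v
        \<and> \<Psi>m (f p) (\<lambda>i. differential A B f p (v i)) = wedge 1 2 (\<eta> p) (\<omega> 3 p) v"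
      if "\<forall>i<3. v i \<in> tangent_space A p" for v
      using that vol[of v] wedge_\<eta>_\<omega>2[of v] wedge_\<eta>_\<omega>3[of v] by simp
    then show ?thesis using su2_coframe_axioms by blast
  qed

  have su2: "su2_structure A \<eta> \<omega>"
    unfolding su2_structure_def
  proof (intro conjI ballI allI impI exI[of _ "\<lambda>p. wedge 2 2 (\<omega> 1 p) (\<omega> 1 p)"])
    show "smooth_form A 1 \<eta>" by (rule s\<eta>)
    show "smooth_form A 2 (\<omega> i)" if "i \<in> {1..3}" for i
    proof -
      have "i = 1 \<or> i = 2 \<or> i = 3" using that by auto
      then show ?thesis using s\<omega>1 s\<omega>2 s\<omega>3 by blast
    qed
    show "smooth_form A 4 (\<lambda>p. wedge 2 2 (\<omega> 1 p) (\<omega> 1 p))"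
      using smooth_form_wedge[OF A s\<omega>1 s\<omega>1] by simp
  next
    fix i j :: nat and p assume ij: "i \<in> {1..3}" "j \<in> {1..3}"
    obtain \<epsilon> where "su2_coframe A p \<epsilon> (\<eta> p) (\<lambda>i. \<omega> i p)" using pointwise by blast
    then interpret su2_coframe A p \<epsilon> "\<eta> p" "\<lambda>i. \<omega> i p" .
    show "form_eq (tangent_space A p) 4 (wedge 2 2 (\<omega> i p) (\<omega> j p))
        (\<lambda>v. if i = j then wedge 2 2 (\<omega> 1 p) (\<omega> 1 p) v else 0)"
      by (rule wedge_\<omega>_\<omega>[OF ij])
  next
    fix p
    obtain \<epsilon> where "su2_coframe A p \<epsilon> (\<eta> p) (\<lambda>i. \<omega> i p)" using pointwise by blast
    then interpret su2_coframe A p \<epsilon> "\<eta> p" "\<lambda>i. \<omega> i p" .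
    show "\<not> form_eq (tangent_space A p) 5 (wedge 4 1 (wedge 2 2 (\<omega> 1 p) (\<omega> 1 p)) (\<eta> p)) (\<lambda>v. 0)"
      by (rule wedge_volume_nonzero[OF alt])
  next
    fix p X Y
    assume XY: "X \<in> tangent_space A p" "Y \<in> tangent_space A p"
      "form_eq (tangent_space A p) 1 (contract X (\<omega> 1 p)) (contract Y (\<omega> 2 p))"
    obtain \<epsilon> where "su2_coframe A p \<epsilon> (\<eta> p) (\<lambda>i. \<omega> i p)" using pointwise by blast
    then interpret su2_coframe A p \<epsilon> "\<eta> p" "\<lambda>i. \<omega> i p" .
    show "0 \<le> contract X (\<omega> 3 p) (\<lambda>_. Y)" by (rule \<omega>3_nonneg[OF XY])
  qed

  have "form_eq (tangent_space A p) 3 (ext_d A 2 (\<omega> 1) p) (\<lambda>v. 3 * wedge 1 2 (\<eta> p) (\<omega> 2 p) v)" for p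
    unfolding form_eq_def
  proof (intro allI impI)
    fix v :: "nat \<Rightarrow> ('n, 5) tvec" assume v: "\<forall>i<3. v i \<in> tangent_space A p"
    have "ext_d A 2 (\<omega> 1) p v = ext_d B 2 F (f p) (\<lambda>i. differential A B f p (v i))"
      unfolding assms(7) by (rule ext_d_pullback[OF A B f smooth(1)])
    also have "\<dots> = 3 * \<Psi>p (f p) (\<lambda>i. differential A B f p (v i))"
      using dF[of "f p"] D v by (simp add: form_eq_def)
    also have "\<dots> = 3 * wedge 1 2 (\<eta> p) (\<omega> 2 p) v" using pointwise[of p] v by auto
    finally show "ext_d A 2 (\<omega> 1) p v = 3 * wedge 1 2 (\<eta> p) (\<omega> 2 p) v" .
  qed
  moreover have "form_eq (tangent_space A p) 4 (ext_d A 3 (\<lambda>q. wedge 1 2 (\<eta> q) (\<omega> 3 q)) p)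
      (\<lambda>v. - 2 * wedge 2 2 (\<omega> 1 p) (\<omega> 1 p) v)" for p
    unfolding form_eq_def
  proof (intro allI impI)
    fix v :: "nat \<Rightarrow> ('n, 5) tvec" assume v: "\<forall>i<4. v i \<in> tangent_space A p"
    have "ext_d A 3 (\<lambda>q. wedge 1 2 (\<eta> q) (\<omega> 3 q)) p v = ext_d A 3 (pullback A B f \<Psi>m) p v"
    proof (rule ext_d_cong[OF A smooth_form_pullback[OF A B f smooth(3)], symmetric])
      show "form_eq (tangent_space A q) 3 (pullback A B f \<Psi>m q) (wedge 1 2 (\<eta> q) (\<omega> 3 q))" for q
        using pointwise[of q] by (auto simp: form_eq_def pullback_def pull_def)
    qed
    also have "\<dots> = ext_d B 3 \<Psi>m (f p) (\<lambda>i. differential A B f p (v i))"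
      by (rule ext_d_pullback[OF A B f smooth(3)])
    also have "\<dots> = - 2 * wedge 2 2 (F (f p)) (F (f p)) (\<lambda>i. differential A B f p (v i))"
      using d\<Psi>m[of "f p"] D v by (simp add: form_eq_def)
    also have "\<dots> = - 2 * wedge 2 2 (\<omega> 1 p) (\<omega> 1 p) v"
      unfolding assms(7) by (simp add: wedge_def pullback_def pull_def)
    finally show "ext_d A 3 (\<lambda>q. wedge 1 2 (\<eta> q) (\<omega> 3 q)) p v
        = - 2 * wedge 2 2 (\<omega> 1 p) (\<omega> 1 p) v" .
  qed
  ultimately show ?thesis using su2 by (simp add: nearly_hypo_def)
qed

end
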